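(* Let $(G/H,\mathbf{G})$ be a homogeneous spray manifold with a linear decomposition $\mathfrak{g}=\mathfrak{h}+\mathfrak{m}$. Suppose that the $\mathrm{Ad}(H)$-action on $\mathfrak{g}/\mathfrak{h}$ is unimodular. Then for $\mathbf{G}$ and any $G$-invariant smooth measure $\mathrm{d}\mu$ on $G/H$, the S-curvature satisfies $$\mathbf{S}(o,y)=\mathrm{Tr}_\mathbb{R}(N(y,\cdot)+\mathrm{ad}_\mathfrak{m}(y)),$$ for any $y\in\mathfrak{m}\backslash\{0\}=T_o(G/H)\backslash\{0\}$. Here $\mathrm{ad}_\mathfrak{m}(y):\mathfrak{m}\rightarrow\mathfrak{m}$ is the linear map $w\mapsto[y,w]_\mathfrak{m}$.
   Context: A spray structure on a smooth manifold $M$ is a smooth tangent vector field $\mathbf{G}$ on the slit tangent bundle $TM\backslash 0$ which, in every standard local coordinate $(x^i,y^j)$ (i.e. $x=(x^i)\in M$, $y=y^j\partial_{x^j}\in T_xM$), has the form $\mathbf{G}=y^i\partial_{x^i}-2\mathbf{G}^i\partial_{y^i}$, where $\mathbf{G}^i(x,\lambda y)=\lambda^2\mathbf{G}^i(x,y)$ for all $\lambda>0$. Denote $\mathbf{N}^i_j=\frac{\partial}{\partial y^j}\mathbf{G}^i$. A smooth curve $c(t)$ with nowhere-vanishing $\dot c(t)$ is a geodesic if $(c(t),\dot c(t))$ is an integral curve of $\mathbf{G}$. S-curvature: given a smooth measure $\mathrm{d}\mu=\sigma(x)\mathrm{d}x^1\cdots\mathrm{d}x^n$ ($\sigma$ smooth,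 nowhere vanishing), the S-curvature of $\mathbf{G}$ and $\mathrm{d}\mu$ is the function on $TM\backslash0$ given in any standard local coordinate by $\mathbf{S}(x,y)=\mathbf{N}^i_i(x,y)-\frac{y^i}{\sigma(x)}\frac{\partial}{\partial x^i}\sigma(x)$. Homogeneous spray manifold $(G/H,\mathbf{G})$: $G$ is a Lie group, $H$ a closed subgroup, $o=eH$, and $\mathbf{G}$ is a spray structure on $G/H$ with $(g_* )_*\mathbf{G}=\mathbf{G}$ for all $g\in G$. A linear decomposition $\mathfrak{g}=\mathfrak{h}+\mathfrak{m}$ is a direct sum of vector spaces ($\mathfrak{g}=\mathrm{Lie}(G)=T_eG$, $\mathfrak{h}=\mathrm{Lie}(H)$); $\mathfrak{m}$ is identified with $T_o(G/H)$ via the differential at $e$ of $g\mapsto g\cdot o$; $[\cdot,\cdot]_\mathfrak{m}$ is the Lie bracket of $\mathfrak{g}$ followed by projection to $\mathfrak{m}$. The $\mathrm{Ad}(H)$-action on $\mathfrak{g}/\mathfrak{h}$ is unimodular if for each $g\in H$ the determinant of $\mathrm{Ad}(g):\mathfrak{g}/\mathfrak{h}\to\mathfrak{g}/\mathfrak{h}$ is $\pm1$. $L_g$ is left translation on $G$. Spray vector field: any smooth curve $c(t)$ on $G/H$ with $c(0)=o$ and nowhere-vanishing $\dot c(t)$ has a unique lift $\overline{c}(t)$ to $G$, defined around $t=0$, with $\overline{c}(0)=e$, $c(t)=\overline{c}(t)\cdot o$ and $(L_{\overline{c}(t)^{-1}})_*(\dot{\overline{c}}(t))\in\mathfrak{m}\backslash\{0\}$.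 For $y\in\mathfrak{m}\backslash\{0\}$ let $c_y(t)$ be the geodesic with $c_y(0)=o$, $\dot c_y(0)=y$, and $\overline{c}_y(t)$ its lift; then $\eta(y)=-\frac{\mathrm{d}}{\mathrm{d}t}|_{t=0}(L_{\overline{c}_y(t)^{-1}})_*(\dot{\overline{c}}_y(t))$, a smooth map $\mathfrak{m}\backslash\{0\}\to\mathfrak{m}$. Connection operator: $N(y,u)=\frac12D\eta(y,u)-\frac12[y,u]_\mathfrak{m}$ with $D\eta(y,u)=\frac{\mathrm{d}}{\mathrm{d}t}|_{t=0}\eta(y+tu)$, $y\in\mathfrak{m}\backslash\{0\}$, $u\in\mathfrak{m}$. *)

theory Defs
  imports
    "HOL-Analysis.Analysis"
    "HOL-Algebra.Left_Coset"
    "HOL-Library.Function_Algebras"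
begin

section \<open>Smooth maps between Euclidean spaces\<close>

primrec Ck_on ::
  "nat \<Rightarrow> 'a::euclidean_space set \<Rightarrow> ('a \<Rightarrow> 'b::euclidean_space) \<Rightarrow> bool" where
  "Ck_on 0 S f \<longleftrightarrow> continuous_on S f"
| "Ck_on (Suc k) S f \<longleftrightarrow>
     (\<forall>x\<in>S. f differentiable (at x)) \<and>
     (\<forall>v. Ck_on k S (\<lambda>x. frechet_derivative f (at x) v))"

text \<open>Only used for open sets \<open>S\<close>.\<close>

definition smooth_on :: "'a::euclidean_space set \<Rightarrow> ('a \<Rightarrow> 'b::euclidean_space) \<Rightarrow> bool" where
  "smooth_on S f \<longleftrightarrow> (\<forall>k. Ck_on k S f)"


section \<open>Smooth manifolds\<close>

text \<open>A chart is a pair of its domain and a coordinate map; the values of the coordinate map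
  outside the domain are irrelevant.\<close>

type_synonym ('a, 'e) chart = "'a set \<times> ('a \<Rightarrow> 'e)"

definition chart_inv :: "('a, 'e) chart \<Rightarrow> 'e \<Rightarrow> 'a" where
  "chart_inv c = inv_into (fst c) (snd c)"

definition chart_img :: "('a, 'e) chart \<Rightarrow> 'e set" where
  "chart_img c = snd c ` fst c"

definition transition :: "('a, 'e) chart \<Rightarrow> ('a, 'e) chart \<Rightarrow> 'e \<Rightarrow> 'e" where
  "transition c d = snd d \<circ> chart_inv c"

definition is_chart :: "'a topology \<Rightarrow> ('a, 'e::euclidean_space) chart \<Rightarrow> bool" where
  "is_chart X c \<longleftrightarrow> openin X (fst c) \<and> open (chart_img c) \<and>
     homeomorphic_map (subtopology X (fst c)) (top_of_set (chart_img c)) (snd c)"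

definition smoothly_compatible ::
  "('a, 'e::euclidean_space) chart \<Rightarrow> ('a, 'e) chart \<Rightarrow> bool" where
  "smoothly_compatible c d \<longleftrightarrow>
     smooth_on (snd c ` (fst c \<inter> fst d)) (transition c d) \<and>
     smooth_on (snd d ` (fst c \<inter> fst d)) (transition d c)"

text \<open>The atlas is maximal, so its elements are exactly the standard local coordinates.\<close>

definition smooth_manifold :: "'a topology \<Rightarrow> ('a, 'e::euclidean_space) chart set \<Rightarrow> bool" where
  "smooth_manifold X A \<longleftrightarrow>
     Hausdorff_space X \<and> second_countable X \<and>
     (\<Union>c\<in>A. fst c) = topspace X \<and>
     (\<forall>c\<in>A. is_chart X c) \<and>
     (\<forall>c\<in>A. \<forall>d\<in>A. smoothly_compatible c d) \<and>
     (\<forall>c. is_chart X c \<longrightarrow> (\<forall>d\<in>A. smoothly_compatible c d) \<longrightarrow> c \<in> A)"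

text \<open>The remaining notions only need a (not necessarily maximal) smooth atlas.  Continuity of
  a smooth map is part of the existence of the neighbourhood \<open>W\<close>.\<close>

definition smooth_map ::
  "('a, 'e::euclidean_space) chart set \<Rightarrow> ('b, 'f::euclidean_space) chart set
     \<Rightarrow> ('a \<Rightarrow> 'b) \<Rightarrow> bool" where
  "smooth_map A B f \<longleftrightarrow>
     (\<forall>c\<in>A. \<forall>p\<in>fst c. (\<exists>d\<in>B. f p \<in> fst d) \<and>
        (\<forall>d\<in>B. f p \<in> fst d \<longrightarrow>
           (\<exists>W. open W \<and> snd c p \<in> W \<and> W \<subseteq> chart_img c \<and>
                (\<forall>x\<in>W. f (chart_inv c x) \<in> fst d) \<and>
                smooth_on W (snd d \<circ> f \<circ> chart_inv c))))"

definition prod_atlas ::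
  "('a, 'e) chart set \<Rightarrow> ('b, 'f) chart set \<Rightarrow> ('a \<times> 'b, 'e \<times> 'f) chart set" where
  "prod_atlas A B = (\<lambda>(c, d). (fst c \<times> fst d, map_prod (snd c) (snd d))) ` (A \<times> B)"


section \<open>Tangent vectors\<close>

text \<open>Vectors are functions, with pointwise operations.\<close>

instantiation "fun" :: (type, real_vector) real_vector
begin

definition scaleR_fun :: "real \<Rightarrow> ('a \<Rightarrow> 'b) \<Rightarrow> 'a \<Rightarrow> 'b" where
  "scaleR_fun r f = (\<lambda>x. r *\<^sub>R f x)"

instance
  by standard (auto simp: scaleR_fun_def fun_eq_iff scaleR_add_right scaleR_add_left)

end

text \<open>A tangent vector at \<open>p\<close> is the family of its components in all charts around \<open>p\<close>,
  which transform by the Jacobian of the transition maps.  The components in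
  all other charts are set to zero, so that the family is determined by the vector.\<close>

type_synonym ('a, 'e) tvec = "('a, 'e) chart \<Rightarrow> 'e"

definition tangent_space ::
  "('a, 'e::euclidean_space) chart set \<Rightarrow> 'a \<Rightarrow> ('a, 'e) tvec set" where
  "tangent_space A p = {v.
     (\<forall>c. c \<notin> A \<or> p \<notin> fst c \<longrightarrow> v c = 0) \<and>
     (\<forall>c\<in>A. \<forall>d\<in>A. p \<in> fst c \<inter> fst d \<longrightarrow>
        v d = frechet_derivative (transition c d) (at (snd c p)) (v c))}"

definition tangent_map ::
  "('a, 'e::euclidean_space) chart set \<Rightarrow> ('b, 'f::euclidean_space) chart set
     \<Rightarrow> ('a \<Rightarrow> 'b) \<Rightarrow> 'a \<Rightarrow> ('a, 'e) tvec \<Rightarrow> ('b, 'f) tvec" where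
  "tangent_map A B f p v = (\<lambda>d.
     if d \<in> B \<and> f p \<in> fst d then
       (let c = (SOME c. c \<in> A \<and> p \<in> fst c) in
          frechet_derivative (snd d \<circ> f \<circ> chart_inv c) (at (snd c p)) (v c))
     else 0)"

definition bundle_map ::
  "('a, 'e::euclidean_space) chart set \<Rightarrow> ('b, 'f::euclidean_space) chart set
     \<Rightarrow> ('a \<Rightarrow> 'b) \<Rightarrow> 'a \<times> ('a, 'e) tvec \<Rightarrow> 'b \<times> ('b, 'f) tvec" where
  "bundle_map A B f = (\<lambda>(p, v). (f p, tangent_map A B f p v))"

definition smooth_submersion ::
  "('a, 'e::euclidean_space) chart set \<Rightarrow> ('b, 'f::euclidean_space) chart set
     \<Rightarrow> ('a \<Rightarrow> 'b) \<Rightarrow> bool" where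
  "smooth_submersion A B f \<longleftrightarrow> smooth_map A B f \<and>
     (\<forall>p\<in>(\<Union>c\<in>A. fst c). tangent_map A B f p ` tangent_space A p = tangent_space B (f p))"

definition smooth_curve ::
  "('a, 'e::euclidean_space) chart set \<Rightarrow> real set \<Rightarrow> (real \<Rightarrow> 'a) \<Rightarrow> bool" where
  "smooth_curve A I \<gamma> \<longleftrightarrow> smooth_map {(I, \<lambda>t. t)} A \<gamma>"

definition velocity ::
  "('a, 'e::euclidean_space) chart set \<Rightarrow> (real \<Rightarrow> 'a) \<Rightarrow> real \<Rightarrow> ('a, 'e) tvec" where
  "velocity A \<gamma> t = (\<lambda>c.
     if c \<in> A \<and> \<gamma> t \<in> fst c then vector_derivative (snd c \<circ> \<gamma>) (at t) else 0)"

text \<open>Derivative of a curve in one fixed tangent space (a finite-dimensional vector space),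
  computed on components.\<close>

definition tvec_deriv :: "(real \<Rightarrow> ('a, 'e::euclidean_space) tvec) \<Rightarrow> real \<Rightarrow> ('a, 'e) tvec" where
  "tvec_deriv w t = (\<lambda>c. vector_derivative (\<lambda>s. w s c) (at t))"

definition vf_in_chart ::
  "('a, 'e) chart \<Rightarrow> ('a \<Rightarrow> ('a, 'e) tvec) \<Rightarrow> 'e \<Rightarrow> 'e" where
  "vf_in_chart c X = (\<lambda>x. X (chart_inv c x) c)"

definition smooth_vector_field ::
  "('a, 'e::euclidean_space) chart set \<Rightarrow> ('a \<Rightarrow> ('a, 'e) tvec) \<Rightarrow> bool" where
  "smooth_vector_field A X \<longleftrightarrow>
     (\<forall>p\<in>(\<Union>c\<in>A. fst c). X p \<in> tangent_space A p) \<and>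
     (\<forall>c\<in>A. smooth_on (chart_img c) (vf_in_chart c X))"

definition integral_curve ::
  "('a, 'e::euclidean_space) chart set \<Rightarrow> ('a \<Rightarrow> ('a, 'e) tvec) \<Rightarrow> real set
     \<Rightarrow> (real \<Rightarrow> 'a) \<Rightarrow> bool" where
  "integral_curve A X I \<gamma> \<longleftrightarrow> smooth_curve A I \<gamma> \<and> (\<forall>t\<in>I. velocity A \<gamma> t = X (\<gamma> t))"

text \<open>In coordinates, \<open>[X, Y]\<^sup>i = X\<^sup>j \<partial>\<^sub>j Y\<^sup>i - Y\<^sup>j \<partial>\<^sub>j X\<^sup>i\<close>.\<close>

definition vf_bracket ::
  "('a, 'e::euclidean_space) chart set \<Rightarrow> ('a \<Rightarrow> ('a, 'e) tvec) \<Rightarrow> ('a \<Rightarrow> ('a, 'e) tvec)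
     \<Rightarrow> 'a \<Rightarrow> ('a, 'e) tvec" where
  "vf_bracket A X Y p = (\<lambda>c.
     if c \<in> A \<and> p \<in> fst c then
       frechet_derivative (vf_in_chart c Y) (at (snd c p)) (X p c)
       - frechet_derivative (vf_in_chart c X) (at (snd c p)) (Y p c)
     else 0)"


section \<open>Sprays\<close>

text \<open>The standard coordinates \<open>(x, y)\<close> on the slit tangent bundle induced by a chart.\<close>

definition lift_chart ::
  "('a, 'e::euclidean_space) chart set \<Rightarrow> ('a, 'e) chart
     \<Rightarrow> ('a \<times> ('a, 'e) tvec, 'e \<times> 'e) chart" where
  "lift_chart A c =
     ({(p, v). p \<in> fst c \<and> v \<in> tangent_space A p \<and> v \<noteq> 0}, \<lambda>(p, v). (snd c p, v c))"

definition slit_atlas ::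
  "('a, 'e::euclidean_space) chart set \<Rightarrow> ('a \<times> ('a, 'e) tvec, 'e \<times> 'e) chart set" where
  "slit_atlas A = lift_chart A ` A"

definition slit_bundle ::
  "('a, 'e::euclidean_space) chart set \<Rightarrow> ('a \<times> ('a, 'e) tvec) set" where
  "slit_bundle A = (\<Union>C\<in>slit_atlas A. fst C)"

type_synonym ('a, 'e) slit_vf =
  "'a \<times> ('a, 'e) tvec \<Rightarrow> ('a \<times> ('a, 'e) tvec, 'e \<times> 'e) tvec"

definition spray_coeff ::
  "('a, 'e::euclidean_space) chart set \<Rightarrow> ('a, 'e) slit_vf \<Rightarrow> ('a, 'e) chart
     \<Rightarrow> 'e \<Rightarrow> 'e \<Rightarrow> 'e" where
  "spray_coeff A S c x y = (- 1/2) *\<^sub>R snd (vf_in_chart (lift_chart A c) S (x, y))"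

definition spray :: "('a, 'e::euclidean_space) chart set \<Rightarrow> ('a, 'e) slit_vf \<Rightarrow> bool" where
  "spray A S \<longleftrightarrow> smooth_vector_field (slit_atlas A) S \<and>
     (\<forall>c\<in>A. \<forall>x\<in>chart_img c. \<forall>y. y \<noteq> 0 \<longrightarrow>
        vf_in_chart (lift_chart A c) S (x, y) = (y, - 2 *\<^sub>R spray_coeff A S c x y) \<and>
        (\<forall>l>0. spray_coeff A S c x (l *\<^sub>R y) = l\<^sup>2 *\<^sub>R spray_coeff A S c x y))"

definition geodesic ::
  "('a, 'e::euclidean_space) chart set \<Rightarrow> ('a, 'e) slit_vf \<Rightarrow> real set
     \<Rightarrow> (real \<Rightarrow> 'a) \<Rightarrow> bool" where
  "geodesic A S I c \<longleftrightarrow> smooth_curve A I c \<and> (\<forall>t\<in>I. velocity A c t \<noteq> 0) \<and>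
     integral_curve (slit_atlas A) S I (\<lambda>t. (c t, velocity A c t))"


section \<open>Smooth measures and S-curvature\<close>

definition local_density ::
  "'a measure \<Rightarrow> ('a, 'e::euclidean_space) chart \<Rightarrow> ('e \<Rightarrow> real) \<Rightarrow> bool" where
  "local_density \<mu> c \<sigma> \<longleftrightarrow>
     smooth_on (chart_img c) \<sigma> \<and> (\<forall>x\<in>chart_img c. \<sigma> x > 0) \<and>
     (\<forall>E\<in>sets \<mu>. E \<subseteq> fst c \<longrightarrow>
        emeasure \<mu> E = (\<integral>\<^sup>+x\<in>snd c ` E. ennreal (\<sigma> x) \<partial>lborel))"

definition smooth_measure ::
  "'a topology \<Rightarrow> ('a, 'e::euclidean_space) chart set \<Rightarrow> 'a measure \<Rightarrow> bool" where
  "smooth_measure X A \<mu> \<longleftrightarrow>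
     space \<mu> = topspace X \<and>
     sets \<mu> = sigma_sets (topspace X) {U. openin X U} \<and>
     (\<forall>c\<in>A. \<exists>\<sigma>. local_density \<mu> c \<sigma>)"

text \<open>The S-curvature at the tangent vector \<open>v\<close> at \<open>p\<close>, computed in the chart \<open>c\<close>.
  The first sum is \<open>N\<^sup>i\<^sub>i\<close>, where \<open>N\<^sup>i\<^sub>j = \<partial>G\<^sup>i/\<partial>y\<^sup>j\<close>.  A local density is
  uniquely determined on the image of the chart.\<close>

definition S_curvature ::
  "('a, 'e::euclidean_space) chart set \<Rightarrow> ('a, 'e) slit_vf \<Rightarrow> 'a measure \<Rightarrow> ('a, 'e) chart
     \<Rightarrow> 'a \<Rightarrow> ('a, 'e) tvec \<Rightarrow> real" where
  "S_curvature A S \<mu> c p v =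
     (let x = snd c p; y = v c; \<sigma> = (SOME \<sigma>. local_density \<mu> c \<sigma>) in
        (\<Sum>b\<in>Basis. frechet_derivative (spray_coeff A S c x) (at y) b \<bullet> b)
        - (\<Sum>b\<in>Basis. (y \<bullet> b) / \<sigma> x * frechet_derivative \<sigma> (at x) b))"


section \<open>Linear algebra\<close>

definition direct_sum_of ::
  "'v::real_vector set \<Rightarrow> 'v set \<Rightarrow> 'v set \<Rightarrow> bool" where
  "direct_sum_of V W W' \<longleftrightarrow> subspace V \<and> subspace W \<and> subspace W' \<and>
     V = {a + b | a b. a \<in> W \<and> b \<in> W'} \<and> W \<inter> W' = {0}"

text \<open>The projection to \<open>W'\<close> along \<open>W\<close>.\<close>

definition proj_along :: "'v::real_vector set \<Rightarrow> 'v set \<Rightarrow> 'v \<Rightarrow> 'v" where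
  "proj_along W W' v = (THE w. w \<in> W' \<and> v - w \<in> W)"

definition lin_trace :: "'v::real_vector set \<Rightarrow> ('v \<Rightarrow> 'v) \<Rightarrow> real" where
  "lin_trace V f =
     (let B = (SOME B. independent B \<and> span B = V) in \<Sum>b\<in>B. representation B (f b) b)"

text \<open>The determinant of the endomorphism of \<open>V/W\<close> induced by \<open>f\<close>: the classes of the elements
  of \<open>B\<close> form a basis of \<open>V/W\<close>, and the coordinates of the class of \<open>f b\<close>
  are those of the representative of that class in the span of \<open>B\<close>.\<close>

definition quotient_det :: "'v::real_vector set \<Rightarrow> 'v set \<Rightarrow> ('v \<Rightarrow> 'v) \<Rightarrow> real" where
  "quotient_det V W f =
     (let B = (SOME B. independent B \<and> direct_sum_of V W (span B)) in
        \<Sum>p | p permutes B. of_int (sign p) *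
          (\<Prod>b\<in>B. representation B (proj_along W (span B) (f b)) (p b)))"


section \<open>Lie groups and their homogeneous spaces\<close>

definition lie_group ::
  "('g, 'z) monoid_scheme \<Rightarrow> 'g topology \<Rightarrow> ('g, 'e::euclidean_space) chart set \<Rightarrow> bool" where
  "lie_group G TG AG \<longleftrightarrow>
     group G \<and> topspace TG = carrier G \<and> smooth_manifold TG AG \<and>
     smooth_map (prod_atlas AG AG) AG (\<lambda>(g, h). g \<otimes>\<^bsub>G\<^esub> h) \<and>
     smooth_map AG AG (\<lambda>g. inv\<^bsub>G\<^esub> g)"

definition left_trans :: "('g, 'z) monoid_scheme \<Rightarrow> 'g \<Rightarrow> 'g \<Rightarrow> 'g" where
  "left_trans G g = (\<lambda>h. g \<otimes>\<^bsub>G\<^esub> h)"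

abbreviation lie_algebra ::
  "('g, 'z) monoid_scheme \<Rightarrow> ('g, 'e::euclidean_space) chart set \<Rightarrow> ('g, 'e) tvec set" where
  "lie_algebra G AG \<equiv> tangent_space AG \<one>\<^bsub>G\<^esub>"

definition left_invariant_vf ::
  "('g, 'z) monoid_scheme \<Rightarrow> ('g, 'e::euclidean_space) chart set \<Rightarrow> ('g, 'e) tvec
     \<Rightarrow> 'g \<Rightarrow> ('g, 'e) tvec" where
  "left_invariant_vf G AG u = (\<lambda>g. tangent_map AG AG (left_trans G g) \<one>\<^bsub>G\<^esub> u)"

definition lie_bracket ::
  "('g, 'z) monoid_scheme \<Rightarrow> ('g, 'e::euclidean_space) chart set
     \<Rightarrow> ('g, 'e) tvec \<Rightarrow> ('g, 'e) tvec \<Rightarrow> ('g, 'e) tvec" where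
  "lie_bracket G AG u v =
     vf_bracket AG (left_invariant_vf G AG u) (left_invariant_vf G AG v) \<one>\<^bsub>G\<^esub>"

text \<open>The Lie algebra of a closed subgroup, i.e. its tangent space at the identity: smooth curves
  in the (embedded) Lie subgroup are the smooth curves in the ambient group with values in it.\<close>

definition subgroup_lie_algebra ::
  "('g, 'z) monoid_scheme \<Rightarrow> ('g, 'e::euclidean_space) chart set \<Rightarrow> 'g set
     \<Rightarrow> ('g, 'e) tvec set" where
  "subgroup_lie_algebra G AG H =
     {velocity AG \<gamma> 0 | \<gamma> \<epsilon>. \<epsilon> > 0 \<and> smooth_curve AG {-\<epsilon><..<\<epsilon>} \<gamma> \<and>
        \<gamma> 0 = \<one>\<^bsub>G\<^esub> \<and> (\<forall>t\<in>{-\<epsilon><..<\<epsilon>}. \<gamma> t \<in> H)}"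

definition Ad ::
  "('g, 'z) monoid_scheme \<Rightarrow> ('g, 'e::euclidean_space) chart set
     \<Rightarrow> 'g \<Rightarrow> ('g, 'e) tvec \<Rightarrow> ('g, 'e) tvec" where
  "Ad G AG g = tangent_map AG AG (\<lambda>k. g \<otimes>\<^bsub>G\<^esub> k \<otimes>\<^bsub>G\<^esub> inv\<^bsub>G\<^esub> g) \<one>\<^bsub>G\<^esub>"

definition Ad_unimodular ::
  "('g, 'z) monoid_scheme \<Rightarrow> ('g, 'e::euclidean_space) chart set \<Rightarrow> 'g set \<Rightarrow> bool" where
  "Ad_unimodular G AG H \<longleftrightarrow>
     (\<forall>g\<in>H. \<bar>quotient_det (lie_algebra G AG) (subgroup_lie_algebra G AG H) (Ad G AG g)\<bar> = 1)"

definition coset_proj :: "('g, 'z) monoid_scheme \<Rightarrow> 'g set \<Rightarrow> 'g \<Rightarrow> 'g set" where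
  "coset_proj G H = (\<lambda>g. g <#\<^bsub>G\<^esub> H)"

definition coset_act :: "('g, 'z) monoid_scheme \<Rightarrow> 'g \<Rightarrow> 'g set \<Rightarrow> 'g set" where
  "coset_act G g = (\<lambda>P. g <#\<^bsub>G\<^esub> P)"

text \<open>\<open>TM\<close> and \<open>AM\<close> are the quotient topology and the canonical smooth structure on the
  set \<open>G/H\<close> of left cosets, that is, the unique one for which the projection is a smooth
  submersion and the action of \<open>G\<close> is smooth.\<close>

definition homogeneous_space ::
  "('g, 'z) monoid_scheme \<Rightarrow> 'g topology \<Rightarrow> ('g, 'e::euclidean_space) chart set \<Rightarrow> 'g set
     \<Rightarrow> 'g set topology \<Rightarrow> ('g set, 'f::euclidean_space) chart set \<Rightarrow> bool" where
  "homogeneous_space G TG AG H TM AM \<longleftrightarrow>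
     lie_group G TG AG \<and> subgroup H G \<and> closedin TG H \<and>
     topspace TM = lcosets\<^bsub>G\<^esub> H \<and> quotient_map TG TM (coset_proj G H) \<and>
     smooth_manifold TM AM \<and> smooth_submersion AG AM (coset_proj G H) \<and>
     smooth_map (prod_atlas AG AM) AM (\<lambda>(g, P). coset_act G g P)"

definition invariant_spray ::
  "('g, 'z) monoid_scheme \<Rightarrow> ('g set, 'f::euclidean_space) chart set
     \<Rightarrow> ('g set, 'f) slit_vf \<Rightarrow> bool" where
  "invariant_spray G AM S \<longleftrightarrow>
     (\<forall>g\<in>carrier G. \<forall>z\<in>slit_bundle AM.
        tangent_map (slit_atlas AM) (slit_atlas AM) (bundle_map AM AM (coset_act G g)) z (S z)
        = S (bundle_map AM AM (coset_act G g) z))"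

definition homogeneous_spray_manifold ::
  "('g, 'z) monoid_scheme \<Rightarrow> 'g topology \<Rightarrow> ('g, 'e::euclidean_space) chart set \<Rightarrow> 'g set
     \<Rightarrow> 'g set topology \<Rightarrow> ('g set, 'f::euclidean_space) chart set
     \<Rightarrow> ('g set, 'f) slit_vf \<Rightarrow> bool" where
  "homogeneous_spray_manifold G TG AG H TM AM S \<longleftrightarrow>
     homogeneous_space G TG AG H TM AM \<and> spray AM S \<and> invariant_spray G AM S"

definition invariant_measure ::
  "('g, 'z) monoid_scheme \<Rightarrow> 'g set measure \<Rightarrow> bool" where
  "invariant_measure G \<mu> \<longleftrightarrow>
     (\<forall>g\<in>carrier G. \<forall>E\<in>sets \<mu>. emeasure \<mu> (coset_act G g ` E) = emeasure \<mu> E)"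


section \<open>Spray vector field and connection operator\<close>

text \<open>The identification of \<open>m\<close> with the tangent space of \<open>G/H\<close> at the base point, which is
  the coset \<open>H\<close>.\<close>

definition base_tangent ::
  "('g, 'z) monoid_scheme \<Rightarrow> ('g, 'e::euclidean_space) chart set \<Rightarrow> 'g set
     \<Rightarrow> ('g set, 'f::euclidean_space) chart set \<Rightarrow> ('g, 'e) tvec \<Rightarrow> ('g set, 'f) tvec" where
  "base_tangent G AG H AM = tangent_map AG AM (coset_proj G H) \<one>\<^bsub>G\<^esub>"

definition left_velocity ::
  "('g, 'z) monoid_scheme \<Rightarrow> ('g, 'e::euclidean_space) chart set \<Rightarrow> (real \<Rightarrow> 'g)
     \<Rightarrow> real \<Rightarrow> ('g, 'e) tvec" where
  "left_velocity G AG \<gamma> t =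
     tangent_map AG AG (left_trans G (inv\<^bsub>G\<^esub> (\<gamma> t))) (\<gamma> t) (velocity AG \<gamma> t)"

definition is_lift ::
  "('g, 'z) monoid_scheme \<Rightarrow> ('g, 'e::euclidean_space) chart set \<Rightarrow> 'g set \<Rightarrow> ('g, 'e) tvec set
     \<Rightarrow> real set \<Rightarrow> (real \<Rightarrow> 'g set) \<Rightarrow> (real \<Rightarrow> 'g) \<Rightarrow> bool" where
  "is_lift G AG H m I c \<gamma> \<longleftrightarrow>
     smooth_curve AG I \<gamma> \<and> \<gamma> 0 = \<one>\<^bsub>G\<^esub> \<and>
     (\<forall>t\<in>I. c t = coset_act G (\<gamma> t) H \<and> left_velocity G AG \<gamma> t \<in> m - {0})"

text \<open>The lift of the geodesic with initial vector \<open>y\<close>; its germ at \<open>0\<close> is unique.\<close>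

definition geodesic_lift ::
  "('g, 'z) monoid_scheme \<Rightarrow> ('g, 'e::euclidean_space) chart set \<Rightarrow> 'g set
     \<Rightarrow> ('g set, 'f::euclidean_space) chart set \<Rightarrow> ('g set, 'f) slit_vf \<Rightarrow> ('g, 'e) tvec set
     \<Rightarrow> ('g, 'e) tvec \<Rightarrow> real \<Rightarrow> 'g" where
  "geodesic_lift G AG H AM S m y =
     (SOME \<gamma>. \<exists>\<epsilon>>0. \<exists>c. geodesic AM S {-\<epsilon><..<\<epsilon>} c \<and> c 0 = H \<and>
        velocity AM c 0 = base_tangent G AG H AM y \<and> is_lift G AG H m {-\<epsilon><..<\<epsilon>} c \<gamma>)"

definition spray_vector_field ::
  "('g, 'z) monoid_scheme \<Rightarrow> ('g, 'e::euclidean_space) chart set \<Rightarrow> 'g set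
     \<Rightarrow> ('g set, 'f::euclidean_space) chart set \<Rightarrow> ('g set, 'f) slit_vf \<Rightarrow> ('g, 'e) tvec set
     \<Rightarrow> ('g, 'e) tvec \<Rightarrow> ('g, 'e) tvec" where
  "spray_vector_field G AG H AM S m y =
     - tvec_deriv (left_velocity G AG (geodesic_lift G AG H AM S m y)) 0"

definition bracket_m ::
  "('g, 'z) monoid_scheme \<Rightarrow> ('g, 'e::euclidean_space) chart set \<Rightarrow> 'g set \<Rightarrow> ('g, 'e) tvec set
     \<Rightarrow> ('g, 'e) tvec \<Rightarrow> ('g, 'e) tvec \<Rightarrow> ('g, 'e) tvec" where
  "bracket_m G AG H m u v = proj_along (subgroup_lie_algebra G AG H) m (lie_bracket G AG u v)"

definition connection_operator ::
  "('g, 'z) monoid_scheme \<Rightarrow> ('g, 'e::euclidean_space) chart set \<Rightarrow> 'g set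
     \<Rightarrow> ('g set, 'f::euclidean_space) chart set \<Rightarrow> ('g set, 'f) slit_vf \<Rightarrow> ('g, 'e) tvec set
     \<Rightarrow> ('g, 'e) tvec \<Rightarrow> ('g, 'e) tvec \<Rightarrow> ('g, 'e) tvec" where
  "connection_operator G AG H AM S m y u =
     (1/2) *\<^sub>R tvec_deriv (\<lambda>t. spray_vector_field G AG H AM S m (y + t *\<^sub>R u)) 0
     - (1/2) *\<^sub>R bracket_m G AG H m y u"

end

theory Submission
  imports Defs
begin

text \<open>Work in a chart of \<open>G\<close> at the identity, with coordinate \<open>z\<close>, and in the given chart of \<open>G/H\<close> at the base
point, with coordinate \<open>x\<close>; the identity is \<open>z0\<close> and the base point \<open>x0\<close>.  Let \<open>pr\<close> be the
projection and \<open>B z\<close> the differential at \<open>x0\<close> of the action of the group element \<open>z\<close>, so that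
\<open>B z0\<close> is the identity, and put \<open>a y v = D\<^sub>z(B z v)(z0)[y]\<close>.  The differential \<open>P\<close> of \<open>pr\<close> at
\<open>z0\<close> has kernel \<open>h\<close> (lemma \<open>kernel_subgroup_lie_algebra\<close>) and therefore restricts to an isomorphism from \<open>m\<close>
to the model space; \<open>R\<close> is its inverse.  Every term of the formula can be expressed by \<open>a\<close>, by
the spray coefficients \<open>Gs\<close> and by the density \<open>\<sigma>\<close> of the measure.

\<^item> A curve \<open>z(t)\<close> in \<open>G\<close> with left velocity \<open>u(t)\<close> in \<open>m\<close> projects to a curve \<open>x(t)\<close> with
  \<open>x' = B z (P u)\<close>.  If \<open>x\<close> is the geodesic with initial vector \<open>P y\<close>, then differentiating at
  \<open>t = 0\<close> and comparing with \<open>x'' = - 2 Gs x x'\<close> gives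
  \<open>P (\<eta> y) = 2 Gs x0 (P y) + a y (P y)\<close> for the spray vector field \<open>\<eta>\<close>
  (lemma \<open>spray_vector_field_eq\<close>).

\<^item> The projection maps the left-invariant field of \<open>u\<close> to \<open>B z (P u)\<close>.  As the second
  derivative of \<open>pr\<close> is symmetric, it cancels from the commutator of two such fields, and
  \<open>P [y, u] = a y (P u) - a u (P y)\<close> (lemma \<open>P_lie_bracket\<close>).

\<^item> In \<open>N(y, u) + [y, u]\<^sub>m = D\<eta>(y, u)/2 + [y, u]\<^sub>m/2\<close> the terms \<open>a u (P y)\<close> cancel, so \<open>P\<close> carries
  this operator to \<open>v \<mapsto> D(Gs x0)(P y) v + a y v\<close> (lemma \<open>connection_operator_eq\<close>).  The trace of the
  first summand is the term \<open>N\<^sup>i\<^sub>i\<close> of the S-curvature.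

\<^item> Invariance of the measure reads \<open>\<sigma> (pr z) \<bar>det (B z)\<bar> = \<sigma> x0\<close>.  Its derivative at
  \<open>z0\<close> in the direction \<open>y\<close> is \<open>D\<sigma>(x0)[P y] + \<sigma> x0 tr (a y) = 0\<close>, so the trace of the second summand is
  the term of the S-curvature that involves the measure (lemma \<open>density_derivative\<close>).

The spray vector field is defined by means of a chosen lift of a geodesic; that one exists follows
from the local solvability of ordinary differential equations with smooth right-hand sides
(lemmas \<open>ode_local_existence\<close> and \<open>geodesic_lift_exists\<close>).\<close>

section \<open>Smooth maps on Euclidean spaces\<close>

abbreviation DD :: "('a::real_normed_vector \<Rightarrow> 'b::real_normed_vector) \<Rightarrow> 'a \<Rightarrow> 'a \<Rightarrow> 'b" where
  "DD f x \<equiv> frechet_derivative f (at x)"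

lemma DD_works: "f differentiable (at x) \<Longrightarrow> (f has_derivative DD f x) (at x)"
  using frechet_derivative_works by blast

lemma DD_eq: "(f has_derivative f') (at x) \<Longrightarrow> DD f x = f'"
  by (rule frechet_derivative_at[symmetric])

lemma DD_bounded_linear: "f differentiable (at x) \<Longrightarrow> bounded_linear (DD f x)"
  using DD_works has_derivative_bounded_linear by blast

lemma DD_cong_open:
  assumes "open S" "x \<in> S" "\<And>y. y \<in> S \<Longrightarrow> f y = g y"
  shows "DD f x = DD g x"
proof -
  have "(f has_derivative f') (at x) \<longleftrightarrow> (g has_derivative f') (at x)" for f'
    by (metis assms has_derivative_transform_within_open)
  then show ?thesis unfolding frechet_derivative_def by simp
qed

lemma differentiable_cong_open:
  assumes "open S" "x \<in> S" "\<And>y. y \<in> S \<Longrightarrow> f y = g y" "f differentiable (at x)"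
  shows "g differentiable (at x)"
  using assms unfolding differentiable_def by (metis has_derivative_transform_within_open)

lemma DD_compose:
  assumes "f differentiable (at x)" "g differentiable (at (f x))"
  shows "DD (\<lambda>x. g (f x)) x v = DD g (f x) (DD f x v)"
  using DD_eq[OF diff_chain_at[OF DD_works[OF assms(1)] DD_works[OF assms(2)]]]
  by (simp add: comp_def)

lemma DD_compose_linear:
  assumes "f differentiable (at x)" "bounded_linear h"
  shows "DD (\<lambda>x. h (f x)) x v = h (DD f x v)"
  using DD_eq[OF bounded_linear.has_derivative[OF assms(2) DD_works[OF assms(1)]]] by simp

lemma DD_slice_snd:
  assumes "f differentiable (at (z, x))"
  shows "DD (\<lambda>x. f (z, x)) x v = DD f (z, x) (0, v)"
proof -
  have "((\<lambda>x. (z, x)) has_derivative (\<lambda>v. (0, v))) (at x)"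
    by (auto intro!: derivative_eq_intros)
  from has_derivative_compose[OF this DD_works[OF assms]]
  show ?thesis by (metis DD_eq)
qed

lemma DD_slice_fst:
  assumes "f differentiable (at (z, x))"
  shows "DD (\<lambda>z. f (z, x)) z v = DD f (z, x) (v, 0)"
proof -
  have "((\<lambda>z. (z, x)) has_derivative (\<lambda>v. (v, 0))) (at z)"
    by (auto intro!: derivative_eq_intros)
  from has_derivative_compose[OF this DD_works[OF assms]]
  show ?thesis by (metis DD_eq)
qed

text \<open>Differentiating a map of two arguments along a curve: the two partial derivatives are added.
This is how \<open>x' = B z (P u)\<close> will be differentiated, where both \<open>z\<close> and \<open>u\<close> depend on time.\<close>

lemma DD_pair_chain:
  assumes Q: "Q differentiable (at (f s, g s))" and f: "f differentiable (at s)" and g: "g differentiable (at s)"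
  shows "DD (\<lambda>s. Q (f s, g s)) s w
    = DD (\<lambda>z. Q (z, g s)) (f s) (DD f s w) + DD (\<lambda>v. Q (f s, v)) (g s) (DD g s w)"
proof -
  have "((\<lambda>s. (f s, g s)) has_derivative (\<lambda>w. (DD f s w, DD g s w))) (at s)"
    by (intro has_derivative_Pair DD_works f g)
  from DD_eq[OF has_derivative_compose[OF this DD_works[OF Q]]]
  have "DD (\<lambda>s. Q (f s, g s)) s w = DD Q (f s, g s) (DD f s w, DD g s w)" by metis
  also have "(DD f s w, DD g s w) = (DD f s w, 0) + (0, DD g s w)" by simp
  also have "DD Q (f s, g s) \<dots> = DD Q (f s, g s) (DD f s w, 0) + DD Q (f s, g s) (0, DD g s w)"
    by (rule linear_add[OF linear_frechet_derivative[OF Q]])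
  finally show ?thesis by (simp add: DD_slice_fst[OF Q] DD_slice_snd[OF Q])
qed

lemma Ck_on_subset: "Ck_on k S f \<Longrightarrow> T \<subseteq> S \<Longrightarrow> Ck_on k T f"
  by (induction k arbitrary: f) (auto intro: continuous_on_subset)

lemma Ck_on_cong_imp:
  assumes "open S" "\<And>x. x \<in> S \<Longrightarrow> f x = g x" "Ck_on k S f"
  shows "Ck_on k S g"
  using assms(2,3)
proof (induction k arbitrary: f g)
  case 0
  then show ?case by (metis Ck_on.simps(1) continuous_on_cong)
next
  case (Suc k)
  have "Ck_on k S (\<lambda>x. DD g x v)" for v
  proof (rule Suc.IH)
    show "Ck_on k S (\<lambda>x. DD f x v)" using Suc.prems(2) by simp
    show "DD f x v = DD g x v" if "x \<in> S" for x
      using DD_cong_open[OF assms(1) that Suc.prems(1)] by simp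
  qed
  moreover have "\<forall>x\<in>S. g differentiable (at x)"
    using Suc.prems differentiable_cong_open[OF assms(1) _ Suc.prems(1)] by simp
  ultimately show ?case by simp
qed

lemma Ck_on_SucD: "Ck_on (Suc k) S f \<Longrightarrow> Ck_on k S f"
proof (induction k arbitrary: f)
  case 0
  then show ?case
    by (auto intro!: continuous_at_imp_continuous_on differentiable_imp_continuous_within)
next
  case (Suc k)
  then show ?case by (metis Ck_on.simps(2))
qed

lemma Ck_on_const: "Ck_on k S (\<lambda>x. c)"
  by (induction k arbitrary: c) auto

lemma Ck_on_bounded_linear:
  assumes "bounded_linear L"
  shows "Ck_on k S L"
proof (cases k)
  case 0
  then show ?thesis by (simp add: assms linear_continuous_on)
next
  case (Suc j)
  have "DD L x = L" for x
    using DD_eq[OF bounded_linear_imp_has_derivative[OF assms]] .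
  then show ?thesis
    using bounded_linear_imp_differentiable[OF assms] by (simp add: Suc Ck_on_const)
qed

lemma Ck_on_linear_compose:
  assumes "open S" "Ck_on k S f" "bounded_linear h"
  shows "Ck_on k S (\<lambda>x. h (f x))"
  using assms(2)
proof (induction k arbitrary: f)
  case 0
  then show ?case
    using bounded_linear.continuous_on[OF assms(3)] by auto
next
  case (Suc k)
  have d: "\<forall>x\<in>S. f differentiable (at x)" using Suc.prems by simp
  have "Ck_on k S (\<lambda>x. DD (\<lambda>x. h (f x)) x v)" for v
    by (rule Ck_on_cong_imp[OF assms(1) _ Suc.IH[of "\<lambda>x. DD f x v"]])
      (use Suc.prems in \<open>simp_all add: DD_compose_linear[OF _ assms(3)]\<close>)
  moreover have "\<forall>x\<in>S. (\<lambda>x. h (f x)) differentiable (at x)"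
    using d bounded_linear.has_derivative[OF assms(3)] unfolding differentiable_def by blast
  ultimately show ?case by simp
qed

lemma Ck_on_add:
  assumes "open S" "Ck_on k S f" "Ck_on k S g"
  shows "Ck_on k S (\<lambda>x. f x + g x)"
  using assms(2,3)
proof (induction k arbitrary: f g)
  case 0
  then show ?case by (auto intro: continuous_intros)
next
  case (Suc k)
  have *: "DD (\<lambda>x. f x + g x) x v = DD f x v + DD g x v" if "x \<in> S" for x v
    using DD_eq[OF has_derivative_add[OF DD_works DD_works], of f x g] Suc.prems that by simp
  have "Ck_on k S (\<lambda>x. DD (\<lambda>x. f x + g x) x v)" for v
    by (rule Ck_on_cong_imp[OF assms(1) _ Suc.IH[of "\<lambda>x. DD f x v" "\<lambda>x. DD g x v"]])
      (use Suc.prems in \<open>simp_all add: *\<close>)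
  then show ?case using Suc.prems by simp
qed

lemma Ck_on_sum:
  assumes "open S" "\<And>i. i \<in> I \<Longrightarrow> Ck_on k S (f i)"
  shows "Ck_on k S (\<lambda>x. \<Sum>i\<in>I. f i x)"
  using assms(2)
  by (induction I rule: infinite_finite_induct) (auto simp: Ck_on_const Ck_on_add[OF assms(1)])

lemma Ck_on_scaleR:
  fixes f :: "'a::euclidean_space \<Rightarrow> real" and g :: "'a \<Rightarrow> 'b::euclidean_space"
  assumes "open S" "Ck_on k S f" "Ck_on k S g"
  shows "Ck_on k S (\<lambda>x. f x *\<^sub>R g x)"
  using assms(2,3)
proof (induction k arbitrary: f g)
  case 0
  then show ?case by (auto intro: continuous_intros)
next
  case (Suc k)
  have *: "DD (\<lambda>x. f x *\<^sub>R g x) x v = f x *\<^sub>R DD g x v + DD f x v *\<^sub>R g x" if "x \<in> S" for x v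
    using DD_eq[OF has_derivative_scaleR[OF DD_works DD_works], of f x g] Suc.prems that by simp
  have "Ck_on k S (\<lambda>x. DD (\<lambda>x. f x *\<^sub>R g x) x v)" for v
    by (rule Ck_on_cong_imp[OF assms(1) _
          Ck_on_add[OF assms(1) Suc.IH[of f "\<lambda>x. DD g x v"] Suc.IH[of "\<lambda>x. DD f x v" g]]])
      (use Suc.prems Ck_on_SucD[OF Suc.prems(1)] Ck_on_SucD[OF Suc.prems(2)] in \<open>simp_all add: *\<close>)
  then show ?case using Suc.prems by simp
qed

text \<open>The chain rule expands \<open>D(g \<circ> f)(x) v\<close> in a basis because only the derivatives of \<open>g\<close> in
  fixed directions are controlled.\<close>

lemma DD_basis_expand:
  assumes "f differentiable (at x)"
  shows "DD f x v = (\<Sum>b\<in>Basis. (v \<bullet> b) *\<^sub>R DD f x b)"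
proof -
  interpret bounded_linear "DD f x" by (rule DD_bounded_linear[OF assms])
  have "DD f x v = DD f x (\<Sum>b\<in>Basis. (v \<bullet> b) *\<^sub>R b)" by (simp add: euclidean_representation)
  then show ?thesis by (simp add: sum scaleR)
qed

text \<open>Since \<open>D(g \<circ> f)(x) v\<close> is a combination of the functions \<open>D g(f(x)) b\<close> for basis vectors \<open>b\<close>, with
coefficients taken from \<open>D f(x) v\<close>, the induction on the order of differentiability applies to
both factors separately.\<close>

lemma Ck_on_compose:
  assumes "open S" "Ck_on k S f" "Ck_on k T g" "f ` S \<subseteq> T"
  shows "Ck_on k S (\<lambda>x. g (f x))"
  using assms(2-4)
proof (induction k arbitrary: f g)
  case 0
  then show ?case using continuous_on_compose2 by auto
next
  case (Suc k)
  have *: "DD (\<lambda>x. g (f x)) x v = (\<Sum>b\<in>Basis. (DD f x v \<bullet> b) *\<^sub>R DD g (f x) b)" if "x \<in> S" for x v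
    using Suc.prems that
    by (subst DD_compose) (auto intro!: DD_basis_expand)
  have "Ck_on k S (\<lambda>x. \<Sum>b\<in>Basis. (DD f x v \<bullet> b) *\<^sub>R DD g (f x) b)" for v
  proof (rule Ck_on_sum[OF assms(1)], rule Ck_on_scaleR[OF assms(1)])
    fix b :: 'b assume "b \<in> Basis"
    show "Ck_on k S (\<lambda>x. DD f x v \<bullet> b)"
      by (rule Ck_on_linear_compose[OF assms(1) _ bounded_linear_inner_left])
        (use Suc.prems(1) in simp)
    show "Ck_on k S (\<lambda>x. DD g (f x) b)"
      by (rule Suc.IH[OF Ck_on_SucD[OF Suc.prems(1)] _ Suc.prems(3)]) (use Suc.prems(2) in simp)
  qed
  then have "Ck_on k S (\<lambda>x. DD (\<lambda>x. g (f x)) x v)" for v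
    by (rule Ck_on_cong_imp[OF assms(1), rotated]) (auto simp: *)
  moreover have "\<forall>x\<in>S. (\<lambda>x. g (f x)) differentiable (at x)"
    using Suc.prems(1,2,3) differentiable_chain_at[unfolded comp_def, of f _ g]
    by (simp add: image_subset_iff)
  ultimately show ?case by simp
qed

lemma smooth_on_subset: "smooth_on S f \<Longrightarrow> T \<subseteq> S \<Longrightarrow> smooth_on T f"
  unfolding smooth_on_def using Ck_on_subset by blast

lemma smooth_on_cong_imp:
  "open S \<Longrightarrow> smooth_on S f \<Longrightarrow> (\<And>x. x \<in> S \<Longrightarrow> f x = g x) \<Longrightarrow> smooth_on S g"
  unfolding smooth_on_def using Ck_on_cong_imp by blast

lemma smooth_on_const: "smooth_on S (\<lambda>x. c)"
  unfolding smooth_on_def using Ck_on_const by blast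

lemma smooth_on_bounded_linear: "bounded_linear L \<Longrightarrow> smooth_on S L"
  unfolding smooth_on_def using Ck_on_bounded_linear by blast

lemma smooth_on_linear_compose:
  "open S \<Longrightarrow> smooth_on S f \<Longrightarrow> bounded_linear h \<Longrightarrow> smooth_on S (\<lambda>x. h (f x))"
  by (simp add: smooth_on_def Ck_on_linear_compose)

lemma smooth_on_add:
  "open S \<Longrightarrow> smooth_on S f \<Longrightarrow> smooth_on S g \<Longrightarrow> smooth_on S (\<lambda>x. f x + g x)"
  by (simp add: smooth_on_def Ck_on_add)

lemma smooth_on_scaleR:
  "open S \<Longrightarrow> smooth_on S f \<Longrightarrow> smooth_on S g \<Longrightarrow> smooth_on S (\<lambda>x. f x *\<^sub>R g x)"
  by (simp add: smooth_on_def Ck_on_scaleR)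

lemma smooth_on_sum:
  "open S \<Longrightarrow> (\<And>i. i \<in> I \<Longrightarrow> smooth_on S (f i)) \<Longrightarrow> smooth_on S (\<lambda>x. \<Sum>i\<in>I. f i x)"
  by (simp add: smooth_on_def Ck_on_sum)

lemma smooth_on_compose:
  "open S \<Longrightarrow> smooth_on S f \<Longrightarrow> smooth_on T g \<Longrightarrow> f ` S \<subseteq> T \<Longrightarrow> smooth_on S (\<lambda>x. g (f x))"
  unfolding smooth_on_def by (metis Ck_on_compose)

lemma smooth_on_Pair:
  assumes "open S" "smooth_on S f" "smooth_on S g"
  shows "smooth_on S (\<lambda>x. (f x, g x))"
proof -
  have "smooth_on S (\<lambda>x. (f x, 0) + (0, g x))"
    by (rule smooth_on_add[OF assms(1)
          smooth_on_linear_compose[OF assms(1,2), of "\<lambda>u. (u, 0)"]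
          smooth_on_linear_compose[OF assms(1,3), of "\<lambda>u. (0, u)"]])
      (rule bounded_linear_Pair bounded_linear_ident bounded_linear_zero)+
  then show ?thesis by simp
qed

lemma smooth_on_differentiable: "smooth_on S f \<Longrightarrow> x \<in> S \<Longrightarrow> f differentiable (at x)"
  unfolding smooth_on_def by (metis Ck_on.simps(2))

lemma smooth_on_continuous: "smooth_on S f \<Longrightarrow> continuous_on S f"
  unfolding smooth_on_def by (metis Ck_on.simps(1))

lemma smooth_on_DD: "smooth_on S f \<Longrightarrow> smooth_on S (\<lambda>x. DD f x v)"
  unfolding smooth_on_def by (metis Ck_on.simps(2))

text \<open>Smoothness is defined by derivatives in constant directions; this is the version for
directions that vary smoothly, again by expansion in a basis.\<close>

lemma smooth_on_DD_apply:
  assumes "open S" "smooth_on S g" "smooth_on S h" "smooth_on T f" "g ` S \<subseteq> T"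
  shows "smooth_on S (\<lambda>x. DD f (g x) (h x))"
proof -
  have "smooth_on S (\<lambda>x. \<Sum>b\<in>Basis. (h x \<bullet> b) *\<^sub>R DD f (g x) b)"
    by (rule smooth_on_sum[OF assms(1)], rule smooth_on_scaleR[OF assms(1)
          smooth_on_linear_compose[OF assms(1,3) bounded_linear_inner_left]
          smooth_on_compose[OF assms(1,2) smooth_on_DD[OF assms(4)] assms(5)]])
  then show ?thesis
    by (rule smooth_on_cong_imp[OF assms(1)])
      (metis DD_basis_expand assms(4,5) image_subset_iff smooth_on_differentiable)
qed


section \<open>Symmetry of second derivatives\<close>

text \<open>Two applications of the mean value theorem to the second difference of \<open>g\<close> over a parallelogram.
The second difference is symmetric in \<open>u\<close> and \<open>v\<close>, and letting \<open>h\<close> tend to zero shows that so is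
the second derivative.\<close>

lemma second_difference_mvt:
  fixes g :: "'a::euclidean_space \<Rightarrow> real"
  assumes "smooth_on S g" "0 < h"
    and S: "\<And>s t. 0 \<le> s \<Longrightarrow> s \<le> h \<Longrightarrow> 0 \<le> t \<Longrightarrow> t \<le> h \<Longrightarrow> x + s *\<^sub>R u + t *\<^sub>R v \<in> S"
  shows "\<exists>s t. 0 < s \<and> s < h \<and> 0 < t \<and> t < h \<and>
    g (x + h *\<^sub>R u + h *\<^sub>R v) - g (x + h *\<^sub>R u) - g (x + h *\<^sub>R v) + g x
    = h * h * DD (\<lambda>y. DD g y u) (x + s *\<^sub>R u + t *\<^sub>R v) v"
proof -
  define \<phi> where "\<phi> s = g (x + s *\<^sub>R u + h *\<^sub>R v) - g (x + s *\<^sub>R u + 0 *\<^sub>R v)" for s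
  have lin: "(\<lambda>a. DD f p (a *\<^sub>R w)) = (\<lambda>a. DD f p w * a)"
    if "f differentiable (at p)" for f :: "'a \<Rightarrow> real" and p w
    using linear_scale[OF bounded_linear.linear[OF DD_bounded_linear[OF that]]]
    by (auto simp: mult.commute)
  have dg: "((\<lambda>s. g (x + s *\<^sub>R u + t *\<^sub>R v)) has_real_derivative DD g (x + s *\<^sub>R u + t *\<^sub>R v) u) (at s)"
    if "0 \<le> s" "s \<le> h" "0 \<le> t" "t \<le> h" for s t
  proof -
    have d: "g differentiable (at (x + s *\<^sub>R u + t *\<^sub>R v))"
      using smooth_on_differentiable[OF assms(1) S] that by blast
    have "((\<lambda>s. x + s *\<^sub>R u + t *\<^sub>R v) has_derivative (\<lambda>a. a *\<^sub>R u)) (at s)"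
      by (auto intro!: derivative_eq_intros)
    from has_derivative_compose[OF this DD_works[OF d]]
    show ?thesis unfolding has_field_derivative_def lin[OF d] .
  qed
  have "\<And>s. 0 \<le> s \<Longrightarrow> s \<le> h \<Longrightarrow>
      (\<phi> has_real_derivative DD g (x + s *\<^sub>R u + h *\<^sub>R v) u - DD g (x + s *\<^sub>R u + 0 *\<^sub>R v) u) (at s)"
    unfolding \<phi>_def using \<open>0 < h\<close> by (intro DERIV_diff dg) auto
  from MVT2[OF \<open>0 < h\<close> this]
  obtain s where s: "0 < s" "s < h"
    "\<phi> h - \<phi> 0 = h * (DD g (x + s *\<^sub>R u + h *\<^sub>R v) u - DD g (x + s *\<^sub>R u + 0 *\<^sub>R v) u)"
    by auto
  define f where "f = (\<lambda>y. DD g y u)"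
  have "((\<lambda>t. f (x + s *\<^sub>R u + t *\<^sub>R v)) has_real_derivative DD f (x + s *\<^sub>R u + t *\<^sub>R v) v) (at t)"
    if "0 \<le> t" "t \<le> h" for t
  proof -
    have d: "f differentiable (at (x + s *\<^sub>R u + t *\<^sub>R v))"
      unfolding f_def using smooth_on_differentiable[OF smooth_on_DD[OF assms(1)] S] that s by auto
    have "((\<lambda>t. x + s *\<^sub>R u + t *\<^sub>R v) has_derivative (\<lambda>a. a *\<^sub>R v)) (at t)"
      by (auto intro!: derivative_eq_intros)
    from has_derivative_compose[OF this DD_works[OF d]]
    show ?thesis unfolding has_field_derivative_def lin[OF d] .
  qed
  from MVT2[OF \<open>0 < h\<close> this]
  obtain t where t: "0 < t" "t < h"
    "f (x + s *\<^sub>R u + h *\<^sub>R v) - f (x + s *\<^sub>R u + 0 *\<^sub>R v) = h * DD f (x + s *\<^sub>R u + t *\<^sub>R v) v"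
    by auto
  have "g (x + h *\<^sub>R u + h *\<^sub>R v) - g (x + h *\<^sub>R u) - g (x + h *\<^sub>R v) + g x = \<phi> h - \<phi> 0"
    by (simp add: \<phi>_def)
  also have "\<dots> = h * h * DD f (x + s *\<^sub>R u + t *\<^sub>R v) v"
    using s(3) t(3) by (simp add: f_def)
  finally show ?thesis using s t unfolding f_def by blast
qed

lemma DD_symmetric_real:
  fixes g :: "'a::euclidean_space \<Rightarrow> real"
  assumes "open S" "x \<in> S" "smooth_on S g"
  shows "DD (\<lambda>y. DD g y u) x v = DD (\<lambda>y. DD g y v) x u"
proof (rule ccontr)
  let ?A = "\<lambda>p. DD (\<lambda>y. DD g y u) p v" and ?B = "\<lambda>p. DD (\<lambda>y. DD g y v) p u"
  assume ne: "?A x \<noteq> ?B x"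
  define \<epsilon> where "\<epsilon> = \<bar>?A x - ?B x\<bar> / 2"
  have "\<epsilon> > 0" using ne by (simp add: \<epsilon>_def)
  have cont: "isCont ?A x" "isCont ?B x"
    using smooth_on_continuous[OF smooth_on_DD[OF smooth_on_DD[OF assms(3)]]] assms(1,2)
    by (auto simp: continuous_on_eq_continuous_at)
  obtain r where r: "r > 0" "ball x r \<subseteq> S" using assms(1,2) open_contains_ball by blast
  obtain d1 where d1: "d1 > 0" "\<And>p. dist p x < d1 \<Longrightarrow> dist (?A p) (?A x) < \<epsilon>"
    using cont(1) \<open>\<epsilon> > 0\<close> unfolding continuous_at_eps_delta by blast
  obtain d2 where d2: "d2 > 0" "\<And>p. dist p x < d2 \<Longrightarrow> dist (?B p) (?B x) < \<epsilon>"
    using cont(2) \<open>\<epsilon> > 0\<close> unfolding continuous_at_eps_delta by blast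
  define d where "d = min r (min d1 d2)"
  define h where "h = d / (1 + norm u + norm v)"
  have pos: "1 + norm u + norm v > 0"
    using norm_ge_zero[of u] norm_ge_zero[of v] by linarith
  have "d > 0" using r d1 d2 by (simp add: d_def)
  then have "h > 0" using pos by (simp add: h_def)
  have hd: "h * (norm u + norm v) < d"
    using \<open>d > 0\<close> pos by (simp add: h_def field_simps)
  have near: "dist (x + s *\<^sub>R u + t *\<^sub>R v) x < d"
    if "0 \<le> s" "s \<le> h" "0 \<le> t" "t \<le> h" for s t
  proof -
    have "dist (x + s *\<^sub>R u + t *\<^sub>R v) x = norm (s *\<^sub>R u + t *\<^sub>R v)"
      by (simp add: dist_norm add.assoc)
    also have "\<dots> \<le> s * norm u + t * norm v"
      using norm_triangle_ineq[of "s *\<^sub>R u" "t *\<^sub>R v"] that by simp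
    also have "\<dots> \<le> h * norm u + h * norm v"
      using that by (intro add_mono mult_right_mono) auto
    finally show ?thesis using hd by (simp add: algebra_simps)
  qed
  have inS: "x + s *\<^sub>R u + t *\<^sub>R v \<in> S" "x + s *\<^sub>R v + t *\<^sub>R u \<in> S"
    if "0 \<le> s" "s \<le> h" "0 \<le> t" "t \<le> h" for s t
    using near[of s t] near[of t s] that r(2)
    by (auto simp: d_def dist_commute algebra_simps subset_iff)
  obtain s t where st: "0 < s" "s < h" "0 < t" "t < h"
    "g (x + h *\<^sub>R u + h *\<^sub>R v) - g (x + h *\<^sub>R u) - g (x + h *\<^sub>R v) + g x
      = h * h * ?A (x + s *\<^sub>R u + t *\<^sub>R v)"
    using second_difference_mvt[OF assms(3) \<open>h > 0\<close> inS(1)] by blast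
  obtain s' t' where st': "0 < s'" "s' < h" "0 < t'" "t' < h"
    "g (x + h *\<^sub>R v + h *\<^sub>R u) - g (x + h *\<^sub>R v) - g (x + h *\<^sub>R u) + g x
      = h * h * ?B (x + s' *\<^sub>R v + t' *\<^sub>R u)"
    using second_difference_mvt[OF assms(3) \<open>h > 0\<close> inS(2)] by blast
  have "h * h * ?A (x + s *\<^sub>R u + t *\<^sub>R v) = h * h * ?B (x + s' *\<^sub>R v + t' *\<^sub>R u)"
    unfolding st(5)[symmetric] st'(5)[symmetric] by (simp add: algebra_simps)
  then have eq: "?A (x + s *\<^sub>R u + t *\<^sub>R v) = ?B (x + s' *\<^sub>R v + t' *\<^sub>R u)"
    using \<open>h > 0\<close> by simp
  have "dist (?A (x + s *\<^sub>R u + t *\<^sub>R v)) (?A x) < \<epsilon>"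
    using d1(2) near[of s t] st by (auto simp: d_def)
  moreover have "dist (?B (x + s' *\<^sub>R v + t' *\<^sub>R u)) (?B x) < \<epsilon>"
    using d2(2) near[of t' s'] st' by (auto simp: d_def algebra_simps)
  ultimately have "\<bar>?A x - ?B x\<bar> < 2 * \<epsilon>"
    unfolding eq by (simp add: dist_real_def)
  then show False by (simp add: \<epsilon>_def)
qed

lemma DD_symmetric:
  assumes "open S" "x \<in> S" "smooth_on S f"
  shows "DD (\<lambda>y. DD f y u) x v = DD (\<lambda>y. DD f y v) x u"
proof (rule euclidean_eqI)
  fix b :: 'b assume "b \<in> Basis"
  define g where "g y = f y \<bullet> b" for y
  have sg: "smooth_on S g"
    unfolding g_def by (rule smooth_on_linear_compose[OF assms(1,3) bounded_linear_inner_left])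
  have Dg: "DD g y w = DD f y w \<bullet> b" if "y \<in> S" for y w
    unfolding g_def
    by (rule DD_compose_linear[OF smooth_on_differentiable[OF assms(3) that] bounded_linear_inner_left])
  have DDg: "DD (\<lambda>y. DD g y w) x z = DD (\<lambda>y. DD f y w) x z \<bullet> b" for w z
  proof -
    have "DD (\<lambda>y. DD g y w) x = DD (\<lambda>y. DD f y w \<bullet> b) x"
      by (rule DD_cong_open[OF assms(1,2)]) (rule Dg)
    then show ?thesis
      using DD_compose_linear[OF smooth_on_differentiable[OF smooth_on_DD[OF assms(3)] assms(2)]
          bounded_linear_inner_left] by metis
  qed
  show "DD (\<lambda>y. DD f y u) x v \<bullet> b = DD (\<lambda>y. DD f y v) x u \<bullet> b"
    using DD_symmetric_real[OF assms(1,2) sg] unfolding DDg .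
qed

text \<open>If \<open>p\<close> maps the vector fields \<open>X\<^sub>i\<close> to \<open>W\<^sub>i\<close>, the second
  derivative of \<open>p\<close> cancels from the commutator by symmetry.\<close>

lemma bracket_related:
  fixes p :: "'a::euclidean_space \<Rightarrow> 'b::euclidean_space"
  assumes "open Z" "z \<in> Z" and p: "smooth_on Z p"
    and X: "X1 differentiable (at z)" "X2 differentiable (at z)"
    and W: "\<And>z. z \<in> Z \<Longrightarrow> DD p z (X1 z) = W1 z" "\<And>z. z \<in> Z \<Longrightarrow> DD p z (X2 z) = W2 z"
  shows "DD p z (DD X2 z (X1 z) - DD X1 z (X2 z)) = DD W2 z (X1 z) - DD W1 z (X2 z)"
proof -
  have dp: "p differentiable (at z)" by (rule smooth_on_differentiable[OF p assms(2)])
  define Q where "Q w = DD p (fst w) (snd w)" for w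
  have op: "open (Z \<times> (UNIV :: 'a set))" using assms(1) by (intro open_Times) auto
  have "smooth_on (Z \<times> UNIV) Q"
    unfolding Q_def
    by (rule smooth_on_DD_apply[OF op smooth_on_bounded_linear[OF bounded_linear_fst]
          smooth_on_bounded_linear[OF bounded_linear_snd] p]) auto
  then have Q: "Q differentiable (at (z, v))" for v
    using assms(2) by (intro smooth_on_differentiable) auto
  have lin: "DD (\<lambda>v. Q (z, v)) v0 = DD p z" for v0
    unfolding Q_def by (simp add: DD_eq[OF bounded_linear_imp_has_derivative[OF DD_bounded_linear[OF dp]]])
  have *: "DD W z w = DD (\<lambda>y. DD p y (X z)) z w + DD p z (DD X z w)"
    if X: "X differentiable (at z)" and W: "\<And>z. z \<in> Z \<Longrightarrow> DD p z (X z) = W z" for X W w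
  proof -
    have "DD W z = DD (\<lambda>y. Q (y, X y)) z"
      by (rule DD_cong_open[OF assms(1,2)]) (simp add: W Q_def)
    then have "DD W z w = DD (\<lambda>y. Q (y, X z)) z w + DD (\<lambda>v. Q (z, v)) (X z) (DD X z w)"
      using DD_pair_chain[of Q "\<lambda>y. y" z X w, OF Q[of "X z"] _ X] by simp
    then show ?thesis unfolding lin by (simp add: Q_def)
  qed
  have "DD W2 z (X1 z) - DD W1 z (X2 z) = DD p z (DD X2 z (X1 z)) - DD p z (DD X1 z (X2 z))"
    using *[OF X(1) W(1), of "X2 z"] *[OF X(2) W(2), of "X1 z"]
      DD_symmetric[OF assms(1,2) p, of "X2 z" "X1 z"] by simp
  then show ?thesis by (simp add: linear_diff[OF linear_frechet_derivative[OF dp]])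
qed


section \<open>Ordinary differential equations\<close>

text \<open>A difference of two integrals that start at \<open>-e\<close> serves as the integral from \<open>0\<close> to \<open>t\<close> for both signs of
\<open>t\<close>, so that a differential equation can be solved forwards and backwards at once.\<close>

lemma signed_integral_bound:
  fixes h :: "real \<Rightarrow> 'a::euclidean_space"
  assumes "continuous_on {-e..e} h" "\<And>s. s \<in> {-e..e} \<Longrightarrow> norm (h s) \<le> M" "t \<in> {-e..e}"
  shows "norm (integral {-e..t} h - integral {-e..0} h) \<le> e * M"
proof -
  have "norm (integral {-e..t} h - integral {-e..0} h) \<le> M * norm (t - 0)"
  proof (rule differentiable_bound[of "{-e..e}" "\<lambda>t. integral {-e..t} h" "\<lambda>s d. d *\<^sub>R h s"])
    fix s assume s: "s \<in> {-e..e}"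
    show "((\<lambda>t. integral {-e..t} h) has_derivative (\<lambda>d. d *\<^sub>R h s)) (at s within {-e..e})"
      using integral_has_vector_derivative[OF assms(1) s] unfolding has_vector_derivative_def .
    show "onorm (\<lambda>d. d *\<^sub>R h s) \<le> M"
      using mult_right_mono[OF assms(2)[OF s] abs_ge_zero] by (intro onorm_le) (simp add: mult.commute)
  qed (use assms(3) in auto)
  also have "\<dots> \<le> M * e"
    using assms(3) order_trans[OF norm_ge_zero assms(2)[OF assms(3)]]
    by (intro mult_left_mono) auto
  finally show ?thesis by (simp add: mult.commute)
qed

lemma smooth_on_lipschitz_cball:
  assumes "smooth_on U F" "cball x r \<subseteq> U"
  shows "\<exists>L>0. \<forall>y\<in>cball x r. \<forall>z\<in>cball x r. norm (F y - F z) \<le> L * norm (y - z)"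
proof -
  define N where "N y = (\<Sum>b\<in>Basis. norm (DD F y b))" for y
  have "continuous_on (cball x r) N"
    unfolding N_def using smooth_on_continuous[OF smooth_on_DD[OF assms(1)]] assms(2)
    by (intro continuous_on_sum continuous_on_norm) (blast intro: continuous_on_subset)
  then have "bounded (N ` cball x r)"
    using compact_cball compact_continuous_image compact_imp_bounded by blast
  then obtain L where L: "L > 0" "\<And>y. y \<in> cball x r \<Longrightarrow> \<bar>N y\<bar> \<le> L"
    unfolding bounded_pos by auto
  have "norm (F y - F z) \<le> L * norm (y - z)" if "y \<in> cball x r" "z \<in> cball x r" for y z
  proof (rule differentiable_bound[of "cball x r" F "\<lambda>y. DD F y"])
    fix p assume p: "p \<in> cball x r"
    have d: "F differentiable (at p)" using smooth_on_differentiable[OF assms(1)] p assms(2) by blast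
    show "(F has_derivative DD F p) (at p within cball x r)"
      using DD_works[OF d] has_derivative_at_withinI by blast
    show "onorm (DD F p) \<le> L"
    proof (rule onorm_le)
      fix v
      have "norm (DD F p v) \<le> (\<Sum>b\<in>Basis. norm ((v \<bullet> b) *\<^sub>R DD F p b))"
        unfolding DD_basis_expand[OF d, of v] by (rule norm_sum)
      also have "\<dots> \<le> (\<Sum>b\<in>Basis. norm v * norm (DD F p b))"
        by (intro sum_mono) (auto intro!: mult_right_mono simp: Basis_le_norm)
      also have "\<dots> = norm v * N p" by (simp add: N_def sum_distrib_left)
      also have "\<dots> \<le> L * norm v"
        using L(2)[OF p] by (metis abs_le_D1 mult.commute mult_right_mono norm_ge_zero)
      finally show "norm (DD F p v) \<le> L * norm v" .
    qed
  qed (use that in auto)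
  then show ?thesis using L(1) by blast
qed

text \<open>Bootstrapping: if \<open>x\<close> is \<open>C\<^sup>k\<close>, then so is \<open>x' = F(x)\<close>, and \<open>x\<close> is \<open>C\<^sup>k\<^sup>+\<^sup>1\<close>.\<close>

lemma ode_solution_smooth:
  fixes x :: "real \<Rightarrow> 'a::euclidean_space"
  assumes "open I" "smooth_on U F"
    and "\<And>t. t \<in> I \<Longrightarrow> x t \<in> U"
    and der: "\<And>t. t \<in> I \<Longrightarrow> (x has_vector_derivative F (x t)) (at t)"
  shows "smooth_on I x"
proof -
  have dx: "DD x t v = v *\<^sub>R F (x t)" if "t \<in> I" for t v
    using DD_eq der[OF that] unfolding has_vector_derivative_def by metis
  have dif: "x differentiable (at t)" if "t \<in> I" for t
    using der[OF that] unfolding has_vector_derivative_def differentiable_def by blast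
  have "Ck_on k I x" for k
  proof (induction k)
    case 0
    then show ?case
      using dif by (auto intro!: continuous_at_imp_continuous_on differentiable_imp_continuous_within)
  next
    case (Suc k)
    have "Ck_on k I (\<lambda>t. F (x t))"
      using assms(2,3) by (intro Ck_on_compose[OF assms(1) Suc, of U]) (auto simp: smooth_on_def)
    then have *: "Ck_on k I (\<lambda>t. v *\<^sub>R F (x t))" for v
      by (rule Ck_on_linear_compose[OF assms(1) _ bounded_linear_scaleR_right])
    have "Ck_on k I (\<lambda>t. DD x t v)" for v
      by (rule Ck_on_cong_imp[OF assms(1) _ *[of v]]) (simp add: dx)
    then show ?case using dif by simp
  qed
  then show ?thesis by (simp add: smooth_on_def)
qed

text \<open>Picard--Lindeloef: a solution is a fixed point of \<open>g \<mapsto> x\<^sub>0 + \<integral>\<^sub>0\<^sup>t F(g(s)) ds\<close>, a contraction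
  on curves in a small ball for short times.  Time is frozen outside \<open>[-e, e]\<close>, which makes this
  an operator on the complete space of bounded continuous functions on the whole line.\<close>

lemma ode_local_existence:
  fixes F :: "'a::euclidean_space \<Rightarrow> 'a"
  assumes "open U" "x0 \<in> U" "smooth_on U F"
  obtains e x where "e > 0" "x 0 = x0" "\<And>t. t \<in> {-e<..<e} \<Longrightarrow> x t \<in> U"
    "\<And>t. t \<in> {-e<..<e} \<Longrightarrow> (x has_vector_derivative F (x t)) (at t)"
    "smooth_on {-e<..<e} x"
proof -
  obtain r where r: "r > 0" "cball x0 r \<subseteq> U" using assms(1,2) open_contains_cball by blast
  obtain L where L: "L > 0"
    "\<And>y z. y \<in> cball x0 r \<Longrightarrow> z \<in> cball x0 r \<Longrightarrow> norm (F y - F z) \<le> L * norm (y - z)"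
    using smooth_on_lipschitz_cball[OF assms(3) r(2)] by blast
  have contF: "continuous_on (cball x0 r) F"
    using smooth_on_continuous[OF assms(3)] r(2) continuous_on_subset by blast
  then have "bounded (F ` cball x0 r)"
    using compact_cball compact_continuous_image compact_imp_bounded by blast
  then obtain M where M: "M > 0" "\<And>y. y \<in> cball x0 r \<Longrightarrow> norm (F y) \<le> M"
    unfolding bounded_pos by auto
  \<comment> \<open>The first bound keeps the curves in the ball of radius \<open>r\<close>, the second makes the contraction
    factor at most \<open>1/2\<close>.\<close>
  define e where "e = min (r / M) (1 / (2 * L))"
  have e: "e > 0" "e * M \<le> r" "e * L \<le> 1 / 2"
    using r M L by (auto simp: e_def min_def field_simps)
  define S where "S = PiC UNIV (\<lambda>_::real. cball x0 r)"
  define cl where "cl t = max (-e) (min e t)" for t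
  have cl: "cl t \<in> {-e..e}" for t using e by (auto simp: cl_def)
  define K where "K g t = integral {-e..t} (\<lambda>s. F (apply_bcontfun g s))" for g t
  define \<Phi> where "\<Phi> g t = x0 + (K g (cl t) - K g 0)" for g t
  have gS: "apply_bcontfun g s \<in> cball x0 r" if "g \<in> S" for g s
    using that unfolding S_def mem_PiC_iff by auto
  have cont: "continuous_on T (\<lambda>s. F (apply_bcontfun g s))" if "g \<in> S" for g T
    using gS[OF that] by (intro continuous_on_compose2[OF contF]) auto
  have ball: "\<Phi> g t \<in> cball x0 r" if "g \<in> S" for g t
    using signed_integral_bound[OF cont[OF that] M(2)[OF gS[OF that]] cl[of t]] e(2)
    by (simp add: \<Phi>_def K_def dist_norm norm_minus_commute)
  have \<Phi>b: "\<Phi> g \<in> bcontfun" if g: "g \<in> S" for g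
  proof -
    have "continuous_on {-e..e} (K g)"
      unfolding K_def by (intro indefinite_integral_continuous_1 integrable_continuous_real cont[OF g])
    then have "continuous_on UNIV (\<lambda>t. K g (cl t))"
      by (rule continuous_on_compose2) (use cl in \<open>auto simp: cl_def intro!: continuous_intros\<close>)
    then have "continuous_on UNIV (\<Phi> g)"
      unfolding \<Phi>_def by (intro continuous_intros)
    moreover have "bounded (range (\<Phi> g))"
      using ball[OF g] by (intro bounded_subset[OF bounded_cball[of x0 r]]) auto
    ultimately show ?thesis by (simp add: bcontfun_def)
  qed
  have app: "apply_bcontfun (Bcontfun (\<Phi> g)) t = \<Phi> g t" if "g \<in> S" for g t
    using Bcontfun_inverse[OF \<Phi>b[OF that]] by simp
  have "\<exists>!g\<in>S. Bcontfun (\<Phi> g) = g"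
  proof (rule Banach_fix[of S "1/2"])
    show "complete S" unfolding S_def by (intro complete_eq_closed[THEN iffD2] closed_PiC) simp
    show "S \<noteq> {}"
    proof -
      have "const_bcontfun x0 \<in> S" using r by (simp add: S_def mem_PiC_iff)
      then show ?thesis by blast
    qed
    show "(\<lambda>g. Bcontfun (\<Phi> g)) ` S \<subseteq> S"
      using ball app by (auto simp: S_def mem_PiC_iff)
    fix g h assume g: "g \<in> S" and h: "h \<in> S"
    show "dist (Bcontfun (\<Phi> g)) (Bcontfun (\<Phi> h)) \<le> 1 / 2 * dist g h"
    proof (rule dist_bound)
      fix t
      let ?d = "\<lambda>s. F (apply_bcontfun g s) - F (apply_bcontfun h s)"
      have int: "(\<lambda>s. F (apply_bcontfun g s)) integrable_on {-e..t}" if "g \<in> S" for g t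
        by (intro integrable_continuous_real cont[OF that])
      have "dist (\<Phi> g t) (\<Phi> h t) = norm (integral {-e..cl t} ?d - integral {-e..0} ?d)"
        unfolding \<Phi>_def K_def dist_norm
        by (simp add: Henstock_Kurzweil_Integration.integral_diff[OF int[OF g] int[OF h]] algebra_simps)
      also have "\<dots> \<le> e * (L * dist g h)"
      proof (rule signed_integral_bound)
        show "continuous_on {-e..e} ?d" by (intro continuous_intros cont g h)
        fix s
        have "norm (?d s) \<le> L * norm (apply_bcontfun g s - apply_bcontfun h s)"
          by (rule L(2)[OF gS[OF g] gS[OF h]])
        also have "\<dots> \<le> L * dist g h"
          using dist_bounded[of g s h] L(1) by (simp add: dist_norm)
        finally show "norm (?d s) \<le> L * dist g h" .
      qed (rule cl)
      also have "\<dots> \<le> 1 / 2 * dist g h"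
        using mult_right_mono[OF e(3) zero_le_dist[of g h]] by (simp add: mult.assoc)
      finally show "dist (apply_bcontfun (Bcontfun (\<Phi> g)) t) (apply_bcontfun (Bcontfun (\<Phi> h)) t)
          \<le> 1 / 2 * dist g h"
        by (simp add: app g h)
    qed
  qed auto
  then obtain g where g: "g \<in> S" "Bcontfun (\<Phi> g) = g" by blast
  define x where "x = apply_bcontfun g"
  have x: "x t = \<Phi> g t" for t using app[OF g(1)] g(2) by (simp add: x_def)
  have x0: "x 0 = x0" using e(1) by (simp add: x \<Phi>_def cl_def)
  have xU: "x t \<in> U" for t using gS[OF g(1)] r(2) by (auto simp: x_def)
  have der: "(x has_vector_derivative F (x t)) (at t)" if t: "t \<in> {-e<..<e}" for t
  proof -
    have "(K g has_vector_derivative F (x t)) (at t within {-e..e})"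
      unfolding K_def x_def
      using integral_has_vector_derivative[OF cont[OF g(1)], of t "-e" e] t by auto
    then have "(K g has_vector_derivative F (x t)) (at t)"
      using t by (metis at_within_interior greaterThanLessThan_iff interior_atLeastAtMost_real)
    then have "((\<lambda>t. x0 + (K g t - K g 0)) has_vector_derivative F (x t)) (at t)"
      by (auto intro!: derivative_eq_intros)
    then show ?thesis
      by (rule has_vector_derivative_transform_within_open[of _ _ _ "{-e<..<e}"])
        (use t in \<open>auto simp: x \<Phi>_def cl_def\<close>)
  qed
  show ?thesis
    by (rule that[OF e(1) x0 xU der ode_solution_smooth[OF _ assms(3) xU der]]) auto
qed


section \<open>Determinants and invariant densities on a Euclidean space\<close>

text \<open>A finite type that indexes the basis of a Euclidean space.  It identifies an abstract
Euclidean space with a space of coordinate vectors, on which determinants and the change of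
variables formula for integrals are available.  The well-order on it is arbitrary.\<close>

typedef (overloaded) ('a::euclidean_space) coord = "Basis :: 'a set"
  using nonempty_Basis by blast

instance coord :: (euclidean_space) finite
proof
  have "UNIV = Abs_coord ` (Basis :: 'a set)"
    by (metis (no_types) UNIV_eq_I Rep_coord Rep_coord_inverse image_eqI)
  then show "finite (UNIV :: 'a coord set)" by (metis finite_Basis finite_imageI)
qed

instantiation coord :: (euclidean_space) wellorder
begin

definition index_coord :: "'a coord \<Rightarrow> nat" where
  "index_coord = (SOME f. inj f)"

definition less_eq_coord :: "'a coord \<Rightarrow> 'a coord \<Rightarrow> bool" where
  "less_eq_coord x y \<longleftrightarrow> index_coord x \<le> index_coord y"

definition less_coord :: "'a coord \<Rightarrow> 'a coord \<Rightarrow> bool" where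
  "less_coord x y \<longleftrightarrow> index_coord x < index_coord y"

instance
proof
  have "\<exists>f :: 'a coord \<Rightarrow> nat. inj f" using finite_imp_inj_to_nat_seg[of "UNIV :: 'a coord set"] by auto
  then have inj: "inj (index_coord :: 'a coord \<Rightarrow> nat)"
    unfolding index_coord_def by (rule someI_ex)
  fix x y z :: "'a coord" and P :: "'a coord \<Rightarrow> bool"
  show "x \<le> y \<Longrightarrow> y \<le> x \<Longrightarrow> x = y"
    using injD[OF inj] by (simp add: less_eq_coord_def)
  show "P x" if *: "\<And>x. (\<And>y. y < x \<Longrightarrow> P y) \<Longrightarrow> P x"
  proof (induction "index_coord x" arbitrary: x rule: less_induct)
    case less
    show ?case by (rule *) (use less in \<open>simp add: less_coord_def\<close>)
  qed
qed (auto simp: less_eq_coord_def less_coord_def)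

end

definition to_vec :: "'a::euclidean_space \<Rightarrow> real ^ 'a coord" where
  "to_vec x = (\<chi> i. x \<bullet> Rep_coord i)"

definition of_vec :: "real ^ 'a coord \<Rightarrow> 'a::euclidean_space" where
  "of_vec v = (\<Sum>i\<in>UNIV. v $ i *\<^sub>R Rep_coord i)"

lemma bij_betw_Rep_coord: "bij_betw Rep_coord UNIV (Basis :: 'a::euclidean_space set)"
  by (rule bij_betw_byWitness[of _ Abs_coord])
    (auto simp: Rep_coord_inverse Abs_coord_inverse Rep_coord)

lemma Rep_coord_inner: "Rep_coord i \<bullet> Rep_coord j = (if i = j then 1 else 0)"
  using inner_Basis[OF Rep_coord[of i] Rep_coord[of j]] by (simp add: Rep_coord_inject)

lemma sum_coord: "(\<Sum>i\<in>UNIV. f (Rep_coord i)) = (\<Sum>b\<in>Basis. f b)"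
  by (rule sum.reindex_bij_betw[OF bij_betw_Rep_coord])

lemma of_vec_to_vec [simp]: "of_vec (to_vec x) = x"
  unfolding of_vec_def to_vec_def
  using sum_coord[of "\<lambda>b. (x \<bullet> b) *\<^sub>R b"] by (simp add: euclidean_representation)

lemma to_vec_of_vec [simp]: "to_vec (of_vec v) = v"
  by (simp add: of_vec_def to_vec_def vec_eq_iff inner_sum_left Rep_coord_inner if_distrib cong: if_cong)

lemma bounded_linear_to_vec: "bounded_linear to_vec"
  by (rule linear_conv_bounded_linear[THEN iffD1], rule linearI)
    (simp_all add: to_vec_def vec_eq_iff inner_add_left)

lemma bounded_linear_of_vec: "bounded_linear of_vec"
  by (rule linear_conv_bounded_linear[THEN iffD1], rule linearI)
    (simp_all add: of_vec_def scaleR_add_left sum.distrib scaleR_sum_right)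

lemma of_vec_inner: "of_vec v \<bullet> Rep_coord i = v $ i"
  using arg_cong[OF to_vec_of_vec[of v], of "\<lambda>w. w $ i"] by (simp add: to_vec_def del: to_vec_of_vec)

text \<open>The identification maps boxes to boxes of the same volume, hence Lebesgue measure to Lebesgue
measure.\<close>

lemma distr_lborel_to_vec:
  "distr lborel borel (to_vec :: 'a::euclidean_space \<Rightarrow> _) = lborel"
proof (rule lborel_eqI[symmetric])
  have meas: "(to_vec :: 'a \<Rightarrow> _) \<in> borel_measurable borel"
    by (intro borel_measurable_continuous_onI linear_continuous_on bounded_linear_to_vec)
  fix l u :: "real ^ 'a coord"
  assume le: "\<And>b. b \<in> Basis \<Longrightarrow> l \<bullet> b \<le> u \<bullet> b"
  have prod: "(\<Prod>b\<in>Basis. w \<bullet> b) = (\<Prod>i\<in>UNIV. w $ i)" for w :: "real ^ 'a coord"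
  proof -
    have "(\<Prod>b\<in>Basis. w \<bullet> b) = (\<Prod>i\<in>UNIV. w \<bullet> axis i 1)"
      by (rule prod.reindex_bij_betw[symmetric])
        (auto simp: bij_betw_def inj_on_def Basis_vec_def axis_eq_axis)
    then show ?thesis by (simp add: inner_axis)
  qed
  have prod': "(\<Prod>b\<in>Basis. of_vec w \<bullet> b) = (\<Prod>i\<in>UNIV. w $ i)" for w :: "real ^ 'a coord"
    using prod.reindex_bij_betw[OF bij_betw_Rep_coord, of "\<lambda>b. of_vec w \<bullet> b"]
    by (simp add: of_vec_inner)
  have mem_box: "to_vec x \<in> box l u \<longleftrightarrow> x \<in> box (of_vec l) (of_vec u)" for x :: 'a
  proof -
    have "x \<in> box (of_vec l) (of_vec u) \<longleftrightarrow>
        (\<forall>i. of_vec l \<bullet> Rep_coord i < x \<bullet> Rep_coord i \<and> x \<bullet> Rep_coord i < of_vec u \<bullet> Rep_coord i)"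
      unfolding mem_box using bij_betw_Rep_coord
      by (metis (no_types, lifting) Rep_coord Rep_coord_cases)
    then show ?thesis by (simp add: mem_box_cart to_vec_def of_vec_inner)
  qed
  have "emeasure (distr lborel borel (to_vec :: 'a \<Rightarrow> _)) (box l u)
      = emeasure lborel ((to_vec :: 'a \<Rightarrow> _) -` box l u)"
    using meas by (subst emeasure_distr) auto
  also have "(to_vec :: 'a \<Rightarrow> _) -` box l u = box (of_vec l) (of_vec u)"
    using mem_box by auto
  also have "emeasure lborel \<dots> = (\<Prod>b\<in>Basis. (of_vec u - of_vec l) \<bullet> b)"
  proof (rule emeasure_lborel_box)
    fix b :: 'a assume "b \<in> Basis"
    then obtain i where "b = Rep_coord i" by (metis Rep_coord_cases)
    moreover have "l $ i \<le> u $ i"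
      using le[of "axis i 1"] by (simp add: inner_axis)
    ultimately show "of_vec l \<bullet> b \<le> of_vec u \<bullet> b" by (simp add: of_vec_inner)
  qed
  also have "of_vec u - of_vec l = of_vec (u - l)"
    using linear_diff[OF bounded_linear.linear[OF bounded_linear_of_vec], of u l] by simp
  finally show "emeasure (distr lborel borel (to_vec :: 'a \<Rightarrow> _)) (box l u)
      = (\<Prod>b\<in>Basis. (u - l) \<bullet> b)"
    unfolding prod prod' .
qed simp

text \<open>The determinant of an endomorphism of a Euclidean space, from its matrix in the standard basis.\<close>

definition edet :: "('a::euclidean_space \<Rightarrow> 'a) \<Rightarrow> real" where
  "edet L = det (\<chi> i j. L (Rep_coord j) \<bullet> Rep_coord i :: real ^ 'a coord ^ 'a coord)"

lemma edet_ident: "edet (\<lambda>x. x) = 1"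
proof -
  have "(\<chi> i j. Rep_coord j \<bullet> Rep_coord i) = (mat 1 :: real ^ 'a coord ^ 'a coord)"
    by (simp add: mat_def vec_eq_iff Rep_coord_inner)
  then show ?thesis unfolding edet_def by simp
qed

text \<open>Jacobi's formula at the identity: in the Leibniz expansion, a permutation other than the
  identity moves at least two indices, so each of its terms keeps a vanishing factor after
  differentiation.\<close>

lemma has_derivative_edet_at_ident:
  fixes B :: "'e::real_normed_vector \<Rightarrow> 'a::euclidean_space \<Rightarrow> 'a"
  assumes B: "\<And>b. b \<in> Basis \<Longrightarrow> ((\<lambda>z. B z b) has_derivative B' b) (at z0)"
    and B0: "\<And>b. b \<in> Basis \<Longrightarrow> B z0 b = b"
  shows "((\<lambda>z. edet (B z)) has_derivative (\<lambda>h. \<Sum>b\<in>Basis. B' b h \<bullet> b)) (at z0)"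
proof -
  let ?R = "Rep_coord :: 'a coord \<Rightarrow> 'a"
  let ?D = "\<lambda>p h. \<Sum>i\<in>UNIV. (B' (?R (p i)) h \<bullet> ?R i) * (\<Prod>j\<in>UNIV - {i}. B z0 (?R (p j)) \<bullet> ?R j)"
  have eq: "edet (B z) = (\<Sum>p | p permutes UNIV. of_int (sign p) *
      (\<Prod>i\<in>UNIV. B z (?R (p i)) \<bullet> ?R i))" for z
    unfolding edet_def det_def by simp
  have der: "((\<lambda>z. edet (B z)) has_derivative
      (\<lambda>h. \<Sum>p | p permutes (UNIV :: 'a coord set). of_int (sign p) * ?D p h)) (at z0)"
    unfolding eq
    by (intro has_derivative_sum has_derivative_mult_right has_derivative_prod
        bounded_linear.has_derivative[OF bounded_linear_inner_left] B Rep_coord)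
  have zero: "?D p h = 0" if p: "p permutes UNIV" "p \<noteq> id" for p h
  proof (rule sum.neutral, rule ballI)
    fix i :: "'a coord"
    have "\<exists>j. j \<noteq> i \<and> p j \<noteq> j"
    proof (rule ccontr)
      assume "\<not> ?thesis"
      then have *: "\<And>j. j \<noteq> i \<Longrightarrow> p j = j" by blast
      have "p i = i" using permutes_inj[OF p(1)] * by (metis injD)
      with * have "p = id" by (metis eq_id_iff)
      with p(2) show False by blast
    qed
    then obtain j where "j \<noteq> i" "p j \<noteq> j" by blast
    then have "(\<Prod>j\<in>UNIV - {i}. B z0 (?R (p j)) \<bullet> ?R j) = 0"
      by (intro prod_zero) (auto simp: B0[OF Rep_coord] Rep_coord_inner)
    then show "(B' (?R (p i)) h \<bullet> ?R i) * (\<Prod>j\<in>UNIV - {i}. B z0 (?R (p j)) \<bullet> ?R j) = 0"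
      by simp
  qed
  have "(\<Sum>p | p permutes (UNIV :: 'a coord set). of_int (sign p) * ?D p h)
      = (\<Sum>b\<in>Basis. B' b h \<bullet> b)" for h
  proof -
    have "(\<Sum>p | p permutes (UNIV :: 'a coord set). of_int (sign p) * ?D p h)
        = (\<Sum>p\<in>{id}. of_int (sign p) * ?D p h)"
      by (rule sum.mono_neutral_right) (auto simp: zero permutes_id)
    also have "\<dots> = (\<Sum>i\<in>UNIV. B' (?R i) h \<bullet> ?R i)"
      by (simp add: B0[OF Rep_coord] Rep_coord_inner sign_id)
    finally show ?thesis by (simp add: sum_coord[of "\<lambda>b. B' b h \<bullet> b"])
  qed
  with der show ?thesis by simp
qed

text \<open>A continuous function that is positive at a point has a positive integral over a small box
around it.  Applied to a function and its negative, this recovers equality of densities from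
equality of integrals.\<close>

lemma continuous_zero_integrals:
  fixes k :: "'a::euclidean_space \<Rightarrow> real"
  assumes "open N" "x0 \<in> N" "continuous_on N k"
    and int: "\<And>a b. x0 \<in> box a b \<Longrightarrow> cbox a b \<subseteq> N \<Longrightarrow> integral (cbox a b) k = 0"
  shows "k x0 \<le> 0"
proof (rule ccontr)
  assume "\<not> k x0 \<le> 0"
  then have pos: "k x0 > 0" by simp
  have "open {x \<in> N. k x > k x0 / 2}"
    using continuous_open_preimage[OF assms(3,1), of "{k x0 / 2 <..}"]
    by (simp add: Int_def vimage_def)
  moreover have "x0 \<in> {x \<in> N. k x > k x0 / 2}" using assms(2) pos by simp
  ultimately obtain a b where ab: "x0 \<in> box a b" "cbox a b \<subseteq> {x \<in> N. k x > k x0 / 2}"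
    by (rule open_contains_cbox)
  have "continuous_on (cbox a b) k" using ab assms(3) continuous_on_subset by blast
  then have "integral (cbox a b) (\<lambda>x. k x0 / 2) \<le> integral (cbox a b) k"
    using ab by (intro integral_le) (auto intro!: integrable_continuous less_imp_le)
  moreover have "measure lborel (cbox a b) > 0"
    using ab(1) by (metis box_ne_empty(2) content_pos_lt_eq empty_iff)
  ultimately show False
    using int[OF ab(1)] ab pos by (auto simp: mult_le_0_iff subset_iff)
qed

text \<open>By the change of variables formula, both sides of the conclusion, as functions of \<open>x0\<close>, have the same
integral over every small box.\<close>

lemma density_jacobian_vec:
  fixes f :: "real ^ 'n::{finite,wellorder} \<Rightarrow> real ^ 'n::_"
  assumes "open N" "x0 \<in> N" "smooth_on N f" "inj_on f N"
    and \<sigma>: "continuous_on X \<sigma>" "\<And>x. x \<in> X \<Longrightarrow> \<sigma> x > 0" and NX: "N \<subseteq> X" "f ` N \<subseteq> X"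
    and inv: "\<And>E. open E \<Longrightarrow> E \<subseteq> N \<Longrightarrow>
      (\<integral>\<^sup>+x\<in>f ` E. ennreal (\<sigma> x) \<partial>lborel) = (\<integral>\<^sup>+x\<in>E. ennreal (\<sigma> x) \<partial>lborel)"
  shows "\<sigma> (f x0) * \<bar>det (matrix (DD f x0))\<bar> = \<sigma> x0"
proof -
  define \<tau> where "\<tau> x = \<bar>det (matrix (DD f x))\<bar> * \<sigma> (f x)" for x
  have "continuous_on N (\<lambda>x. det (matrix (DD f x)))"
    unfolding det_def matrix_def
    by (simp, intro continuous_on_sum continuous_on_mult continuous_on_const continuous_on_prod
        continuous_on_component smooth_on_continuous smooth_on_DD assms(3))
  moreover have "continuous_on N (\<lambda>x. \<sigma> (f x))"
    by (rule continuous_on_compose2[OF \<sigma>(1) smooth_on_continuous[OF assms(3)] NX(2)])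
  ultimately have cont\<tau>: "continuous_on N \<tau>"
    unfolding \<tau>_def by (intro continuous_intros)
  have cont\<sigma>: "continuous_on N \<sigma>" using \<sigma>(1) NX(1) continuous_on_subset by blast
  have eq: "integral (cbox a b) \<tau> = integral (cbox a b) \<sigma>" if ab: "cbox a b \<subseteq> N" for a b
  proof -
    have sub: "box a b \<subseteq> N" using ab box_subset_cbox by blast
    have ai: "g absolutely_integrable_on box a b" if "continuous_on N g" for g :: "real ^ 'n::{finite,wellorder} \<Rightarrow> real"
      using absolutely_integrable_continuous[OF continuous_on_subset[OF that ab]]
      by (rule set_integrable_subset) (auto intro: box_subset_cbox[THEN subsetD])
    have der: "(f has_derivative DD f x) (at x within box a b)" if "x \<in> box a b" for x
      using DD_works[OF smooth_on_differentiable[OF assms(3)]] that sub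
      by (meson has_derivative_at_withinI subsetD)
    have "(\<lambda>x. vec (\<sigma> x) :: real^1) absolutely_integrable_on f ` box a b \<and>
        integral (f ` box a b) (\<lambda>x. vec (\<sigma> x) :: real^1) = vec (integral (box a b) \<tau>)"
      using ai[OF cont\<tau>]
      by (subst has_absolute_integral_change_of_variables[symmetric, OF _ der inj_on_subset[OF assms(4) sub]])
        (auto simp: absolutely_integrable_on_1_iff integral_on_1_eq \<tau>_def[abs_def])
    then have "\<sigma> absolutely_integrable_on f ` box a b" "integral (f ` box a b) \<sigma> = integral (box a b) \<tau>"
      by (auto simp: absolutely_integrable_on_1_iff integral_on_1_eq vec_eq_iff)
    then have "(\<sigma> has_integral integral (box a b) \<tau>) (f ` box a b)"
      by (metis absolutely_integrable_on_def integrable_integral)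
    then have 1: "(\<integral>\<^sup>+x\<in>f ` box a b. ennreal (\<sigma> x) \<partial>lborel) = ennreal (integral (box a b) \<tau>)"
      using sub NX \<sigma>(2) by (intro nn_integral_has_integral_lebesgue') (auto intro!: less_imp_le)
    have "(\<sigma> has_integral integral (box a b) \<sigma>) (box a b)"
      using ai[OF cont\<sigma>] by (metis absolutely_integrable_on_def integrable_integral)
    then have 2: "(\<integral>\<^sup>+x\<in>box a b. ennreal (\<sigma> x) \<partial>lborel) = ennreal (integral (box a b) \<sigma>)"
      using sub NX \<sigma>(2) by (intro nn_integral_has_integral_lebesgue') (auto intro!: less_imp_le)
    have "integral (box a b) \<tau> \<ge> 0" "integral (box a b) \<sigma> \<ge> 0"
    proof -
      have "\<tau> x \<ge> 0" "\<sigma> x \<ge> 0" if "x \<in> box a b" for x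
        using \<sigma>(2)[of x] \<sigma>(2)[of "f x"] that sub NX by (auto simp: \<tau>_def subset_iff)
      then show "integral (box a b) \<tau> \<ge> 0" "integral (box a b) \<sigma> \<ge> 0"
        using ai[OF cont\<tau>] ai[OF cont\<sigma>]
        by (auto intro!: integral_nonneg simp: absolutely_integrable_on_def)
    qed
    then have "integral (box a b) \<tau> = integral (box a b) \<sigma>"
      using inv[OF open_box sub] 1 2 by simp
    then show ?thesis by (simp add: integral_open_interval)
  qed
  have int: "integral (cbox a b) (\<lambda>x. \<tau> x - \<sigma> x) = 0" "integral (cbox a b) (\<lambda>x. \<sigma> x - \<tau> x) = 0"
    if "cbox a b \<subseteq> N" for a b
    using eq[OF that] that cont\<tau> cont\<sigma>
    by (auto simp: Henstock_Kurzweil_Integration.integral_diff integrable_continuous continuous_on_subset)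
  have "\<tau> x0 - \<sigma> x0 \<le> 0" "\<sigma> x0 - \<tau> x0 \<le> 0"
    using continuous_zero_integrals[OF assms(1,2), of "\<lambda>x. \<tau> x - \<sigma> x"]
      continuous_zero_integrals[OF assms(1,2), of "\<lambda>x. \<sigma> x - \<tau> x"] int cont\<tau> cont\<sigma>
    by (auto intro: continuous_intros)
  then show ?thesis by (simp add: \<tau>_def mult.commute)
qed

lemma density_jacobian:
  fixes f :: "'a::euclidean_space \<Rightarrow> 'a"
  assumes "open N" "x0 \<in> N" "smooth_on N f" "inj_on f N"
    and "open X" and \<sigma>: "continuous_on X \<sigma>" "\<And>x. x \<in> X \<Longrightarrow> \<sigma> x > 0" and NX: "N \<subseteq> X" "f ` N \<subseteq> X"
    and inv: "\<And>E. open E \<Longrightarrow> E \<subseteq> N \<Longrightarrow>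
      (\<integral>\<^sup>+x\<in>f ` E. ennreal (\<sigma> x) \<partial>lborel) = (\<integral>\<^sup>+x\<in>E. ennreal (\<sigma> x) \<partial>lborel)"
  shows "\<sigma> (f x0) * \<bar>edet (DD f x0)\<bar> = \<sigma> x0"
proof -
  define f' where "f' v = to_vec (f (of_vec v))" for v
  define \<sigma>' where "\<sigma>' v = \<sigma> (of_vec v)" for v :: "real ^ 'a coord"
  let ?v = "\<lambda>S. (of_vec :: real ^ 'a coord \<Rightarrow> 'a) -` S"
  have cont_of: "continuous_on S (of_vec :: real ^ 'a coord \<Rightarrow> 'a)" for S
    by (intro linear_continuous_on bounded_linear_of_vec)
  have openv: "open (?v S)" if "open S" for S
    using that by (intro open_vimage cont_of)
  have im: "to_vec ` S = ?v S" for S by (force intro: image_eqI[of _ _ "of_vec _"])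
  have "smooth_on (?v N) (\<lambda>v. f (of_vec v))"
    by (rule smooth_on_compose[OF openv[OF assms(1)] smooth_on_bounded_linear[OF bounded_linear_of_vec] assms(3)])
      auto
  then have smooth: "smooth_on (?v N) f'"
    unfolding f'_def by (rule smooth_on_linear_compose[OF openv[OF assms(1)] _ bounded_linear_to_vec])
  have inj: "inj_on f' (?v N)"
    unfolding f'_def using assms(4)
    by (smt (verit) inj_on_def of_vec_to_vec to_vec_of_vec vimage_eq)
  have nn: "(\<integral>\<^sup>+v\<in>?v E. ennreal (\<sigma>' v) \<partial>lborel) = (\<integral>\<^sup>+x\<in>E. ennreal (\<sigma> x) \<partial>lborel)"
    if E: "open E" "E \<subseteq> X" for E
  proof -
    have "(\<lambda>v. indicator (?v E) v *\<^sub>R \<sigma>' v) \<in> borel_measurable borel"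
      unfolding \<sigma>'_def using E openv[OF E(1)]
      by (intro borel_measurable_continuous_on_indicator
          continuous_on_compose2[OF continuous_on_subset[OF \<sigma>(1) E(2)] cont_of]) auto
    then have m: "(\<lambda>v. ennreal (indicator (?v E) v * \<sigma>' v)) \<in> borel_measurable borel"
      by simp
    have "(\<integral>\<^sup>+v\<in>?v E. ennreal (\<sigma>' v) \<partial>lborel)
        = (\<integral>\<^sup>+v. ennreal (indicator (?v E) v * \<sigma>' v) \<partial>distr lborel borel (to_vec :: 'a \<Rightarrow> _))"
      unfolding distr_lborel_to_vec by (intro nn_integral_cong) (simp add: indicator_def)
    also have "\<dots> = (\<integral>\<^sup>+x. ennreal (indicator (?v E) (to_vec x) * \<sigma>' (to_vec x)) \<partial>lborel)"
      using m by (intro nn_integral_distr)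
        (auto intro!: borel_measurable_continuous_onI linear_continuous_on bounded_linear_to_vec)
    also have "\<dots> = (\<integral>\<^sup>+x\<in>E. ennreal (\<sigma> x) \<partial>lborel)"
      by (intro nn_integral_cong) (simp add: indicator_def \<sigma>'_def)
    finally show ?thesis .
  qed
  have inv': "(\<integral>\<^sup>+v\<in>f' ` E. ennreal (\<sigma>' v) \<partial>lborel) = (\<integral>\<^sup>+v\<in>E. ennreal (\<sigma>' v) \<partial>lborel)"
    if E: "open E" "E \<subseteq> ?v N" for E
  proof -
    define E' where "E' = (to_vec :: 'a \<Rightarrow> _) -` E"
    have E': "E = ?v E'" by (auto simp: E'_def)
    have oE': "open E'" unfolding E'_def
      using E(1) by (intro open_vimage linear_continuous_on bounded_linear_to_vec)
    have sub: "E' \<subseteq> N" using E(2) by (auto simp: E'_def dest: subsetD)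
    have img: "f' ` E = ?v (f ` E')"
      unfolding im[symmetric] E' f'_def
      by (force simp: image_iff intro: exI[of _ "to_vec _"])
    have "open (f ` E')"
      using continuous_on_subset[OF smooth_on_continuous[OF assms(3)] sub] oE' inj_on_subset[OF assms(4) sub]
      by (rule invariance_of_domain)
    then show ?thesis
      unfolding img using sub NX inv[OF oE' sub] oE' by (subst nn, auto simp: E' nn)
  qed
  have "\<sigma>' (f' (to_vec x0)) * \<bar>det (matrix (DD f' (to_vec x0)))\<bar> = \<sigma>' (to_vec x0)"
  proof (rule density_jacobian_vec[OF openv[OF assms(1)] _ smooth inj, where X = "?v X"])
    show "continuous_on (?v X) \<sigma>'"
      unfolding \<sigma>'_def by (rule continuous_on_compose2[OF \<sigma>(1) cont_of]) auto
  qed (use assms(2) \<sigma>(2) NX inv' in \<open>auto simp: \<sigma>'_def f'_def\<close>)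
  moreover have "det (matrix (DD f' (to_vec x0))) = edet (DD f x0)"
  proof -
    have df: "f differentiable (at x0)" using smooth_on_differentiable[OF assms(3,2)] .
    have "DD f' (to_vec x0) v = to_vec (DD f x0 (of_vec v))" for v
    proof -
      have "((\<lambda>v. f (of_vec v)) has_derivative (\<lambda>v. DD f x0 (of_vec v))) (at (to_vec x0))"
        using has_derivative_compose[OF bounded_linear_imp_has_derivative[OF bounded_linear_of_vec],
            of f "DD f x0" "to_vec x0" UNIV] DD_works[OF df] by simp
      from DD_eq[OF bounded_linear.has_derivative[OF bounded_linear_to_vec this]]
      show ?thesis unfolding f'_def by simp
    qed
    moreover have "of_vec (axis j 1) = Rep_coord j" for j :: "'a coord"
      by (simp add: of_vec_def axis_def if_distrib[of "\<lambda>c. c *\<^sub>R _"] cong: if_cong)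
    ultimately show ?thesis
      unfolding edet_def matrix_def by (simp add: to_vec_def)
  qed
  ultimately show ?thesis by (simp add: \<sigma>'_def f'_def)
qed


section \<open>Smooth atlases and tangent maps\<close>

text \<open>What is needed of a manifold for local calculus.  Topological axioms and maximality of the atlas are left out so
that the same lemmas apply to intervals and to the slit tangent bundle with its induced charts.\<close>

locale smooth_atlas =
  fixes A :: "('a, 'e::euclidean_space) chart set"
  assumes inj: "c \<in> A \<Longrightarrow> inj_on (snd c) (fst c)"
    and open_img: "c \<in> A \<Longrightarrow> open (chart_img c)"
    and open_overlap: "c \<in> A \<Longrightarrow> d \<in> A \<Longrightarrow> open (snd c ` (fst c \<inter> fst d))"
    and smooth_transition: "c \<in> A \<Longrightarrow> d \<in> A \<Longrightarrow> smooth_on (snd c ` (fst c \<inter> fst d)) (transition c d)"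

lemma chart_inv_in: "x \<in> chart_img c \<Longrightarrow> chart_inv c x \<in> fst c"
  unfolding chart_inv_def chart_img_def by (rule inv_into_into)

lemma chart_chart_inv: "x \<in> chart_img c \<Longrightarrow> snd c (chart_inv c x) = x"
  unfolding chart_inv_def chart_img_def by (rule f_inv_into_f)

lemma chart_in_img: "p \<in> fst c \<Longrightarrow> snd c p \<in> chart_img c"
  unfolding chart_img_def by blast

lemma smooth_manifold_atlas:
  assumes "smooth_manifold X A"
  shows "smooth_atlas A"
proof
  fix c d assume c: "c \<in> A" and d: "d \<in> A"
  have hom: "homeomorphic_map (subtopology X (fst c)) (top_of_set (chart_img c)) (snd c)"
    and op: "openin X (fst c)" "openin X (fst d)" "open (chart_img c)"
    using assms c d unfolding smooth_manifold_def is_chart_def by blast+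
  have top: "topspace (subtopology X (fst c)) = fst c"
    using openin_subset[OF op(1)] by auto
  show "inj_on (snd c) (fst c)"
    using homeomorphic_imp_injective_map[OF hom] unfolding top .
  show "open (chart_img c)" by (rule op)
  have "openin (subtopology X (fst c)) (fst c \<inter> fst d)"
    using op by (metis inf.commute openin_subtopology_Int)
  then have "openin (top_of_set (chart_img c)) (snd c ` (fst c \<inter> fst d))"
    using homeomorphic_map_openness[OF hom, of "fst c \<inter> fst d"] top by auto
  then show "open (snd c ` (fst c \<inter> fst d))"
    using op(3) openin_open_trans by blast
  show "smooth_on (snd c ` (fst c \<inter> fst d)) (transition c d)"
    using assms c d unfolding smooth_manifold_def smoothly_compatible_def by blast
qed

context smooth_atlas
begin

lemma chart_inv_chart: "c \<in> A \<Longrightarrow> p \<in> fst c \<Longrightarrow> chart_inv c (snd c p) = p"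
  unfolding chart_inv_def using inj by (rule inv_into_f_f)

lemma transition_chart: "c \<in> A \<Longrightarrow> p \<in> fst c \<Longrightarrow> transition c d (snd c p) = snd d p"
  by (simp add: transition_def chart_inv_chart)

lemma overlap_mem: "c \<in> A \<Longrightarrow> x \<in> snd c ` (fst c \<inter> fst d) \<longleftrightarrow> x \<in> chart_img c \<and> chart_inv c x \<in> fst d"
  using chart_inv_chart[of c] chart_chart_inv[of x c] chart_inv_in[of x c]
  by (auto simp: chart_in_img intro!: image_eqI[of _ _ "chart_inv c x"])

lemma transition_differentiable:
  assumes "c \<in> A" "d \<in> A" "p \<in> fst c" "p \<in> fst d"
  shows "transition c d differentiable (at (snd c p))"
  using smooth_on_differentiable[OF smooth_transition[OF assms(1,2)]] assms(3,4) by blast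

lemma DD_transition_trans:
  assumes "c \<in> A" "d \<in> A" "e \<in> A" "p \<in> fst c" "p \<in> fst d" "p \<in> fst e"
  shows "DD (transition d e) (snd d p) (DD (transition c d) (snd c p) y) = DD (transition c e) (snd c p) y"
proof -
  have "DD (transition c e) (snd c p) = DD (\<lambda>x. transition d e (transition c d x)) (snd c p)"
    by (rule DD_cong_open[OF open_overlap[OF assms(1,2)]])
      (use assms in \<open>auto simp: transition_chart\<close>)
  then show ?thesis
    using DD_compose[OF transition_differentiable[OF assms(1,2,4,5)], of "transition d e" y]
      transition_differentiable[OF assms(2,3,5,6)] by (simp add: transition_chart assms)
qed

lemma DD_transition_self:
  assumes "c \<in> A" "p \<in> fst c"
  shows "DD (transition c c) (snd c p) y = y"
proof -
  have "DD (transition c c) (snd c p) = DD (\<lambda>x. x) (snd c p)"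
    by (rule DD_cong_open[OF open_overlap[OF assms(1,1)]])
      (use assms in \<open>auto simp: transition_chart\<close>)
  then show ?thesis by simp
qed

subsection \<open>Tangent spaces\<close>

lemma tangent_transition:
  "v \<in> tangent_space A p \<Longrightarrow> c \<in> A \<Longrightarrow> d \<in> A \<Longrightarrow> p \<in> fst c \<Longrightarrow> p \<in> fst d \<Longrightarrow>
    v d = DD (transition c d) (snd c p) (v c)"
  unfolding tangent_space_def by blast

lemma tangent_outside: "v \<in> tangent_space A p \<Longrightarrow> c \<notin> A \<or> p \<notin> fst c \<Longrightarrow> v c = 0"
  unfolding tangent_space_def by blast

lemma tangent_ext:
  assumes "v \<in> tangent_space A p" "w \<in> tangent_space A p" "c \<in> A" "p \<in> fst c" "v c = w c"
  shows "v = w"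
proof
  fix d
  show "v d = w d"
  proof (cases "d \<in> A \<and> p \<in> fst d")
    case True
    then show ?thesis
      using tangent_transition[OF assms(1,3) _ assms(4)] tangent_transition[OF assms(2,3) _ assms(4)]
        assms(5) by simp
  next
    case False
    then show ?thesis using tangent_outside[OF assms(1)] tangent_outside[OF assms(2)] by auto
  qed
qed

text \<open>The tangent vector at \<open>p\<close> with prescribed component in one chart.\<close>

definition chart_vector :: "('a, 'e) chart \<Rightarrow> 'a \<Rightarrow> 'e \<Rightarrow> ('a, 'e) tvec" where
  "chart_vector c p y = (\<lambda>d. if d \<in> A \<and> p \<in> fst d then DD (transition c d) (snd c p) y else 0)"

lemma chart_vector_tangent:
  "c \<in> A \<Longrightarrow> p \<in> fst c \<Longrightarrow> chart_vector c p y \<in> tangent_space A p"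
  unfolding tangent_space_def chart_vector_def by (auto simp: DD_transition_trans)

lemma chart_vector_comp: "c \<in> A \<Longrightarrow> p \<in> fst c \<Longrightarrow> chart_vector c p y c = y"
  by (simp add: chart_vector_def DD_transition_self)

lemma tangent_add:
  assumes "v \<in> tangent_space A p" "w \<in> tangent_space A p"
  shows "v + w \<in> tangent_space A p"
  unfolding tangent_space_def mem_Collect_eq
proof (intro conjI allI ballI impI)
  fix c assume "c \<notin> A \<or> p \<notin> fst c"
  then show "(v + w) c = 0"
    using tangent_outside[OF assms(1)] tangent_outside[OF assms(2)] by simp
next
  fix c d assume c: "c \<in> A" and d: "d \<in> A" and p: "p \<in> fst c \<inter> fst d"
  then have p: "p \<in> fst c" "p \<in> fst d" by auto
  show "(v + w) d = DD (transition c d) (snd c p) ((v + w) c)"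
    using tangent_transition[OF assms(1) c d p] tangent_transition[OF assms(2) c d p]
      linear_add[OF linear_frechet_derivative[OF transition_differentiable[OF c d p]]] by simp
qed

lemma tangent_scaleR:
  assumes "v \<in> tangent_space A p"
  shows "r *\<^sub>R v \<in> tangent_space A p"
  unfolding tangent_space_def mem_Collect_eq
proof (intro conjI allI ballI impI)
  fix c assume "c \<notin> A \<or> p \<notin> fst c"
  then show "(r *\<^sub>R v) c = 0"
    using tangent_outside[OF assms(1)] by (simp add: scaleR_fun_def)
next
  fix c d assume c: "c \<in> A" and d: "d \<in> A" and p: "p \<in> fst c \<inter> fst d"
  then have p: "p \<in> fst c" "p \<in> fst d" by auto
  show "(r *\<^sub>R v) d = DD (transition c d) (snd c p) ((r *\<^sub>R v) c)"
    using tangent_transition[OF assms(1) c d p]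
      linear_scale[OF linear_frechet_derivative[OF transition_differentiable[OF c d p]]]
    by (simp add: scaleR_fun_def)
qed

lemma tangent_zero: "0 \<in> tangent_space A p"
  unfolding tangent_space_def mem_Collect_eq
proof (intro conjI allI ballI impI)
  fix c d assume c: "c \<in> A" and d: "d \<in> A" and p: "p \<in> fst c \<inter> fst d"
  then have p: "p \<in> fst c" "p \<in> fst d" by auto
  show "0 d = DD (transition c d) (snd c p) (0 c)"
    using linear_0[OF linear_frechet_derivative[OF transition_differentiable[OF c d p]]] by simp
qed simp

lemma tangent_subspace: "subspace (tangent_space A p)"
  by (intro subspaceI tangent_zero tangent_add tangent_scaleR)

end

subsection \<open>Smooth maps\<close>

lemma smooth_mapD:
  assumes "smooth_map A B f" "c \<in> A" "p \<in> fst c" "d \<in> B" "f p \<in> fst d"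
  obtains W where "open W" "snd c p \<in> W" "W \<subseteq> chart_img c"
    "\<And>x. x \<in> W \<Longrightarrow> f (chart_inv c x) \<in> fst d"
    "smooth_on W (\<lambda>x. snd d (f (chart_inv c x)))"
proof -
  have "\<forall>d\<in>B. f p \<in> fst d \<longrightarrow> (\<exists>W. open W \<and> snd c p \<in> W \<and> W \<subseteq> chart_img c \<and>
      (\<forall>x\<in>W. f (chart_inv c x) \<in> fst d) \<and> smooth_on W (snd d \<circ> f \<circ> chart_inv c))"
    using assms(1-3) unfolding smooth_map_def by simp
  then obtain W where W: "open W" "snd c p \<in> W" "W \<subseteq> chart_img c"
    "\<forall>x\<in>W. f (chart_inv c x) \<in> fst d" "smooth_on W (snd d \<circ> f \<circ> chart_inv c)"
    using assms(4,5) by meson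
  then show ?thesis by (intro that[of W]) (simp_all add: comp_def)
qed

lemma smooth_map_target:
  assumes "smooth_map A B f" "c \<in> A" "p \<in> fst c"
  obtains d where "d \<in> B" "f p \<in> fst d"
  using assms unfolding smooth_map_def by meson

text \<open>By compatibility of the charts, smoothness near a point may be checked in one pair of
  charts.\<close>

lemma smooth_mapI:
  assumes A: "smooth_atlas A" and B: "smooth_atlas B"
    and one: "\<And>p. p \<in> (\<Union>c\<in>A. fst c) \<Longrightarrow> \<exists>c\<in>A. \<exists>d\<in>B. \<exists>W. p \<in> fst c \<and> f p \<in> fst d \<and>
      open W \<and> snd c p \<in> W \<and> W \<subseteq> chart_img c \<and> (\<forall>x\<in>W. f (chart_inv c x) \<in> fst d) \<and>
      smooth_on W (\<lambda>x. snd d (f (chart_inv c x)))"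
  shows "smooth_map A B f"
  unfolding smooth_map_def
proof (intro ballI conjI impI)
  interpret A: smooth_atlas A by (rule A)
  interpret B: smooth_atlas B by (rule B)
  fix c p assume c: "c \<in> A" "p \<in> fst c"
  then obtain c0 d0 W0 where c0: "c0 \<in> A" "p \<in> fst c0" and d0: "d0 \<in> B" "f p \<in> fst d0"
    and W0: "open W0" "snd c0 p \<in> W0" "W0 \<subseteq> chart_img c0"
      "\<And>x. x \<in> W0 \<Longrightarrow> f (chart_inv c0 x) \<in> fst d0"
      "smooth_on W0 (\<lambda>x. snd d0 (f (chart_inv c0 x)))"
    using one[of p] by blast
  show "\<exists>d\<in>B. f p \<in> fst d" using d0 by blast
  fix d assume d: "d \<in> B" "f p \<in> fst d"
  define F where "F x = snd d0 (f (chart_inv c0 x))" for x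
  define W1 where "W1 = W0 \<inter> F -` (snd d0 ` (fst d0 \<inter> fst d))"
  have oW1: "open W1"
    unfolding W1_def F_def
    by (rule continuous_open_preimage[OF smooth_on_continuous[OF W0(5)] W0(1) B.open_overlap[OF d0(1) d(1)]])
  define W where "W = snd c ` (fst c \<inter> fst c0) \<inter> transition c c0 -` W1"
  have oW: "open W"
    unfolding W_def
    by (rule continuous_open_preimage[OF smooth_on_continuous[OF A.smooth_transition[OF c(1) c0(1)]]
          A.open_overlap[OF c(1) c0(1)] oW1])
  have Wimg: "W \<subseteq> chart_img c" unfolding W_def chart_img_def by blast
  have W: "transition c c0 x \<in> W1" "chart_inv c0 (transition c c0 x) = chart_inv c x" if "x \<in> W" for x
    using that c c0 A.overlap_mem[OF c(1), of x c0] by (auto simp: W_def transition_def A.chart_inv_chart)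
  have fd: "f (chart_inv c x) \<in> fst d" "transition d0 d (F (transition c c0 x)) = snd d (f (chart_inv c x))"
    if "x \<in> W" for x
  proof -
    have "f (chart_inv c0 (transition c c0 x)) \<in> fst d0"
      using W(1)[OF that] W0(4) by (simp add: W1_def)
    then have f0: "f (chart_inv c x) \<in> fst d0" using W(2)[OF that] by simp
    have FF: "F (transition c c0 x) = snd d0 (f (chart_inv c x))"
      unfolding F_def W(2)[OF that] ..
    show "f (chart_inv c x) \<in> fst d"
      using W(1)[OF that] f0 inj_onD[OF B.inj[OF d0(1)]] unfolding W1_def
      by (auto simp: FF)
    show "transition d0 d (F (transition c c0 x)) = snd d (f (chart_inv c x))"
      unfolding FF by (rule B.transition_chart[OF d0(1) f0])
  qed
  have sub: "transition c c0 ` W \<subseteq> W1" using W by blast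
  have s1: "smooth_on W (transition c c0)"
    using A.smooth_transition[OF c(1) c0(1)] by (rule smooth_on_subset) (auto simp: W_def)
  have s2: "smooth_on W (\<lambda>x. F (transition c c0 x))"
    by (rule smooth_on_compose[OF oW s1 W0(5)[folded F_def]]) (use sub W1_def in blast)
  have "smooth_on W (\<lambda>x. transition d0 d (F (transition c c0 x)))"
    by (rule smooth_on_compose[OF oW s2 B.smooth_transition[OF d0(1) d(1)]])
      (use sub W1_def in blast)
  then have "smooth_on W (snd d \<circ> f \<circ> chart_inv c)"
    by (rule smooth_on_cong_imp[OF oW]) (simp add: fd)
  moreover have "snd c p \<in> W"
    using c c0 d d0 W0(2)
    by (auto simp: W_def W1_def F_def A.transition_chart A.chart_inv_chart)
  ultimately show "\<exists>W. open W \<and> snd c p \<in> W \<and> W \<subseteq> chart_img c \<and>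
      (\<forall>x\<in>W. f (chart_inv c x) \<in> fst d) \<and> smooth_on W (snd d \<circ> f \<circ> chart_inv c)"
    using oW Wimg fd(1) by blast
qed

text \<open>The composition is smooth in every pair of charts because the coordinate expression factors
through any chart around the intermediate point.\<close>

lemma smooth_map_compose:
  assumes A: "smooth_atlas A" and B: "smooth_atlas B"
    and f: "smooth_map A B f" and g: "smooth_map B C g"
  shows "smooth_map A C (\<lambda>x. g (f x))"
  unfolding smooth_map_def
proof (intro ballI conjI impI)
  interpret A: smooth_atlas A by (rule A)
  interpret B: smooth_atlas B by (rule B)
  fix c p assume c: "c \<in> A" "p \<in> fst c"
  obtain d where d: "d \<in> B" "f p \<in> fst d" using smooth_map_target[OF f c] .
  show "\<exists>e\<in>C. g (f p) \<in> fst e" using smooth_map_target[OF g d] by blast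
  fix e assume e: "e \<in> C" "g (f p) \<in> fst e"
  obtain V where V: "open V" "snd c p \<in> V" "V \<subseteq> chart_img c" "\<And>x. x \<in> V \<Longrightarrow> f (chart_inv c x) \<in> fst d"
    "smooth_on V (\<lambda>x. snd d (f (chart_inv c x)))"
    using smooth_mapD[OF f c d] by blast
  obtain U where U: "open U" "snd d (f p) \<in> U" "U \<subseteq> chart_img d" "\<And>x. x \<in> U \<Longrightarrow> g (chart_inv d x) \<in> fst e"
    "smooth_on U (\<lambda>x. snd e (g (chart_inv d x)))"
    using smooth_mapD[OF g d e] by blast
  define W where "W = V \<inter> (\<lambda>x. snd d (f (chart_inv c x))) -` U"
  have oW: "open W"
    unfolding W_def by (rule continuous_open_preimage[OF smooth_on_continuous[OF V(5)] V(1) U(1)])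
  have inv: "chart_inv d (snd d (f (chart_inv c x))) = f (chart_inv c x)" if "x \<in> W" for x
    using V(4) that by (simp add: W_def B.chart_inv_chart[OF d(1)])
  have "smooth_on W (\<lambda>x. snd e (g (chart_inv d (snd d (f (chart_inv c x))))))"
    by (rule smooth_on_compose[OF oW smooth_on_subset[OF V(5)] U(5)]) (auto simp: W_def)
  then have "smooth_on W (snd e \<circ> (\<lambda>x. g (f x)) \<circ> chart_inv c)"
    by (rule smooth_on_cong_imp[OF oW]) (simp add: inv)
  moreover have "\<forall>x\<in>W. g (f (chart_inv c x)) \<in> fst e"
    using U(4) inv by (metis IntD2 W_def vimageD)
  moreover have "snd c p \<in> W"
    using V(2) U(2) by (simp add: W_def A.chart_inv_chart[OF c])
  ultimately show "\<exists>W. open W \<and> snd c p \<in> W \<and> W \<subseteq> chart_img c \<and>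
      (\<forall>x\<in>W. g (f (chart_inv c x)) \<in> fst e) \<and> smooth_on W (snd e \<circ> (\<lambda>x. g (f x)) \<circ> chart_inv c)"
    using oW V(3) W_def by blast
qed


subsection \<open>Tangent maps\<close>

lemma smooth_map_differentiable:
  assumes "smooth_map A B f" "c \<in> A" "p \<in> fst c" "d \<in> B" "f p \<in> fst d"
  shows "(\<lambda>x. snd d (f (chart_inv c x))) differentiable (at (snd c p))"
  by (rule smooth_mapD[OF assms]) (metis smooth_on_differentiable)

lemma DD_change_chart:
  assumes A: "smooth_atlas A" and f: "smooth_map A B f"
    and c: "c \<in> A" "p \<in> fst c" and c': "c' \<in> A" "p \<in> fst c'" and d: "d \<in> B" "f p \<in> fst d"
  shows "DD (\<lambda>x. snd d (f (chart_inv c' x))) (snd c' p) (DD (transition c c') (snd c p) y)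
    = DD (\<lambda>x. snd d (f (chart_inv c x))) (snd c p) y"
proof -
  interpret A: smooth_atlas A by (rule A)
  let ?F = "\<lambda>c x. snd d (f (chart_inv c x))"
  have "DD (?F c) (snd c p) = DD (\<lambda>x. ?F c' (transition c c' x)) (snd c p)"
  proof (rule DD_cong_open[OF A.open_overlap[OF c(1) c'(1)]])
    fix x assume x: "x \<in> snd c ` (fst c \<inter> fst c')"
    then have "chart_inv c x \<in> fst c'" using A.overlap_mem[OF c(1)] by blast
    then show "?F c x = ?F c' (transition c c' x)"
      by (simp add: transition_def A.chart_inv_chart[OF c'(1)])
  qed (use c c' in auto)
  then show ?thesis
    using DD_compose[OF A.transition_differentiable[OF c(1) c'(1) c(2) c'(2)], of "?F c'" y]
      smooth_map_differentiable[OF f c' d] A.transition_chart[OF c] by simp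
qed

text \<open>The tangent map is defined by an arbitrarily chosen chart of the source; by the chain rule for
transition maps it may be computed in any chart.\<close>

lemma tangent_map_chart:
  assumes A: "smooth_atlas A" and f: "smooth_map A B f" and v: "v \<in> tangent_space A p"
    and c: "c \<in> A" "p \<in> fst c" and d: "d \<in> B" "f p \<in> fst d"
  shows "tangent_map A B f p v d = DD (\<lambda>x. snd d (f (chart_inv c x))) (snd c p) (v c)"
proof -
  define c' where "c' = (SOME c. c \<in> A \<and> p \<in> fst c)"
  have c': "c' \<in> A" "p \<in> fst c'" unfolding c'_def using someI[of "\<lambda>c. c \<in> A \<and> p \<in> fst c", OF conjI[OF c]] by auto
  have "tangent_map A B f p v d = DD (\<lambda>x. snd d (f (chart_inv c' x))) (snd c' p) (v c')"
    unfolding tangent_map_def c'_def[symmetric] using d by (simp add: Let_def comp_def)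
  also have "v c' = DD (transition c c') (snd c p) (v c)"
    by (rule smooth_atlas.tangent_transition[OF A v c(1) c'(1) c(2) c'(2)])
  finally show ?thesis by (simp add: DD_change_chart[OF A f c c' d])
qed

lemma tangent_map_outside: "d \<notin> B \<or> f p \<notin> fst d \<Longrightarrow> tangent_map A B f p v d = 0"
  unfolding tangent_map_def by auto

lemma DD_post_transition:
  assumes B: "smooth_atlas B" and f: "smooth_map A B f"
    and c: "c \<in> A" "p \<in> fst c" and d: "d \<in> B" "f p \<in> fst d" and e: "e \<in> B" "f p \<in> fst e"
    and inv: "chart_inv c (snd c p) = p"
  shows "DD (\<lambda>x. snd e (f (chart_inv c x))) (snd c p) y
    = DD (transition d e) (snd d (f p)) (DD (\<lambda>x. snd d (f (chart_inv c x))) (snd c p) y)"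
proof -
  interpret B: smooth_atlas B by (rule B)
  obtain V where V: "open V" "snd c p \<in> V" "\<And>x. x \<in> V \<Longrightarrow> f (chart_inv c x) \<in> fst d"
    by (rule smooth_mapD[OF f c d]) blast
  have "DD (\<lambda>x. snd e (f (chart_inv c x))) (snd c p)
      = DD (\<lambda>x. transition d e (snd d (f (chart_inv c x)))) (snd c p)"
    by (rule DD_cong_open[OF V(1,2)]) (simp add: B.transition_chart[OF d(1) V(3)])
  then show ?thesis
    using DD_compose[OF smooth_map_differentiable[OF f c d], of "transition d e" y] inv
      B.transition_differentiable[OF d(1) e(1) d(2) e(2)] by simp
qed

lemma tangent_map_tangent:
  assumes A: "smooth_atlas A" and B: "smooth_atlas B" and f: "smooth_map A B f"
    and v: "v \<in> tangent_space A p" and p: "p \<in> (\<Union>c\<in>A. fst c)"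
  shows "tangent_map A B f p v \<in> tangent_space B (f p)"
  unfolding tangent_space_def mem_Collect_eq
proof (intro conjI allI ballI impI)
  fix d assume "d \<notin> B \<or> f p \<notin> fst d"
  then show "tangent_map A B f p v d = 0" by (rule tangent_map_outside)
next
  obtain c where c: "c \<in> A" "p \<in> fst c" using p by blast
  fix d e assume d: "d \<in> B" and e: "e \<in> B" and "f p \<in> fst d \<inter> fst e"
  then have p: "f p \<in> fst d" "f p \<in> fst e" by auto
  show "tangent_map A B f p v e = DD (transition d e) (snd d (f p)) (tangent_map A B f p v d)"
    unfolding tangent_map_chart[OF A f v c d p(1)] tangent_map_chart[OF A f v c e p(2)]
    by (rule DD_post_transition[OF B f c d p(1) e p(2) smooth_atlas.chart_inv_chart[OF A c]])
qed

lemma tangent_map_compose: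
  assumes A: "smooth_atlas A" and B: "smooth_atlas B"
    and f: "smooth_map A B f" and g: "smooth_map B C g"
    and v: "v \<in> tangent_space A p" and p: "p \<in> (\<Union>c\<in>A. fst c)"
  shows "tangent_map A C (\<lambda>x. g (f x)) p v = tangent_map B C g (f p) (tangent_map A B f p v)"
proof
  fix e
  obtain c where c: "c \<in> A" "p \<in> fst c" using p by blast
  obtain d where d: "d \<in> B" "f p \<in> fst d" using smooth_map_target[OF f c] .
  have inv: "chart_inv c (snd c p) = p" by (rule smooth_atlas.chart_inv_chart[OF A c])
  show "tangent_map A C (\<lambda>x. g (f x)) p v e = tangent_map B C g (f p) (tangent_map A B f p v) e"
  proof (cases "e \<in> C \<and> g (f p) \<in> fst e")
    case True
    then have e: "e \<in> C" "g (f p) \<in> fst e" by auto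
    obtain V where V: "open V" "snd c p \<in> V" "\<And>x. x \<in> V \<Longrightarrow> f (chart_inv c x) \<in> fst d"
      by (rule smooth_mapD[OF f c d]) blast
    have "tangent_map A C (\<lambda>x. g (f x)) p v e = DD (\<lambda>x. snd e (g (f (chart_inv c x)))) (snd c p) (v c)"
      by (rule tangent_map_chart[OF A smooth_map_compose[OF A B f g] v c e])
    also have "DD (\<lambda>x. snd e (g (f (chart_inv c x)))) (snd c p)
        = DD (\<lambda>x. snd e (g (chart_inv d (snd d (f (chart_inv c x)))))) (snd c p)"
      by (rule DD_cong_open[OF V(1,2)]) (simp add: smooth_atlas.chart_inv_chart[OF B d(1) V(3)])
    also have "\<dots> (v c) = DD (\<lambda>y. snd e (g (chart_inv d y))) (snd d (f p))
        (DD (\<lambda>x. snd d (f (chart_inv c x))) (snd c p) (v c))"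
      using DD_compose[OF smooth_map_differentiable[OF f c d],
          of "\<lambda>y. snd e (g (chart_inv d y))"] smooth_map_differentiable[OF g d e] inv by simp
    finally show ?thesis
      using tangent_map_chart[OF B g tangent_map_tangent[OF A B f v p] d e]
      by (simp add: tangent_map_chart[OF A f v c d])
  qed (auto simp: tangent_map_outside)
qed

text \<open>Maps such as left translations are only determined on the manifold itself; identities between
them yield identities between tangent maps.\<close>

lemma tangent_map_cong:
  fixes A :: "('a, 'e::euclidean_space) chart set" and B :: "('b, 'f::euclidean_space) chart set"
  assumes A: "smooth_atlas A" and p: "p \<in> (\<Union>c\<in>A. fst c)"
    and eq: "\<And>q. q \<in> (\<Union>c\<in>A. fst c) \<Longrightarrow> f q = g q"
  shows "tangent_map A B f p v = tangent_map A B g p v"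
proof
  fix d :: "('b, 'f) chart"
  define c where "c = (SOME c. c \<in> A \<and> p \<in> fst c)"
  have "\<exists>c. c \<in> A \<and> p \<in> fst c" using p by blast
  from someI_ex[OF this] have c: "c \<in> A" "p \<in> fst c" unfolding c_def by blast+
  have "DD (snd d \<circ> f \<circ> chart_inv c) (snd c p) = DD (snd d \<circ> g \<circ> chart_inv c) (snd c p)"
    by (rule DD_cong_open[OF smooth_atlas.open_img[OF A c(1)]])
      (use c in \<open>auto simp: chart_in_img intro!: arg_cong[of _ _ "snd d"] eq chart_inv_in\<close>)
  then show "tangent_map A B f p v d = tangent_map A B g p v d"
    unfolding tangent_map_def c_def[symmetric] by (simp add: eq[OF p] Let_def)
qed

lemma tangent_map_ident:
  assumes A: "smooth_atlas A" and p: "p \<in> (\<Union>c\<in>A. fst c)" and v: "v \<in> tangent_space A p"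
    and eq: "\<And>q. q \<in> (\<Union>c\<in>A. fst c) \<Longrightarrow> f q = q"
  shows "tangent_map A A f p v = v"
proof -
  interpret A: smooth_atlas A by (rule A)
  have id: "smooth_map A A (\<lambda>x. x)"
  proof (rule smooth_mapI[OF A A])
    fix q assume "q \<in> (\<Union>c\<in>A. fst c)"
    then obtain c where c: "c \<in> A" "q \<in> fst c" by blast
    have "smooth_on (chart_img c) (\<lambda>x. snd c (chart_inv c x))"
      by (rule smooth_on_cong_imp[OF A.open_img[OF c(1)] smooth_on_bounded_linear[OF bounded_linear_ident]])
        (simp add: chart_chart_inv)
    then show "\<exists>c\<in>A. \<exists>d\<in>A. \<exists>W. q \<in> fst c \<and> q \<in> fst d \<and> open W \<and> snd c q \<in> W \<and> W \<subseteq> chart_img c \<and>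
        (\<forall>x\<in>W. chart_inv c x \<in> fst d) \<and> smooth_on W (\<lambda>x. snd d (chart_inv c x))"
      using c A.open_img[OF c(1)] chart_in_img[OF c(2)]
      by (intro bexI[of _ c] exI[of _ "chart_img c"]) (auto intro: chart_inv_in)
  qed
  obtain c where c: "c \<in> A" "p \<in> fst c" using p by blast
  have "tangent_map A A (\<lambda>x. x) p v = v"
  proof (rule A.tangent_ext[OF tangent_map_tangent[OF A A id v p] v c])
    have "DD (\<lambda>x. snd c (chart_inv c x)) (snd c p) = DD (\<lambda>x. x) (snd c p)"
      by (rule DD_cong_open[OF A.open_img[OF c(1)]]) (simp_all add: chart_in_img c chart_chart_inv)
    then show "tangent_map A A (\<lambda>x. x) p v c = v c"
      using tangent_map_chart[OF A id v c c] by simp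
  qed
  then show ?thesis using tangent_map_cong[OF A p, of f "\<lambda>x. x" A v] eq by simp
qed

subsection \<open>Curves\<close>

lemma chart_inv_interval: "t \<in> I \<Longrightarrow> chart_inv (I, \<lambda>t. t) t = t"
  using inv_into_f_f[of "\<lambda>t. t" I t] by (simp add: chart_inv_def)

lemma interval_atlas:
  assumes "open I"
  shows "smooth_atlas {(I, \<lambda>t::real. t)}"
proof
  fix c d :: "(real, real) chart" assume c: "c \<in> {(I, \<lambda>t. t)}" and d: "d \<in> {(I, \<lambda>t. t)}"
  show "inj_on (snd c) (fst c)" "open (chart_img c)" "open (snd c ` (fst c \<inter> fst d))"
    using c d assms by (auto simp: chart_img_def)
  have "smooth_on I (transition (I, \<lambda>t. t) (I, \<lambda>t. t))"
    by (rule smooth_on_cong_imp[OF assms smooth_on_bounded_linear[OF bounded_linear_ident]])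
      (simp add: transition_def chart_inv_interval)
  then show "smooth_on (snd c ` (fst c \<inter> fst d)) (transition c d)"
    using c d by simp
qed

lemma smooth_curveD:
  assumes "smooth_curve A I \<gamma>" "t \<in> I" "c \<in> A" "\<gamma> t \<in> fst c"
  obtains W where "open W" "t \<in> W" "W \<subseteq> I" "\<And>s. s \<in> W \<Longrightarrow> \<gamma> s \<in> fst c"
    "smooth_on W (\<lambda>s. snd c (\<gamma> s))"
proof -
  obtain W where W: "open W" "t \<in> W" "W \<subseteq> I" "\<And>s. s \<in> W \<Longrightarrow> \<gamma> (chart_inv (I, \<lambda>t. t) s) \<in> fst c"
    "smooth_on W (\<lambda>s. snd c (\<gamma> (chart_inv (I, \<lambda>t. t) s)))"
    using smooth_mapD[of "{(I, \<lambda>t. t)}" A \<gamma> "(I, \<lambda>t. t)" t c] assms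
    unfolding smooth_curve_def by (auto simp: chart_img_def)
  have inv: "chart_inv (I, \<lambda>t. t) s = s" if "s \<in> W" for s
    using W(3) that by (intro chart_inv_interval) blast
  show ?thesis
    by (rule that[OF W(1-3)], use W(4) inv in force,
        rule smooth_on_cong_imp[OF W(1,5)]) (simp add: inv)
qed

lemma smooth_curveI:
  assumes A: "smooth_atlas A" and I: "open I"
    and one: "\<And>t. t \<in> I \<Longrightarrow> \<exists>c\<in>A. \<exists>W. open W \<and> t \<in> W \<and> W \<subseteq> I \<and> (\<forall>s\<in>W. \<gamma> s \<in> fst c) \<and>
      smooth_on W (\<lambda>s. snd c (\<gamma> s))"
  shows "smooth_curve A I \<gamma>"
  unfolding smooth_curve_def
proof (rule smooth_mapI[OF interval_atlas[OF I] A])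
  fix t assume "t \<in> (\<Union>c\<in>{(I, \<lambda>t. t)}. fst c)"
  then have t: "t \<in> I" by simp
  obtain c W where c: "c \<in> A" and W: "open W" "t \<in> W" "W \<subseteq> I" "\<forall>s\<in>W. \<gamma> s \<in> fst c"
      "smooth_on W (\<lambda>s. snd c (\<gamma> s))"
    using one[OF t] by blast
  have inv: "chart_inv (I, \<lambda>t. t) s = s" if "s \<in> W" for s
    using W(3) that by (intro chart_inv_interval) blast
  have "smooth_on W (\<lambda>s. snd c (\<gamma> (chart_inv (I, \<lambda>t. t) s)))"
    by (rule smooth_on_cong_imp[OF W(1,5)]) (simp add: inv)
  then show "\<exists>c\<in>{(I, \<lambda>t. t)}. \<exists>d\<in>A. \<exists>W. t \<in> fst c \<and> \<gamma> t \<in> fst d \<and> open W \<and> snd c t \<in> W \<and>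
      W \<subseteq> chart_img c \<and> (\<forall>x\<in>W. \<gamma> (chart_inv c x) \<in> fst d) \<and>
      smooth_on W (\<lambda>x. snd d (\<gamma> (chart_inv c x)))"
    using t c W inv by (intro bexI[of _ "(I, \<lambda>t. t)"] bexI[of _ c] exI[of _ W])
      (auto simp: chart_img_def)
qed

lemma velocity_chart:
  assumes "smooth_curve A I \<gamma>" "t \<in> I" "c \<in> A" "\<gamma> t \<in> fst c"
  shows "((\<lambda>s. snd c (\<gamma> s)) has_vector_derivative velocity A \<gamma> t c) (at t)"
proof -
  obtain W where "t \<in> W" "smooth_on W (\<lambda>s. snd c (\<gamma> s))"
    by (rule smooth_curveD[OF assms]) blast
  then have "(\<lambda>s. snd c (\<gamma> s)) differentiable (at t)"
    using smooth_on_differentiable by blast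
  then show ?thesis
    using assms(3,4) by (simp add: velocity_def comp_def vector_derivative_works)
qed

lemma velocity_compose:
  assumes A: "smooth_atlas A" and B: "smooth_atlas B" and g: "smooth_curve A I \<gamma>" and t: "t \<in> I"
    and f: "smooth_map A B f" and v: "velocity A \<gamma> t \<in> tangent_space A (\<gamma> t)"
  shows "velocity B (\<lambda>s. f (\<gamma> s)) t = tangent_map A B f (\<gamma> t) (velocity A \<gamma> t)"
proof
  fix d
  obtain c where c: "c \<in> A" "\<gamma> t \<in> fst c"
    using g smooth_map_target[of "{(I, \<lambda>t. t)}" A \<gamma> "(I, \<lambda>t. t)" t] t
    unfolding smooth_curve_def by auto
  show "velocity B (\<lambda>s. f (\<gamma> s)) t d = tangent_map A B f (\<gamma> t) (velocity A \<gamma> t) d"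
  proof (cases "d \<in> B \<and> f (\<gamma> t) \<in> fst d")
    case True
    then have d: "d \<in> B" "f (\<gamma> t) \<in> fst d" by auto
    let ?F = "\<lambda>x. snd d (f (chart_inv c x))"
    obtain W where W: "open W" "t \<in> W" "\<And>s. s \<in> W \<Longrightarrow> \<gamma> s \<in> fst c"
      by (rule smooth_curveD[OF g t c]) blast
    have "(?F has_derivative DD ?F (snd c (\<gamma> t))) (at (snd c (\<gamma> t)))"
      by (rule DD_works[OF smooth_map_differentiable[OF f c d]])
    from has_derivative_compose[OF velocity_chart[OF g t c, unfolded has_vector_derivative_def] this]
    have "((\<lambda>s. ?F (snd c (\<gamma> s))) has_vector_derivative DD ?F (snd c (\<gamma> t)) (velocity A \<gamma> t c)) (at t)"
      using linear_scale[OF linear_frechet_derivative[OF smooth_map_differentiable[OF f c d]]]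
      by (simp add: has_vector_derivative_def)
    then have "((\<lambda>s. snd d (f (\<gamma> s))) has_vector_derivative DD ?F (snd c (\<gamma> t)) (velocity A \<gamma> t c)) (at t)"
      by (rule has_vector_derivative_transform_within_open[OF _ W(1,2)])
        (simp add: smooth_atlas.chart_inv_chart[OF A c(1) W(3)])
    then show ?thesis
      using d tangent_map_chart[OF A f v c d]
      by (simp add: velocity_def comp_def vector_derivative_at)
  qed (auto simp: velocity_def tangent_map_outside)
qed

text \<open>The components of a velocity in two charts are related by the chain rule for the transition map.\<close>

lemma velocity_tangent:
  assumes A: "smooth_atlas A" and g: "smooth_curve A I \<gamma>" and t: "t \<in> I"
  shows "velocity A \<gamma> t \<in> tangent_space A (\<gamma> t)"
  unfolding tangent_space_def mem_Collect_eq
proof (intro conjI allI ballI impI)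
  fix c assume "c \<notin> A \<or> \<gamma> t \<notin> fst c"
  then show "velocity A \<gamma> t c = 0" by (auto simp: velocity_def)
next
  interpret A: smooth_atlas A by (rule A)
  fix c d assume c: "c \<in> A" and d: "d \<in> A" and p: "\<gamma> t \<in> fst c \<inter> fst d"
  then have p: "\<gamma> t \<in> fst c" "\<gamma> t \<in> fst d" by auto
  let ?T = "transition c d"
  obtain W where W: "open W" "t \<in> W" "\<And>s. s \<in> W \<Longrightarrow> \<gamma> s \<in> fst c"
    by (rule smooth_curveD[OF g t c p(1)]) blast
  have dT: "?T differentiable (at (snd c (\<gamma> t)))" by (rule A.transition_differentiable[OF c d p])
  from has_derivative_compose[OF velocity_chart[OF g t c p(1), unfolded has_vector_derivative_def] DD_works[OF dT]]
  have "((\<lambda>s. ?T (snd c (\<gamma> s))) has_vector_derivative DD ?T (snd c (\<gamma> t)) (velocity A \<gamma> t c)) (at t)"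
    using linear_scale[OF linear_frechet_derivative[OF dT]] by (simp add: has_vector_derivative_def)
  then have "((\<lambda>s. snd d (\<gamma> s)) has_vector_derivative DD ?T (snd c (\<gamma> t)) (velocity A \<gamma> t c)) (at t)"
    by (rule has_vector_derivative_transform_within_open[OF _ W(1,2)])
      (simp add: A.transition_chart[OF c W(3)])
  then show "velocity A \<gamma> t d = DD ?T (snd c (\<gamma> t)) (velocity A \<gamma> t c)"
    using velocity_chart[OF g t d p(2)] vector_derivative_at by metis
qed

lemma smooth_curve_of_chart:
  assumes A: "smooth_atlas A" and I: "open I" and c: "c \<in> A"
    and x: "smooth_on I x" "\<And>t. t \<in> I \<Longrightarrow> x t \<in> chart_img c"
  shows "smooth_curve A I (\<lambda>t. chart_inv c (x t))"
proof (rule smooth_curveI[OF A I])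
  fix t assume t: "t \<in> I"
  have "smooth_on I (\<lambda>s. snd c (chart_inv c (x s)))"
    by (rule smooth_on_cong_imp[OF I x(1)]) (simp add: chart_chart_inv x(2))
  then show "\<exists>c'\<in>A. \<exists>W. open W \<and> t \<in> W \<and> W \<subseteq> I \<and> (\<forall>s\<in>W. chart_inv c (x s) \<in> fst c') \<and>
      smooth_on W (\<lambda>s. snd c' (chart_inv c (x s)))"
    using c I t x(2) by (intro bexI[of _ c] exI[of _ I]) (auto intro: chart_inv_in)
qed

lemma velocity_of_chart:
  assumes "open I" "t \<in> I" "c \<in> A" "\<And>t. t \<in> I \<Longrightarrow> x t \<in> chart_img c"
    "(x has_vector_derivative x') (at t)"
  shows "velocity A (\<lambda>t. chart_inv c (x t)) t c = x'"
proof -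
  have "((\<lambda>t. snd c (chart_inv c (x t))) has_vector_derivative x') (at t)"
    by (rule has_vector_derivative_transform_within_open[OF assms(5,1,2)])
      (simp add: chart_chart_inv assms(4))
  then show ?thesis
    using assms by (simp add: velocity_def comp_def vector_derivative_at chart_inv_in)
qed

subsection \<open>Maps on products\<close>

text \<open>A chart of the product is a pair of charts, and its inverse is the pair of their inverses.\<close>

lemma prod_atlas_chart:
  assumes A: "smooth_atlas A" and B: "smooth_atlas B"
    and F: "smooth_map (prod_atlas A B) C F"
    and c: "c \<in> A" "p \<in> fst c" and d: "d \<in> B" "q \<in> fst d" and e: "e \<in> C" "F (p, q) \<in> fst e"
  obtains W where "open W" "(snd c p, snd d q) \<in> W" "W \<subseteq> chart_img c \<times> chart_img d"
    "\<And>x y. (x, y) \<in> W \<Longrightarrow> F (chart_inv c x, chart_inv d y) \<in> fst e"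
    "smooth_on W (\<lambda>z. snd e (F (chart_inv c (fst z), chart_inv d (snd z))))"
proof -
  interpret A: smooth_atlas A by (rule A)
  interpret B: smooth_atlas B by (rule B)
  let ?c = "(fst c \<times> fst d, map_prod (snd c) (snd d))"
  have mem: "?c \<in> prod_atlas A B"
    unfolding prod_atlas_def using c d by (auto intro!: image_eqI[of _ _ "(c, d)"])
  obtain W where W: "open W" "snd ?c (p, q) \<in> W" "W \<subseteq> chart_img ?c"
    "\<And>x. x \<in> W \<Longrightarrow> F (chart_inv ?c x) \<in> fst e" "smooth_on W (\<lambda>x. snd e (F (chart_inv ?c x)))"
    using smooth_mapD[OF F mem _ e] c d by auto
  have img: "chart_img ?c = chart_img c \<times> chart_img d"
    unfolding chart_img_def by (simp add: map_prod_surj_on)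
  have inv: "chart_inv ?c z = (chart_inv c (fst z), chart_inv d (snd z))" if "z \<in> W" for z
  proof -
    have z: "fst z \<in> chart_img c" "snd z \<in> chart_img d" using that W(3) img by auto
    let ?p = "(chart_inv c (fst z), chart_inv d (snd z))"
    have "inj_on (map_prod (snd c) (snd d)) (fst c \<times> fst d)"
      using A.inj[OF c(1)] B.inj[OF d(1)] by (rule map_prod_inj_on)
    moreover have "?p \<in> fst c \<times> fst d" using z by (simp add: chart_inv_in)
    moreover have "z = map_prod (snd c) (snd d) ?p" using z by (simp add: chart_chart_inv)
    ultimately show ?thesis
      using inv_into_f_f[of "map_prod (snd c) (snd d)" "fst c \<times> fst d" ?p]
      unfolding chart_inv_def[of ?c] fst_conv snd_conv by simp
  qed
  show ?thesis
  proof (rule that[OF W(1)])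
    show "(snd c p, snd d q) \<in> W" "W \<subseteq> chart_img c \<times> chart_img d"
      using W(2,3) img by auto
    show "F (chart_inv c x, chart_inv d y) \<in> fst e" if "(x, y) \<in> W" for x y
      using W(4)[OF that] inv[OF that] by simp
    show "smooth_on W (\<lambda>z. snd e (F (chart_inv c (fst z), chart_inv d (snd z))))"
      by (rule smooth_on_cong_imp[OF W(1,5)]) (simp add: inv)
  qed
qed

lemma prod_atlas_target:
  assumes "smooth_map (prod_atlas A B) C F" "c \<in> A" "p \<in> fst c" "d \<in> B" "q \<in> fst d"
  obtains e where "e \<in> C" "F (p, q) \<in> fst e"
proof -
  have "(fst c \<times> fst d, map_prod (snd c) (snd d)) \<in> prod_atlas A B"
    unfolding prod_atlas_def using assms by (auto intro!: image_eqI[of _ _ "(c, d)"])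
  from smooth_map_target[OF assms(1) this, of "(p, q)"] show ?thesis
    using that assms by auto
qed

lemma smooth_map_slice:
  assumes A: "smooth_atlas A" and B: "smooth_atlas B" and C: "smooth_atlas C"
    and F: "smooth_map (prod_atlas A B) C F" and p: "p \<in> (\<Union>c\<in>A. fst c)"
  shows "smooth_map B C (\<lambda>q. F (p, q))"
proof (rule smooth_mapI[OF B C])
  obtain c where c: "c \<in> A" "p \<in> fst c" using p by blast
  fix q assume "q \<in> (\<Union>d\<in>B. fst d)"
  then obtain d where d: "d \<in> B" "q \<in> fst d" by blast
  obtain e where e: "e \<in> C" "F (p, q) \<in> fst e" using prod_atlas_target[OF F c d] .
  obtain W where W: "open W" "(snd c p, snd d q) \<in> W" "W \<subseteq> chart_img c \<times> chart_img d"
    "\<And>x y. (x, y) \<in> W \<Longrightarrow> F (chart_inv c x, chart_inv d y) \<in> fst e"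
    "smooth_on W (\<lambda>z. snd e (F (chart_inv c (fst z), chart_inv d (snd z))))"
    by (rule prod_atlas_chart[OF A B F c d e]) blast
  define V where "V = Pair (snd c p) -` W"
  have oV: "open V" unfolding V_def using W(1) by (intro open_vimage continuous_intros)
  have inv: "chart_inv c (snd c p) = p" by (rule smooth_atlas.chart_inv_chart[OF A c])
  have sp: "smooth_on V (\<lambda>y. (snd c p, y))"
    by (rule smooth_on_Pair[OF oV smooth_on_const smooth_on_bounded_linear[OF bounded_linear_ident]])
  have "smooth_on V (\<lambda>y. snd e (F (p, chart_inv d y)))"
    using smooth_on_compose[OF oV sp W(5)] by (auto simp: V_def inv)
  then show "\<exists>d\<in>B. \<exists>e\<in>C. \<exists>W. q \<in> fst d \<and> F (p, q) \<in> fst e \<and> open W \<and> snd d q \<in> W \<and>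
      W \<subseteq> chart_img d \<and> (\<forall>x\<in>W. F (p, chart_inv d x) \<in> fst e) \<and>
      smooth_on W (\<lambda>x. snd e (F (p, chart_inv d x)))"
    using d e oV W(2,3) W(4)[of "snd c p"]
    by (intro bexI[of _ d] bexI[of _ e] exI[of _ V]) (auto simp: V_def inv)
qed


subsection \<open>The slit tangent bundle and geodesics\<close>

context smooth_atlas
begin

lemma lift_chart_mem: "(p, v) \<in> fst (lift_chart A c) \<longleftrightarrow> p \<in> fst c \<and> v \<in> tangent_space A p \<and> v \<noteq> 0"
  by (simp add: lift_chart_def)

lemma lift_chart_apply: "snd (lift_chart A c) (p, v) = (snd c p, v c)"
  by (simp add: lift_chart_def)

lemma tangent_nonzero: "v \<in> tangent_space A p \<Longrightarrow> c \<in> A \<Longrightarrow> p \<in> fst c \<Longrightarrow> v \<noteq> 0 \<longleftrightarrow> v c \<noteq> 0"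
  using tangent_ext[OF _ tangent_zero, of v p c] by auto

lemma chart_vector_lift_mem:
  "c \<in> A \<Longrightarrow> d \<in> A \<Longrightarrow> p \<in> fst c \<Longrightarrow> p \<in> fst d \<Longrightarrow> y \<noteq> 0 \<Longrightarrow> (p, chart_vector c p y) \<in> fst (lift_chart A d)"
  using tangent_nonzero[OF chart_vector_tangent, of c p c y]
  by (simp add: lift_chart_mem chart_vector_tangent chart_vector_comp)

lemma lift_chart_overlap_img:
  assumes c: "c \<in> A" and d: "d \<in> A"
  shows "snd (lift_chart A c) ` (fst (lift_chart A c) \<inter> fst (lift_chart A d))
    = snd c ` (fst c \<inter> fst d) \<times> (- {0})"
proof (intro equalityI subsetI)
  fix z assume "z \<in> snd (lift_chart A c) ` (fst (lift_chart A c) \<inter> fst (lift_chart A d))"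
  then obtain p v where "z = (snd c p, v c)" "p \<in> fst c" "p \<in> fst d" "v \<in> tangent_space A p" "v \<noteq> 0"
    by (auto simp: lift_chart_mem lift_chart_apply)
  then show "z \<in> snd c ` (fst c \<inter> fst d) \<times> (- {0})" using tangent_nonzero[of v p c] c by auto
next
  fix z :: "'e \<times> 'e" assume "z \<in> snd c ` (fst c \<inter> fst d) \<times> (- {0})"
  then obtain p y where z: "z = (snd c p, y)" and p: "p \<in> fst c" "p \<in> fst d" and y: "y \<noteq> 0" by auto
  show "z \<in> snd (lift_chart A c) ` (fst (lift_chart A c) \<inter> fst (lift_chart A d))"
    using chart_vector_lift_mem[OF c d p y] chart_vector_lift_mem[OF c c p(1) p(1) y] c p z
    by (intro image_eqI[of _ _ "(p, chart_vector c p y)"]) (auto simp: lift_chart_apply chart_vector_comp)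
qed

lemma lift_chart_img: "c \<in> A \<Longrightarrow> chart_img (lift_chart A c) = chart_img c \<times> (- {0})"
  using lift_chart_overlap_img[of c c] by (simp add: chart_img_def)

lemma lift_chart_inj: "c \<in> A \<Longrightarrow> inj_on (snd (lift_chart A c)) (fst (lift_chart A c))"
proof (rule inj_onI)
  fix z w assume c: "c \<in> A" and z: "z \<in> fst (lift_chart A c)" and w: "w \<in> fst (lift_chart A c)"
    and eq: "snd (lift_chart A c) z = snd (lift_chart A c) w"
  obtain p v q u where zw: "z = (p, v)" "w = (q, u)" by (metis surj_pair)
  have "p = q"
    using z w eq inj_onD[OF inj[OF c]] by (auto simp: zw lift_chart_mem lift_chart_apply)
  moreover have "v = u"
    using z w eq c tangent_ext[of v p u c] \<open>p = q\<close> by (auto simp: zw lift_chart_mem lift_chart_apply)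
  ultimately show "z = w" by (simp add: zw)
qed

lemma lift_chart_inv:
  assumes "c \<in> A" "p \<in> fst c" "v \<in> tangent_space A p" "v \<noteq> 0"
  shows "chart_inv (lift_chart A c) (snd c p, v c) = (p, v)"
  using inv_into_f_f[OF lift_chart_inj[OF assms(1)], of "(p, v)"] assms
  by (simp add: chart_inv_def lift_chart_mem lift_chart_apply)

text \<open>The transition maps of the slit tangent bundle are \<open>(x, y) \<mapsto> (\<tau>(x), D\<tau>(x) y)\<close>, where \<open>\<tau>\<close> is
a transition map of the base; in particular they are smooth.\<close>

lemma lift_transition:
  assumes "c \<in> A" "d \<in> A" "p \<in> fst c" "p \<in> fst d" "y \<noteq> 0"
  shows "transition (lift_chart A c) (lift_chart A d) (snd c p, y)
    = (transition c d (snd c p), DD (transition c d) (snd c p) y)"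
proof -
  have "chart_vector c p y \<noteq> 0" "chart_vector c p y c = y"
    using chart_vector_lift_mem[OF assms(1,1,3,3,5)] by (auto simp: lift_chart_mem chart_vector_comp assms)
  then have "chart_inv (lift_chart A c) (snd c p, y) = (p, chart_vector c p y)"
    using lift_chart_inv[OF assms(1,3) chart_vector_tangent[OF assms(1,3)], of y] by simp
  then show ?thesis
    using assms by (simp add: transition_def lift_chart_apply chart_inv_chart)
      (simp add: chart_vector_def transition_def)
qed

lemma slit_smooth_atlas: "smooth_atlas (slit_atlas A)"
proof
  fix C D assume "C \<in> slit_atlas A" "D \<in> slit_atlas A"
  then obtain c d where C: "C = lift_chart A c" "c \<in> A" and D: "D = lift_chart A d" "d \<in> A"
    by (auto simp: slit_atlas_def)
  show "inj_on (snd C) (fst C)" using C lift_chart_inj by simp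
  show "open (chart_img C)" using C open_img[OF C(2)] by (simp add: lift_chart_img open_Times open_Compl)
  have img: "snd C ` (fst C \<inter> fst D) = snd c ` (fst c \<inter> fst d) \<times> (- {0})"
    using C D lift_chart_overlap_img by simp
  have op: "open (snd c ` (fst c \<inter> fst d) \<times> (- {0 :: 'e}))"
    using open_overlap[OF C(2) D(2)] by (intro open_Times) auto
  then show "open (snd C ` (fst C \<inter> fst D))" unfolding img .
  have "smooth_on (snd c ` (fst c \<inter> fst d) \<times> (- {0}))
      (\<lambda>z. (transition c d (fst z), DD (transition c d) (fst z) (snd z)))"
  proof (rule smooth_on_Pair[OF op])
    note fst = smooth_on_bounded_linear[OF bounded_linear_fst]
    show "smooth_on (snd c ` (fst c \<inter> fst d) \<times> (- {0 :: 'e})) (\<lambda>z. transition c d (fst z))"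
      by (rule smooth_on_compose[OF op fst smooth_transition[OF C(2) D(2)]]) auto
    show "smooth_on (snd c ` (fst c \<inter> fst d) \<times> (- {0}))
        (\<lambda>z. DD (transition c d) (fst z) (snd z))"
      by (rule smooth_on_DD_apply[OF op fst smooth_on_bounded_linear[OF bounded_linear_snd]
            smooth_transition[OF C(2) D(2)]]) auto
  qed
  then show "smooth_on (snd C ` (fst C \<inter> fst D)) (transition C D)"
    unfolding img
  proof (rule smooth_on_cong_imp[OF op])
    fix z :: "'e \<times> 'e" assume "z \<in> snd c ` (fst c \<inter> fst d) \<times> (- {0})"
    then obtain p y where "z = (snd c p, y)" "p \<in> fst c" "p \<in> fst d" "y \<noteq> 0" by auto
    then show "(transition c d (fst z), DD (transition c d) (fst z) (snd z)) = transition C D z"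
      using lift_transition[OF C(2) D(2), of p y] C D by simp
  qed
qed

lemma spray_in_lift_chart:
  assumes "spray A S" "c \<in> A" "p \<in> fst c" "v \<in> tangent_space A p" "v \<noteq> 0"
  shows "S (p, v) (lift_chart A c) = (v c, - 2 *\<^sub>R spray_coeff A S c (snd c p) (v c))"
proof -
  have "vf_in_chart (lift_chart A c) S (snd c p, v c) = (v c, - 2 *\<^sub>R spray_coeff A S c (snd c p) (v c))"
    using assms tangent_nonzero[of v p c] chart_in_img[of p c] unfolding spray_def by blast
  then show ?thesis using lift_chart_inv[OF assms(2-5)] by (simp add: vf_in_chart_def)
qed

lemma smooth_spray_coeff:
  assumes "spray A S" "c \<in> A"
  shows "smooth_on (chart_img c \<times> (- {0})) (\<lambda>z. spray_coeff A S c (fst z) (snd z))"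
proof -
  have op: "open (chart_img c \<times> (- {0 :: 'e}))" using open_img[OF assms(2)] by (intro open_Times) auto
  have "lift_chart A c \<in> slit_atlas A" using assms(2) by (simp add: slit_atlas_def)
  then have "smooth_on (chart_img c \<times> (- {0})) (vf_in_chart (lift_chart A c) S)"
    using assms lift_chart_img unfolding spray_def smooth_vector_field_def by metis
  then have "smooth_on (chart_img c \<times> (- {0})) (\<lambda>z. (- 1 / 2) *\<^sub>R snd (vf_in_chart (lift_chart A c) S z))"
    by (rule smooth_on_linear_compose[OF op])
      (intro bounded_linear_compose[OF bounded_linear_scaleR_right bounded_linear_snd])
  then show ?thesis by (rule smooth_on_cong_imp[OF op]) (simp add: spray_coeff_def)
qed

lemma smooth_velocity:
  assumes g: "smooth_curve A I \<gamma>" and t: "t \<in> I" and c: "c \<in> A" "\<gamma> t \<in> fst c"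
  obtains W where "open W" "t \<in> W" "W \<subseteq> I" "\<And>s. s \<in> W \<Longrightarrow> \<gamma> s \<in> fst c"
    "smooth_on W (\<lambda>s. snd c (\<gamma> s))" "smooth_on W (\<lambda>s. velocity A \<gamma> s c)"
proof -
  obtain W where W: "open W" "t \<in> W" "W \<subseteq> I" "\<And>s. s \<in> W \<Longrightarrow> \<gamma> s \<in> fst c"
    "smooth_on W (\<lambda>s. snd c (\<gamma> s))"
    by (rule smooth_curveD[OF g t c]) blast
  have eq: "DD (\<lambda>s. snd c (\<gamma> s)) s 1 = velocity A \<gamma> s c" if "s \<in> W" for s
    using DD_eq[OF velocity_chart[OF g _ c(1) W(4)[OF that], unfolded has_vector_derivative_def]] that W(3)
    by auto
  have "smooth_on W (\<lambda>s. velocity A \<gamma> s c)"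
    by (rule smooth_on_cong_imp[OF W(1) smooth_on_DD[OF W(5)]]) (rule eq)
  then show ?thesis using that W by blast
qed

lemma smooth_velocity_curve:
  assumes g: "smooth_curve A I \<gamma>" and I: "open I" and nz: "\<And>t. t \<in> I \<Longrightarrow> velocity A \<gamma> t \<noteq> 0"
  shows "smooth_curve (slit_atlas A) I (\<lambda>t. (\<gamma> t, velocity A \<gamma> t))"
proof (rule smooth_curveI[OF slit_smooth_atlas I])
  fix t assume t: "t \<in> I"
  obtain c where c: "c \<in> A" "\<gamma> t \<in> fst c"
    using g smooth_map_target[of "{(I, \<lambda>t. t)}" A \<gamma> "(I, \<lambda>t. t)" t] t
    unfolding smooth_curve_def by auto
  obtain W where W: "open W" "t \<in> W" "W \<subseteq> I" "\<And>s. s \<in> W \<Longrightarrow> \<gamma> s \<in> fst c"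
    "smooth_on W (\<lambda>s. snd c (\<gamma> s))" "smooth_on W (\<lambda>s. velocity A \<gamma> s c)"
    by (rule smooth_velocity[OF g t c]) blast
  have "\<forall>s\<in>W. (\<gamma> s, velocity A \<gamma> s) \<in> fst (lift_chart A c)"
    using W velocity_tangent[OF smooth_atlas_axioms g] nz by (auto simp: lift_chart_mem)
  moreover have "smooth_on W (\<lambda>s. snd (lift_chart A c) (\<gamma> s, velocity A \<gamma> s))"
    unfolding lift_chart_apply by (rule smooth_on_Pair[OF W(1,5,6)])
  ultimately show "\<exists>C\<in>slit_atlas A. \<exists>W. open W \<and> t \<in> W \<and> W \<subseteq> I \<and>
      (\<forall>s\<in>W. (\<gamma> s, velocity A \<gamma> s) \<in> fst C) \<and> smooth_on W (\<lambda>s. snd C (\<gamma> s, velocity A \<gamma> s))"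
    using c W by (intro bexI[of _ "lift_chart A c"] exI[of _ W]) (auto simp: slit_atlas_def)
qed

text \<open>The two components of the equation for integral curves in the chart \<open>lift_chart A c\<close>: the first
is \<open>x' = y\<close>, the second is the geodesic equation.\<close>

lemma geodesic_acceleration:
  assumes S: "spray A S" and g: "geodesic A S I \<gamma>" and t: "t \<in> I" and c: "c \<in> A" "\<gamma> t \<in> fst c"
  shows "((\<lambda>s. velocity A \<gamma> s c) has_vector_derivative
    - 2 *\<^sub>R spray_coeff A S c (snd c (\<gamma> t)) (velocity A \<gamma> t c)) (at t)"
proof -
  let ?z = "\<lambda>t. (\<gamma> t, velocity A \<gamma> t)"
  have cur: "smooth_curve A I \<gamma>" and nz: "velocity A \<gamma> t \<noteq> 0"
    and zc: "smooth_curve (slit_atlas A) I ?z" and zv: "velocity (slit_atlas A) ?z t = S (?z t)"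
    using g t by (auto simp: geodesic_def integral_curve_def)
  have v: "velocity A \<gamma> t \<in> tangent_space A (\<gamma> t)" by (rule velocity_tangent[OF smooth_atlas_axioms cur t])
  have C: "lift_chart A c \<in> slit_atlas A" "?z t \<in> fst (lift_chart A c)"
    using c v nz by (auto simp: slit_atlas_def lift_chart_mem)
  have "((\<lambda>s. (snd c (\<gamma> s), velocity A \<gamma> s c)) has_vector_derivative
      (velocity A \<gamma> t c, - 2 *\<^sub>R spray_coeff A S c (snd c (\<gamma> t)) (velocity A \<gamma> t c))) (at t)"
    using velocity_chart[OF zc t C] unfolding zv spray_in_lift_chart[OF S c v nz] lift_chart_apply .
  from bounded_linear.has_vector_derivative[OF bounded_linear_snd this]
  show ?thesis by simp
qed

text \<open>Conversely, a solution of the geodesic equation in one chart is a geodesic, since the equality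
of two tangent vectors of the slit bundle can be tested in one chart.\<close>

lemma geodesic_of_chart:
  assumes S: "spray A S" and I: "open I" and c: "c \<in> A"
    and x: "smooth_on I x" "\<And>t. t \<in> I \<Longrightarrow> x t \<in> chart_img c"
    and dx: "\<And>t. t \<in> I \<Longrightarrow> (x has_vector_derivative v t) (at t)"
    and nz: "\<And>t. t \<in> I \<Longrightarrow> v t \<noteq> 0"
    and dv: "\<And>t. t \<in> I \<Longrightarrow> (v has_vector_derivative - 2 *\<^sub>R spray_coeff A S c (x t) (v t)) (at t)"
  shows "geodesic A S I (\<lambda>t. chart_inv c (x t))"
proof -
  interpret slit: smooth_atlas "slit_atlas A" by (rule slit_smooth_atlas)
  let ?\<gamma> = "\<lambda>t. chart_inv c (x t)"
  let ?z = "\<lambda>t. (?\<gamma> t, velocity A ?\<gamma> t)"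
  have cur: "smooth_curve A I ?\<gamma>" by (rule smooth_curve_of_chart[OF smooth_atlas_axioms I c x])
  have vel: "velocity A ?\<gamma> t c = v t" if "t \<in> I" for t
    by (rule velocity_of_chart[OF I that c x(2) dx[OF that]])
  have in_c: "?\<gamma> t \<in> fst c" if "t \<in> I" for t by (rule chart_inv_in[OF x(2)[OF that]])
  have tan: "velocity A ?\<gamma> t \<in> tangent_space A (?\<gamma> t)" if "t \<in> I" for t
    by (rule velocity_tangent[OF smooth_atlas_axioms cur that])
  have nz': "velocity A ?\<gamma> t \<noteq> 0" if "t \<in> I" for t
    using tangent_nonzero[OF tan[OF that] c in_c[OF that]] nz[OF that] vel[OF that] by simp
  have zc: "smooth_curve (slit_atlas A) I ?z" by (rule smooth_velocity_curve[OF cur I nz'])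
  have "velocity (slit_atlas A) ?z t = S (?z t)" if t: "t \<in> I" for t
  proof -
    have C: "lift_chart A c \<in> slit_atlas A" "?z t \<in> fst (lift_chart A c)"
      using c tan[OF t] nz'[OF t] in_c[OF t] by (auto simp: slit_atlas_def lift_chart_mem)
    have "((\<lambda>s. (x s, v s)) has_vector_derivative (v t, - 2 *\<^sub>R spray_coeff A S c (x t) (v t))) (at t)"
      by (rule has_vector_derivative_Pair[OF dx[OF t] dv[OF t]])
    then have "((\<lambda>s. snd (lift_chart A c) (?z s)) has_vector_derivative
        (v t, - 2 *\<^sub>R spray_coeff A S c (x t) (v t))) (at t)"
      by (rule has_vector_derivative_transform_within_open[OF _ I t])
        (simp add: lift_chart_apply vel chart_chart_inv x(2))
    then have "velocity (slit_atlas A) ?z t (lift_chart A c)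
        = (v t, - 2 *\<^sub>R spray_coeff A S c (x t) (v t))"
      by (rule vector_derivative_unique_at[OF velocity_chart[OF zc t C]])
    also have "\<dots> = S (?z t) (lift_chart A c)"
      using spray_in_lift_chart[OF S c in_c[OF t] tan[OF t] nz'[OF t]] vel[OF t] chart_chart_inv[OF x(2)[OF t]]
      by simp
    finally have eq: "velocity (slit_atlas A) ?z t (lift_chart A c) = S (?z t) (lift_chart A c)" .
    show ?thesis
    proof (rule slit.tangent_ext)
      show "velocity (slit_atlas A) ?z t \<in> tangent_space (slit_atlas A) (?z t)"
        using velocity_tangent[OF slit_smooth_atlas zc t] .
      show "S (?z t) \<in> tangent_space (slit_atlas A) (?z t)"
        using S C unfolding spray_def smooth_vector_field_def by blast
    qed (fact C eq)+
  qed
  then show ?thesis using cur zc nz' unfolding geodesic_def integral_curve_def by simp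
qed

end

section \<open>Traces\<close>

text \<open>The trace does not depend on the basis, and it may be computed after transport along a
  linear isomorphism.\<close>

lemma lin_trace_transport:
  fixes P :: "'v::real_vector \<Rightarrow> 'f::euclidean_space" and R :: "'f \<Rightarrow> 'v"
  assumes m: "subspace m" and R: "linear R" and Rm: "\<And>x. R x \<in> m"
    and PR: "\<And>x. P (R x) = x" and RP: "\<And>v. v \<in> m \<Longrightarrow> R (P v) = v"
    and F: "linear F" and f: "\<And>v. v \<in> m \<Longrightarrow> f v = R (F (P v))"
  shows "lin_trace m f = (\<Sum>b\<in>Basis. F b \<bullet> b)"
proof -
  define B where "B = (SOME B. independent B \<and> span B = m)"
  have "\<exists>B. independent B \<and> span B = m"
    using maximal_independent_subset[of m] span_minimal[OF _ m] by (metis order_antisym)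
  from someI_ex[OF this] have B: "independent B" "span B = m" unfolding B_def by blast+
  have Bm: "b \<in> m" if "b \<in> B" for b using B(2) span_base that by blast
  have "m = range R" using Rm RP by (metis image_subset_iff rangeI subsetI subset_antisym)
  also have "\<dots> = span (R ` Basis)" using linear_span_image[OF R, of Basis] by (simp add: span_Basis)
  finally have "B \<subseteq> span (R ` Basis)" using Bm by blast
  then have fin: "finite B" using independent_span_bound[OF _ B(1)] finite_Basis by blast
  let ?rep = "representation B"
  have expand: "v = (\<Sum>b\<in>B. ?rep v b *\<^sub>R b)" if "v \<in> m" for v
    using sum_representation_eq[OF B(1) _ fin, of v] that B(2) by simp
  have rep_sum: "?rep (\<Sum>i\<in>Basis. r i *\<^sub>R R i) b = (\<Sum>i\<in>Basis. r i * ?rep (R i) b)" for r b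
    using representation_sum[OF B(1), of Basis "\<lambda>i. r i *\<^sub>R R i"]
      representation_scale[OF B(1)] Rm B(2) by (simp add: subspace_scale[OF m])
  have "lin_trace m f = (\<Sum>b\<in>B. ?rep (f b) b)"
    unfolding lin_trace_def B_def[symmetric] by (simp add: Let_def)
  also have "\<dots> = (\<Sum>b\<in>B. \<Sum>i\<in>Basis. (F (P b) \<bullet> i) * ?rep (R i) b)"
  proof (rule sum.cong[OF refl])
    fix b assume "b \<in> B"
    then have "f b = R (\<Sum>i\<in>Basis. (F (P b) \<bullet> i) *\<^sub>R i)"
      using f[OF Bm] by (simp add: euclidean_representation)
    also have "\<dots> = (\<Sum>i\<in>Basis. (F (P b) \<bullet> i) *\<^sub>R R i)"
      by (simp add: linear_sum[OF R] linear_scale[OF R])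
    finally show "?rep (f b) b = (\<Sum>i\<in>Basis. (F (P b) \<bullet> i) * ?rep (R i) b)"
      by (simp add: rep_sum)
  qed
  also have "\<dots> = (\<Sum>i\<in>Basis. \<Sum>b\<in>B. (F (P b) \<bullet> i) * ?rep (R i) b)" by (rule sum.swap)
  also have "\<dots> = (\<Sum>i\<in>Basis. F i \<bullet> i)"
  proof (rule sum.cong[OF refl])
    fix i :: 'f
    have "R i = R (\<Sum>b\<in>B. ?rep (R i) b *\<^sub>R P b)"
      using expand[OF Rm[of i]] by (simp add: linear_sum[OF R] linear_scale[OF R] RP Bm)
    then have "i = (\<Sum>b\<in>B. ?rep (R i) b *\<^sub>R P b)" using PR by metis
    then have "F i = (\<Sum>b\<in>B. ?rep (R i) b *\<^sub>R F (P b))"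
      using linear_sum[OF F] linear_scale[OF F] by (metis (no_types, lifting) sum.cong)
    then show "(\<Sum>b\<in>B. (F (P b) \<bullet> i) * ?rep (R i) b) = F i \<bullet> i"
      by (simp add: inner_sum_left mult.commute)
  qed
  finally show ?thesis .
qed


section \<open>Homogeneous spaces in coordinates\<close>

locale homogeneous =
  fixes G :: "('g, 'z) monoid_scheme" and TG :: "'g topology"
    and AG :: "('g, 'e::euclidean_space) chart set" and H :: "'g set"
    and TM :: "'g set topology" and AM :: "('g set, 'f::euclidean_space) chart set"
    and c :: "('g set, 'f) chart"
  assumes homogeneous: "homogeneous_space G TG AG H TM AM"
    and c: "c \<in> AM" "H \<in> fst c"
begin

sublocale group G
  using homogeneous by (simp add: homogeneous_space_def lie_group_def)

lemma subgroup: "subgroup H G"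
  using homogeneous by (simp add: homogeneous_space_def)

sublocale AG: smooth_atlas AG
  using homogeneous smooth_manifold_atlas unfolding homogeneous_space_def lie_group_def by blast

sublocale AM: smooth_atlas AM
  using homogeneous smooth_manifold_atlas unfolding homogeneous_space_def by blast

lemmas atlasG = AG.smooth_atlas_axioms
lemmas atlasM = AM.smooth_atlas_axioms

lemma chartsG: "(\<Union>d\<in>AG. fst d) = carrier G"
  using homogeneous by (simp add: homogeneous_space_def lie_group_def smooth_manifold_def)

lemma chartsM: "(\<Union>d\<in>AM. fst d) = lcosets\<^bsub>G\<^esub> H"
  using homogeneous by (simp add: homogeneous_space_def smooth_manifold_def)

lemma H_point: "H \<in> (\<Union>d\<in>AM. fst d)"
  using c by blast

lemma H_subset: "H \<subseteq> carrier G"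
  using subgroup by (rule subgroup.subset)

lemma point_subset: "P \<in> (\<Union>d\<in>AM. fst d) \<Longrightarrow> P \<subseteq> carrier G"
  unfolding chartsM using lcosets_subset_PowG[OF subgroup] by blast

lemma smooth_proj: "smooth_map AG AM (coset_proj G H)"
  using homogeneous by (simp add: homogeneous_space_def smooth_submersion_def)

lemma smooth_mult: "smooth_map (prod_atlas AG AG) AG (\<lambda>(g, h). g \<otimes>\<^bsub>G\<^esub> h)"
  using homogeneous by (simp add: homogeneous_space_def lie_group_def)

lemma smooth_inv: "smooth_map AG AG (\<lambda>g. inv\<^bsub>G\<^esub> g)"
  using homogeneous by (simp add: homogeneous_space_def lie_group_def)

lemma smooth_action: "smooth_map (prod_atlas AG AM) AM (\<lambda>(g, P). coset_act G g P)"
  using homogeneous by (simp add: homogeneous_space_def)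

lemma smooth_left: "g \<in> carrier G \<Longrightarrow> smooth_map AG AG (left_trans G g)"
  using smooth_map_slice[OF atlasG atlasG atlasG smooth_mult, of g]
  by (simp add: chartsG left_trans_def del: UN_iff)

lemma smooth_act: "g \<in> carrier G \<Longrightarrow> smooth_map AM AM (coset_act G g)"
  using smooth_map_slice[OF atlasG atlasM atlasM smooth_action, of g]
  by (simp add: chartsG del: UN_iff)

lemma proj_one: "coset_proj G H \<one>\<^bsub>G\<^esub> = H"
  using lcos_mult_one[OF H_subset] by (simp add: coset_proj_def)

lemma act_proj:
  "g \<in> carrier G \<Longrightarrow> h \<in> carrier G \<Longrightarrow> coset_act G g (coset_proj G H h) = coset_proj G H (g \<otimes>\<^bsub>G\<^esub> h)"
  using lcos_m_assoc[OF H_subset] by (simp add: coset_proj_def coset_act_def)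

lemma act_H: "coset_act G g H = coset_proj G H g"
  by (simp add: coset_proj_def coset_act_def)

lemma act_inverse:
  assumes "g \<in> carrier G" "P \<in> (\<Union>d\<in>AM. fst d)"
  shows "coset_act G (inv\<^bsub>G\<^esub> g) (coset_act G g P) = P" "coset_act G g (coset_act G (inv\<^bsub>G\<^esub> g) P) = P"
  using assms point_subset[OF assms(2)]
  by (simp_all add: coset_act_def lcos_m_assoc lcos_mult_one l_inv r_inv)

lemma proj_eq_H: "g \<in> carrier G \<Longrightarrow> coset_proj G H g = H \<longleftrightarrow> g \<in> H"
  using lcos_self[OF _ subgroup, of g] coset_join3[OF _ subgroup] by (auto simp: coset_proj_def)

lemma point_act: "g \<in> carrier G \<Longrightarrow> P \<in> (\<Union>d\<in>AM. fst d) \<Longrightarrow> coset_act G g P \<in> (\<Union>d\<in>AM. fst d)"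
  using smooth_map_target[OF smooth_act] by (metis UN_E UN_I)

subsection \<open>The chart of the group at the identity\<close>

text \<open>The very chart that enters the definition of tangent maps at the identity, so that tangent maps
there unfold to derivatives in this chart.\<close>

definition cG :: "('g, 'e) chart" where
  "cG = (SOME d. d \<in> AG \<and> \<one>\<^bsub>G\<^esub> \<in> fst d)"

lemma cG: "cG \<in> AG" "\<one>\<^bsub>G\<^esub> \<in> fst cG"
proof -
  have "\<exists>d. d \<in> AG \<and> \<one>\<^bsub>G\<^esub> \<in> fst d" using chartsG one_closed by blast
  from someI_ex[OF this] show "cG \<in> AG" "\<one>\<^bsub>G\<^esub> \<in> fst cG" unfolding cG_def by blast+
qed

definition z0 :: 'e where "z0 = snd cG \<one>\<^bsub>G\<^esub>"
definition x0 :: 'f where "x0 = snd c H"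
definition el :: "'e \<Rightarrow> 'g" where "el = chart_inv cG"
definition pt :: "'f \<Rightarrow> 'g set" where "pt = chart_inv c"

definition pr :: "'e \<Rightarrow> 'f" where "pr z = snd c (coset_proj G H (el z))"
definition mul :: "'e \<times> 'e \<Rightarrow> 'e" where "mul w = snd cG (el (fst w) \<otimes>\<^bsub>G\<^esub> el (snd w))"
definition act :: "'e \<times> 'f \<Rightarrow> 'f" where "act w = snd c (coset_act G (el (fst w)) (pt (snd w)))"
definition iact :: "'e \<times> 'f \<Rightarrow> 'f" where
  "iact w = snd c (coset_act G (inv\<^bsub>G\<^esub> (el (fst w))) (pt (snd w)))"

lemma el_z0: "el z0 = \<one>\<^bsub>G\<^esub>"
  unfolding el_def z0_def by (rule AG.chart_inv_chart[OF cG])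

lemma pt_x0: "pt x0 = H"
  unfolding pt_def x0_def by (rule AM.chart_inv_chart[OF c])

lemma el_carrier: "z \<in> chart_img cG \<Longrightarrow> el z \<in> carrier G"
  using chart_inv_in[of z cG] cG(1) chartsG unfolding el_def by blast

lemma pr_z0: "pr z0 = x0"
  by (simp add: pr_def el_z0 proj_one x0_def)

end

text \<open>\<open>Z\<close> and \<open>N\<close> are coordinate neighbourhoods of the identity and of the base point on which
  the projection, the action of \<open>g\<close> and of \<open>g\<^sup>-\<^sup>1\<close> and the multiplication
  can all be written in the two charts.\<close>

locale homogeneous_chart = homogeneous G TG AG H TM AM c
  for G :: "('g, 'z) monoid_scheme" and TG :: "'g topology"
    and AG :: "('g, 'e::euclidean_space) chart set" and H :: "'g set"
    and TM :: "'g set topology" and AM :: "('g set, 'f::euclidean_space) chart set"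
    and c :: "('g set, 'f) chart" +
  fixes Z :: "'e::euclidean_space set" and N :: "'f::euclidean_space set"
  assumes Z: "open Z" "z0 \<in> Z" "Z \<subseteq> chart_img cG"
    and N: "open N" "x0 \<in> N" "N \<subseteq> chart_img c"
    and pr: "smooth_on Z pr" "pr ` Z \<subseteq> N" "\<And>z. z \<in> Z \<Longrightarrow> coset_proj G H (el z) \<in> fst c"
    and act: "smooth_on (Z \<times> N) act" "\<And>z x. z \<in> Z \<Longrightarrow> x \<in> N \<Longrightarrow> coset_act G (el z) (pt x) \<in> fst c"
    and iact: "smooth_on (Z \<times> N) iact"
      "\<And>z x. z \<in> Z \<Longrightarrow> x \<in> N \<Longrightarrow> coset_act G (inv\<^bsub>G\<^esub> (el z)) (pt x) \<in> fst c"
    and mul: "smooth_on (Z \<times> Z) mul" "\<And>z w. z \<in> Z \<Longrightarrow> w \<in> Z \<Longrightarrow> el z \<otimes>\<^bsub>G\<^esub> el w \<in> fst cG"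

context homogeneous
begin

text \<open>Continuity: each of the maps is smooth near the identity and the base point.  The action of
inverses is the composition of inversion with the action in coordinates.\<close>

lemma homogeneous_chart_exists:
  "\<exists>Z N. homogeneous_chart G TG AG H TM AM c Z N"
proof -
  obtain Wp where Wp: "open Wp" "z0 \<in> Wp" "Wp \<subseteq> chart_img cG"
    "\<And>z. z \<in> Wp \<Longrightarrow> coset_proj G H (el z) \<in> fst c" "smooth_on Wp pr"
    unfolding z0_def el_def pr_def[abs_def]
    by (rule smooth_mapD[OF smooth_proj cG c(1)]) (use c in \<open>auto simp: proj_one\<close>)
  obtain Wa where Wa: "open Wa" "(z0, x0) \<in> Wa" "Wa \<subseteq> chart_img cG \<times> chart_img c"
    "\<And>z x. (z, x) \<in> Wa \<Longrightarrow> coset_act G (el z) (pt x) \<in> fst c" "smooth_on Wa act"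
    unfolding z0_def x0_def el_def pt_def act_def[abs_def]
    by (rule prod_atlas_chart[OF atlasG atlasM smooth_action cG c c(1)])
      (use c in \<open>auto simp: act_H proj_one\<close>)
  obtain Wm where Wm: "open Wm" "(z0, z0) \<in> Wm" "Wm \<subseteq> chart_img cG \<times> chart_img cG"
    "\<And>z w. (z, w) \<in> Wm \<Longrightarrow> el z \<otimes>\<^bsub>G\<^esub> el w \<in> fst cG" "smooth_on Wm mul"
    unfolding z0_def el_def mul_def[abs_def]
    by (rule prod_atlas_chart[OF atlasG atlasG smooth_mult cG cG cG(1)]) (use cG in auto)
  obtain Wi where Wi: "open Wi" "z0 \<in> Wi" "Wi \<subseteq> chart_img cG"
    "\<And>z. z \<in> Wi \<Longrightarrow> inv\<^bsub>G\<^esub> (el z) \<in> fst cG" "smooth_on Wi (\<lambda>z. snd cG (inv\<^bsub>G\<^esub> (el z)))"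
    unfolding z0_def el_def
    by (rule smooth_mapD[OF smooth_inv cG cG(1)]) (use cG in auto)
  let ?i = "\<lambda>z. snd cG (inv\<^bsub>G\<^esub> (el z))"
  have i0: "?i z0 = z0" by (simp add: el_z0) (simp add: z0_def)
  have el_i: "el (?i z) = inv\<^bsub>G\<^esub> (el z)" if "z \<in> Wi" for z
    using AG.chart_inv_chart[OF cG(1) Wi(4)[OF that]] by (simp add: el_def)
  obtain Za Na where ZNa: "open Za" "open Na" "(z0, x0) \<in> Za \<times> Na" "Za \<times> Na \<subseteq> Wa"
    by (rule open_prod_elim[OF Wa(1,2)])
  obtain Zm Zm' where Zm: "open Zm" "open Zm'" "(z0, z0) \<in> Zm \<times> Zm'" "Zm \<times> Zm' \<subseteq> Wm"
    by (rule open_prod_elim[OF Wm(1,2)])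
  define Zi where "Zi = Wi \<inter> ?i -` Za"
  have oZi: "open Zi"
    unfolding Zi_def by (rule continuous_open_preimage[OF smooth_on_continuous[OF Wi(5)] Wi(1) ZNa(1)])
  define Zp where "Zp = Wp \<inter> pr -` Na"
  have oZp: "open Zp"
    unfolding Zp_def by (rule continuous_open_preimage[OF smooth_on_continuous[OF Wp(5)] Wp(1) ZNa(2)])
  define Z where "Z = Zp \<inter> Za \<inter> Zm \<inter> Zm' \<inter> Zi"
  have oZ: "open Z" unfolding Z_def using oZp oZi ZNa Zm by (intro open_Int)
  have o1: "open (Z \<times> Na)" using oZ ZNa(2) by (rule open_Times)
  have sm: "smooth_on (Z \<times> Na) (\<lambda>w. act (?i (fst w), snd w))"
  proof (rule smooth_on_compose[OF o1 _ Wa(5)])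
    have "smooth_on (Z \<times> Na) (\<lambda>w. ?i (fst w))"
      by (rule smooth_on_compose[OF o1 smooth_on_bounded_linear[OF bounded_linear_fst] Wi(5)])
        (auto simp: Z_def Zi_def)
    then show "smooth_on (Z \<times> Na) (\<lambda>w. (?i (fst w), snd w))"
      by (rule smooth_on_Pair[OF o1 _ smooth_on_bounded_linear[OF bounded_linear_snd]])
    show "(\<lambda>w. (?i (fst w), snd w)) ` (Z \<times> Na) \<subseteq> Wa"
      using ZNa(4) by (auto simp: Z_def Zi_def)
  qed
  have "homogeneous_chart G TG AG H TM AM c Z Na"
  proof (unfold_locales)
    show "open Z" "open Na" by (fact oZ ZNa)+
    show "z0 \<in> Z" using Wp(2) Wi(2) ZNa(3) Zm(3) by (simp add: Z_def Zp_def Zi_def pr_z0 i0)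
    show "x0 \<in> Na" using ZNa(3) by simp
    show "Z \<subseteq> chart_img cG" using Wp(3) by (auto simp: Z_def Zp_def)
    have "(z0, x) \<in> Wa" if "x \<in> Na" for x using ZNa(3,4) that by auto
    then show "Na \<subseteq> chart_img c" using Wa(3) by auto
    show "smooth_on Z pr" by (rule smooth_on_subset[OF Wp(5)]) (auto simp: Z_def Zp_def)
    show "pr ` Z \<subseteq> Na" by (auto simp: Z_def Zp_def)
    show "coset_proj G H (el z) \<in> fst c" if "z \<in> Z" for z
      using Wp(4) that by (simp add: Z_def Zp_def)
    show "smooth_on (Z \<times> Na) act" using ZNa(4) by (intro smooth_on_subset[OF Wa(5)]) (auto simp: Z_def)
    show "coset_act G (el z) (pt x) \<in> fst c" if "z \<in> Z" "x \<in> Na" for z x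
      using Wa(4)[of z x] ZNa(4) that by (auto simp: Z_def)
    show "smooth_on (Z \<times> Na) iact"
      by (rule smooth_on_cong_imp[OF o1 sm]) (auto simp: act_def iact_def Z_def Zi_def el_i)
    show "coset_act G (inv\<^bsub>G\<^esub> (el z)) (pt x) \<in> fst c" if "z \<in> Z" "x \<in> Na" for z x
    proof -
      have "z \<in> Wi" "(?i z, x) \<in> Wa" using ZNa(4) that by (auto simp: Z_def Zi_def)
      then show ?thesis using Wa(4)[of "?i z" x] el_i[of z] by simp
    qed
    show "smooth_on (Z \<times> Z) mul" using Zm(4) by (intro smooth_on_subset[OF Wm(5)]) (auto simp: Z_def)
    show "el z \<otimes>\<^bsub>G\<^esub> el w \<in> fst cG" if "z \<in> Z" "w \<in> Z" for z w
      using Wm(4)[of z w] Zm(4) that by (auto simp: Z_def)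
  qed
  then show ?thesis by blast
qed

end


context homogeneous_chart
begin

lemma open_ZU: "open (Z \<times> UNIV)" using Z by (intro open_Times) auto

lemma snd_el: "z \<in> Z \<Longrightarrow> snd cG (el z) = z"
  unfolding el_def by (rule chart_chart_inv[OF subsetD[OF Z(3)]])

lemma el_in: "z \<in> Z \<Longrightarrow> el z \<in> fst cG"
  unfolding el_def by (rule chart_inv_in[OF subsetD[OF Z(3)]])

lemma el_Z: "z \<in> Z \<Longrightarrow> el z \<in> carrier G"
  by (rule el_carrier[OF subsetD[OF Z(3)]])

lemma el_point: "g \<in> carrier G \<Longrightarrow> g \<in> (\<Union>d\<in>AG. fst d)"
  by (simp only: chartsG)

lemma proj_point: "g \<in> carrier G \<Longrightarrow> coset_proj G H g \<in> (\<Union>d\<in>AM. fst d)"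
  using point_act[OF _ H_point] by (simp only: act_H)

text \<open>In coordinates: \<open>B z\<close> is the differential of the action of \<open>el z\<close> at the base point, \<open>C z\<close> that of the
action of its inverse at the point \<open>pr z\<close>, and \<open>ell z\<close> that of left translation by \<open>el z\<close> at the
identity.  As derivatives of maps on the product they depend smoothly on \<open>z\<close>.\<close>

definition B :: "'e \<Rightarrow> 'f \<Rightarrow> 'f" where "B z v = DD act (z, x0) (0, v)"
definition C :: "'e \<Rightarrow> 'f \<Rightarrow> 'f" where "C z v = DD iact (z, pr z) (0, v)"
definition ell :: "'e \<Rightarrow> 'e \<Rightarrow> 'e" where "ell z y = DD mul (z, z0) (0, y)"

lemma B_slice: "z \<in> Z \<Longrightarrow> DD (\<lambda>x. act (z, x)) x0 = B z"
  using DD_slice_snd[OF smooth_on_differentiable[OF act(1)], of z x0] N by (auto simp: B_def)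

lemma pr_N: "z \<in> Z \<Longrightarrow> pr z \<in> N"
  using pr(2) by blast

lemma C_slice: "z \<in> Z \<Longrightarrow> DD (\<lambda>x. iact (z, x)) (pr z) = C z"
  using DD_slice_snd[OF smooth_on_differentiable[OF iact(1)], of z "pr z"] pr_N by (auto simp: C_def)

lemma ell_slice: "z \<in> Z \<Longrightarrow> DD (\<lambda>w. mul (z, w)) z0 = ell z"
  using DD_slice_snd[OF smooth_on_differentiable[OF mul(1)], of z z0] Z by (auto simp: ell_def)

lemma smooth_B: "smooth_on (Z \<times> UNIV) (\<lambda>w. B (fst w) (snd w))"
  unfolding B_def
proof (rule smooth_on_DD_apply[OF open_ZU _ _ act(1)])
  show "smooth_on (Z \<times> UNIV) (\<lambda>w :: 'e \<times> 'f. (fst w, x0))"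
    by (rule smooth_on_Pair[OF open_ZU smooth_on_bounded_linear[OF bounded_linear_fst] smooth_on_const])
  show "smooth_on (Z \<times> UNIV) (\<lambda>w. (0 :: 'e, snd w :: 'f))"
    by (rule smooth_on_Pair[OF open_ZU smooth_on_const smooth_on_bounded_linear[OF bounded_linear_snd]])
qed (use N in auto)

lemma smooth_C: "smooth_on (Z \<times> UNIV) (\<lambda>w. C (fst w) (snd w))"
  unfolding C_def
proof (rule smooth_on_DD_apply[OF open_ZU _ _ iact(1)])
  note fst = smooth_on_bounded_linear[OF bounded_linear_fst]
  have "smooth_on (Z \<times> UNIV) (\<lambda>w :: 'e \<times> 'f. pr (fst w))"
    by (rule smooth_on_compose[OF open_ZU fst pr(1)]) auto
  then show "smooth_on (Z \<times> UNIV) (\<lambda>w :: 'e \<times> 'f. (fst w, pr (fst w)))"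
    by (rule smooth_on_Pair[OF open_ZU fst])
  show "smooth_on (Z \<times> UNIV) (\<lambda>w. (0 :: 'e, snd w :: 'f))"
    by (rule smooth_on_Pair[OF open_ZU smooth_on_const smooth_on_bounded_linear[OF bounded_linear_snd]])
qed (use pr_N in auto)

lemma smooth_ell: "smooth_on (Z \<times> UNIV) (\<lambda>w. ell (fst w) (snd w))"
  unfolding ell_def
proof (rule smooth_on_DD_apply[OF open_ZU _ _ mul(1)])
  show "smooth_on (Z \<times> UNIV) (\<lambda>w :: 'e \<times> 'e. (fst w, z0))"
    by (rule smooth_on_Pair[OF open_ZU smooth_on_bounded_linear[OF bounded_linear_fst] smooth_on_const])
  show "smooth_on (Z \<times> UNIV) (\<lambda>w. (0 :: 'e, snd w :: 'e))"
    by (rule smooth_on_Pair[OF open_ZU smooth_on_const smooth_on_bounded_linear[OF bounded_linear_snd]])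
qed (use Z in auto)

lemma smooth_B_at: "smooth_on Z (\<lambda>z. B z v)"
proof -
  have "smooth_on Z (\<lambda>z. (z, v))"
    by (rule smooth_on_Pair[OF Z(1) smooth_on_bounded_linear[OF bounded_linear_ident] smooth_on_const])
  from smooth_on_compose[OF Z(1) this smooth_B] show ?thesis by auto
qed

lemma smooth_ell_at: "smooth_on Z (\<lambda>z. ell z y)"
proof -
  have "smooth_on Z (\<lambda>z. (z, y))"
    by (rule smooth_on_Pair[OF Z(1) smooth_on_bounded_linear[OF bounded_linear_ident] smooth_on_const])
  from smooth_on_compose[OF Z(1) this smooth_ell] show ?thesis by auto
qed

lemma linear_B: "z \<in> Z \<Longrightarrow> linear (B z)"
  unfolding B_slice[symmetric]
  by (intro linear_frechet_derivative)
    (use smooth_on_differentiable[OF act(1), of "(z, x0)"] N(2) in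
      \<open>auto intro!: differentiable_chain_at[of "\<lambda>x. (z, x)" x0 act, unfolded comp_def]
        differentiable_Pair\<close>)

subsection \<open>Coordinate expressions of tangent maps\<close>

lemma tangent_act:
  assumes z: "z \<in> Z" and w: "w \<in> tangent_space AM H"
  shows "tangent_map AM AM (coset_act G (el z)) H w c = B z (w c)"
  using tangent_map_chart[OF atlasM smooth_act[OF el_Z[OF z]] w c c(1)] pr(3)[OF z]
    B_slice[OF z] by (simp add: act_def pt_def act_H x0_def)

lemma tangent_iact:
  assumes z: "z \<in> Z" and w: "w \<in> tangent_space AM (coset_proj G H (el z))"
  shows "tangent_map AM AM (coset_act G (inv\<^bsub>G\<^esub> (el z))) (coset_proj G H (el z)) w c = C z (w c)"
proof -
  have "coset_act G (inv\<^bsub>G\<^esub> (el z)) (coset_proj G H (el z)) = H"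
    using act_inverse(1)[OF el_Z[OF z] H_point] by (simp add: act_H)
  then show ?thesis
    using tangent_map_chart[OF atlasM smooth_act[OF inv_closed[OF el_Z[OF z]]] w c(1) pr(3)[OF z] c(1)]
      C_slice[OF z] c by (simp add: iact_def pt_def pr_def)
qed

lemma B_C: 
  assumes z: "z \<in> Z"
  shows "B z (C z v) = v"
proof -
  let ?q = "coset_proj G H (el z)"
  let ?w = "AM.chart_vector c ?q v" and ?a = "coset_act G (el z)" and ?b = "coset_act G (inv\<^bsub>G\<^esub> (el z))"
  have w: "?w \<in> tangent_space AM ?q" "?w c = v"
    using AM.chart_vector_tangent[OF c(1) pr(3)[OF z]] AM.chart_vector_comp[OF c(1) pr(3)[OF z]] by auto
  note g = el_Z[OF z] inv_closed[OF el_Z[OF z]]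
  note q = proj_point[OF g(1)]
  have bq: "?b ?q = H" using act_inverse(1)[OF g(1) H_point] by (simp add: act_H)
  have t: "tangent_map AM AM ?b ?q ?w \<in> tangent_space AM H"
    using tangent_map_tangent[OF atlasM atlasM smooth_act[OF g(2)] w(1) q] by (simp add: bq)
  have "v = tangent_map AM AM (\<lambda>P. ?a (?b P)) ?q ?w c"
    using tangent_map_ident[OF atlasM q w(1) act_inverse(2)[OF g(1)]] w(2) by simp
  also have "\<dots> = tangent_map AM AM ?a H (tangent_map AM AM ?b ?q ?w) c"
    using tangent_map_compose[OF atlasM atlasM smooth_act[OF g(2)] smooth_act[OF g(1)] w(1) q]
    by (simp add: bq)
  also have "\<dots> = B z (C z v)"
    unfolding tangent_act[OF z t] tangent_iact[OF z w(1)] w(2) ..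
  finally show ?thesis by simp
qed

lemma B_z0: "B z0 v = v"
proof -
  have "DD (\<lambda>x. act (z0, x)) x0 = DD (\<lambda>x. x) x0"
  proof (rule DD_cong_open[OF N(1,2)])
    fix x assume "x \<in> N"
    then have x: "x \<in> chart_img c" using N(3) by blast
    then have "pt x \<subseteq> carrier G"
      using chart_inv_in[OF x] c(1) point_subset unfolding pt_def by blast
    then show "act (z0, x) = x"
      using chart_chart_inv[OF x] by (simp add: act_def el_z0 coset_act_def lcos_mult_one) (simp add: pt_def)
  qed
  then show ?thesis using B_slice[OF Z(2)] by simp
qed

lemma left_invariant_tangent:
  assumes "u \<in> lie_algebra G AG" "g \<in> carrier G"
  shows "left_invariant_vf G AG u g \<in> tangent_space AG g"
  using tangent_map_tangent[OF atlasG atlasG smooth_left[OF assms(2)] assms(1) el_point[OF one_closed]] assms(2)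
  by (simp add: left_invariant_vf_def left_trans_def)

lemma left_invariant_chart:
  assumes u: "u \<in> lie_algebra G AG" and z: "z \<in> Z"
  shows "left_invariant_vf G AG u (el z) cG = ell z (u cG)"
  using tangent_map_chart[OF atlasG smooth_left[OF el_Z[OF z]] u cG cG(1)] el_Z[OF z] el_in[OF z]
    ell_slice[OF z] by (simp add: left_invariant_vf_def left_trans_def mul_def el_def z0_def)

lemma left_invariant_one: "u \<in> lie_algebra G AG \<Longrightarrow> left_invariant_vf G AG u \<one>\<^bsub>G\<^esub> = u"
  unfolding left_invariant_vf_def
  by (rule tangent_map_ident[OF atlasG el_point[OF one_closed]]) (simp_all add: left_trans_def chartsG)

lemma ell_z0: "ell z0 y = y"
proof -
  have "AG.chart_vector cG \<one>\<^bsub>G\<^esub> y \<in> lie_algebra G AG" by (rule AG.chart_vector_tangent[OF cG])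
  from left_invariant_chart[OF this Z(2)] left_invariant_one[OF this]
  show ?thesis by (simp add: el_z0 AG.chart_vector_comp[OF cG])
qed

text \<open>The projection intertwines left translation on the group with the action on the homogeneous
space, \<open>pr (mul (z, w)) = act (z, pr w)\<close>; the claim is the differential of this in \<open>w\<close> at the identity.\<close>

lemma pr_ell:
  assumes z: "z \<in> Z"
  shows "DD pr z (ell z y) = B z (DD pr z0 y)"
proof -
  let ?u = "AG.chart_vector cG \<one>\<^bsub>G\<^esub> y" and ?L = "left_trans G (el z)" and ?a = "coset_act G (el z)"
  have u: "?u \<in> lie_algebra G AG" "?u cG = y"
    using AG.chart_vector_tangent[OF cG] AG.chart_vector_comp[OF cG] by auto
  note g = el_Z[OF z] and one = el_point[OF one_closed]
  have Xz: "left_invariant_vf G AG ?u (el z) \<in> tangent_space AG (el z)"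
    by (rule left_invariant_tangent[OF u(1) g])
  have "DD pr z (ell z y) = tangent_map AG AM (coset_proj G H) (el z) (left_invariant_vf G AG ?u (el z)) c"
    using tangent_map_chart[OF atlasG smooth_proj Xz cG(1) el_in[OF z] c(1) pr(3)[OF z]]
      left_invariant_chart[OF u(1) z] u(2) snd_el[OF z] by (simp add: pr_def[abs_def] el_def)
  also have "\<dots> = tangent_map AG AM (\<lambda>h. coset_proj G H (?L h)) \<one>\<^bsub>G\<^esub> ?u c"
    using tangent_map_compose[OF atlasG atlasG smooth_left[OF g] smooth_proj u(1) one] g
    by (simp add: left_invariant_vf_def) (simp add: left_trans_def)
  also have "\<dots> = tangent_map AG AM (\<lambda>h. ?a (coset_proj G H h)) \<one>\<^bsub>G\<^esub> ?u c"
    by (subst tangent_map_cong[OF atlasG one, of "\<lambda>h. coset_proj G H (?L h)" "\<lambda>h. ?a (coset_proj G H h)"])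
      (simp_all add: chartsG act_proj g left_trans_def)
  also have "\<dots> = tangent_map AM AM ?a H (tangent_map AG AM (coset_proj G H) \<one>\<^bsub>G\<^esub> ?u) c"
    using tangent_map_compose[OF atlasG atlasM smooth_proj smooth_act[OF g] u(1) one] by (simp add: proj_one)
  also have "\<dots> = B z (tangent_map AG AM (coset_proj G H) \<one>\<^bsub>G\<^esub> ?u c)"
    using tangent_map_tangent[OF atlasG atlasM smooth_proj u(1) one] by (intro tangent_act[OF z]) (simp add: proj_one)
  also have "tangent_map AG AM (coset_proj G H) \<one>\<^bsub>G\<^esub> ?u c = DD pr z0 y"
    using tangent_map_chart[OF atlasG smooth_proj u(1) cG c(1)] c u(2)
    by (simp add: proj_one pr_def[abs_def] el_def z0_def)
  finally show ?thesis .
qed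

subsection \<open>The identification of the complement with the tangent space\<close>

text \<open>The differential of the projection at the identity, with values in the chart at the base point.\<close>

definition P :: "('g, 'e) tvec \<Rightarrow> 'f" where "P u = base_tangent G AG H AM u c"

lemma P_eq: "P u = DD pr z0 (u cG)"
  unfolding P_def base_tangent_def tangent_map_def cG_def[symmetric]
  using c by (simp add: proj_one Let_def comp_def pr_def[abs_def] el_def z0_def)

lemma pr_differentiable: "z \<in> Z \<Longrightarrow> pr differentiable (at z)"
  using smooth_on_differentiable[OF pr(1)] .

lemma P_linear: "P (u + v) = P u + P v" "P (r *\<^sub>R u) = r *\<^sub>R P u" "P (u - v) = P u - P v" "P 0 = 0"
  using linear_frechet_derivative[OF pr_differentiable[OF Z(2)]]
  by (simp_all add: P_eq scaleR_fun_def linear_add linear_scale linear_diff linear_0)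

lemma base_tangent_tangent:
  "u \<in> lie_algebra G AG \<Longrightarrow> base_tangent G AG H AM u \<in> tangent_space AM H"
  using tangent_map_tangent[OF atlasG atlasM smooth_proj _ el_point[OF one_closed]]
  by (simp add: base_tangent_def proj_one)

lemma subgroup_lie_algebra_tangent:
  assumes "u \<in> subgroup_lie_algebra G AG H"
  shows "u \<in> lie_algebra G AG" "P u = 0"
proof -
  obtain \<gamma> \<epsilon> where g: "u = velocity AG \<gamma> 0" "\<epsilon> > 0" "smooth_curve AG {-\<epsilon><..<\<epsilon>} \<gamma>" "\<gamma> 0 = \<one>\<^bsub>G\<^esub>"
      "\<And>t. t \<in> {-\<epsilon><..<\<epsilon>} \<Longrightarrow> \<gamma> t \<in> H"
    using assms unfolding subgroup_lie_algebra_def by blast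
  have t: "0 \<in> {-\<epsilon><..<\<epsilon>}" using g(2) by simp
  have u: "velocity AG \<gamma> 0 \<in> tangent_space AG (\<gamma> 0)" by (rule velocity_tangent[OF atlasG g(3) t])
  then show "u \<in> lie_algebra G AG" using g by simp
  have "P u = velocity AM (\<lambda>s. coset_proj G H (\<gamma> s)) 0 c"
    unfolding P_def base_tangent_def velocity_compose[OF atlasG atlasM g(3) t smooth_proj u] g(1,4) ..
  also have "\<dots> = 0"
  proof -
    have eq: "coset_proj G H (\<gamma> s) = H" if "s \<in> {-\<epsilon><..<\<epsilon>}" for s
      using g(5)[OF that] proj_eq_H H_subset by blast
    have "((\<lambda>s. snd c (coset_proj G H (\<gamma> s))) has_vector_derivative 0) (at 0)"
      by (rule has_vector_derivative_transform_within_open[OF has_vector_derivative_const _ t]) (simp_all add: eq)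
    then show ?thesis by (simp add: velocity_def comp_def vector_derivative_at)
  qed
  finally show "P u = 0" .
qed

text \<open>Conversely, the integral curve through the identity of the left-invariant field of a vector
  in the kernel of the projection stays in \<open>H\<close>, because the field is everywhere vertical.\<close>

lemma kernel_subgroup_lie_algebra:
  assumes u: "u \<in> lie_algebra G AG" and Pu: "P u = 0"
  shows "u \<in> subgroup_lie_algebra G AG H"
proof -
  obtain e x where e: "e > 0" and x: "x 0 = z0" "\<And>t. t \<in> {-e<..<e} \<Longrightarrow> x t \<in> Z"
    "\<And>t. t \<in> {-e<..<e} \<Longrightarrow> (x has_vector_derivative ell (x t) (u cG)) (at t)"
    "smooth_on {-e<..<e} x"
    by (rule ode_local_existence[OF Z(1,2) smooth_ell_at[of "u cG"]]) blast
  let ?I = "{-e<..<e}"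
  define \<gamma> where "\<gamma> t = el (x t)" for t
  have img: "x t \<in> chart_img cG" if "t \<in> ?I" for t using x(2)[OF that] Z(3) by blast
  have cur: "smooth_curve AG ?I \<gamma>"
    unfolding \<gamma>_def el_def by (rule smooth_curve_of_chart[OF atlasG open_greaterThanLessThan cG(1) x(4) img])
  have t0: "0 \<in> ?I" using e by simp
  have g0: "\<gamma> 0 = \<one>\<^bsub>G\<^esub>" by (simp add: \<gamma>_def x el_z0)
  have "velocity AG \<gamma> 0 cG = u cG"
    using velocity_of_chart[OF open_greaterThanLessThan t0 cG(1) img x(3)[OF t0]]
    by (simp add: \<gamma>_def[abs_def] el_def x(1) ell_z0)
  then have "velocity AG \<gamma> 0 = u"
    using AG.tangent_ext[OF _ u cG] velocity_tangent[OF atlasG cur t0] g0 by simp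
  moreover have "\<gamma> t \<in> H" if t: "t \<in> ?I" for t
  proof -
    have "((\<lambda>s. pr (x s)) has_vector_derivative 0) (at s)" if s: "s \<in> ?I" for s
    proof -
      from has_derivative_compose[OF x(3)[OF s, unfolded has_vector_derivative_def]
          DD_works[OF pr_differentiable[OF x(2)[OF s]]]]
      have "((\<lambda>s. pr (x s)) has_derivative (\<lambda>r. r *\<^sub>R DD pr (x s) (ell (x s) (u cG)))) (at s)"
        by (simp add: linear_scale[OF linear_frechet_derivative[OF pr_differentiable[OF x(2)[OF s]]]])
      then show ?thesis
        using Pu by (simp add: has_vector_derivative_def pr_ell[OF x(2)[OF s]] P_eq[symmetric]
            linear_0[OF linear_B[OF x(2)[OF s]]])
    qed
    then obtain k where "\<And>s. s \<in> ?I \<Longrightarrow> pr (x s) = k"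
      using has_vector_derivative_zero_constant[of ?I "\<lambda>s. pr (x s)"]
      by (metis convex_real_interval(8) has_vector_derivative_at_within)
    then have "pr (x t) = x0" using t t0 x(1) pr_z0 by metis
    then have "snd c (coset_proj G H (\<gamma> t)) = snd c H" by (simp add: pr_def \<gamma>_def x0_def)
    then have "coset_proj G H (\<gamma> t) = H"
      using inj_onD[OF AM.inj[OF c(1)] _ pr(3)[OF x(2)[OF t]] c(2)] by (simp add: \<gamma>_def)
    then show ?thesis using proj_eq_H[OF el_Z[OF x(2)[OF t]]] by (simp add: \<gamma>_def)
  qed
  ultimately show ?thesis
    unfolding subgroup_lie_algebra_def using e cur g0 by blast
qed

end

locale decomposed_chart = homogeneous_chart G TG AG H TM AM c Z N
  for G :: "('g, 'z) monoid_scheme" and TG :: "'g topology"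
    and AG :: "('g, 'e::euclidean_space) chart set" and H :: "'g set"
    and TM :: "'g set topology" and AM :: "('g set, 'f::euclidean_space) chart set"
    and c :: "('g set, 'f) chart" and Z N +
  fixes m :: "('g, 'e) tvec set"
  assumes decomposition: "direct_sum_of (lie_algebra G AG) (subgroup_lie_algebra G AG H) m"
begin

lemma m_subspace: "subspace m"
  using decomposition by (simp add: direct_sum_of_def)

lemma h_subspace: "subspace (subgroup_lie_algebra G AG H)"
  using decomposition by (simp add: direct_sum_of_def)

lemma m_tangent: "u \<in> m \<Longrightarrow> u \<in> lie_algebra G AG"
proof -
  assume u: "u \<in> m"
  have "u = 0 + u" "0 \<in> subgroup_lie_algebra G AG H" using subspace_0[OF h_subspace] by auto
  then show ?thesis using decomposition u unfolding direct_sum_of_def by blast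
qed

lemma P_inj: "u \<in> m \<Longrightarrow> v \<in> m \<Longrightarrow> P u = P v \<Longrightarrow> u = v"
proof -
  assume u: "u \<in> m" and v: "v \<in> m" and eq: "P u = P v"
  have d: "u - v \<in> m" using u v by (rule subspace_diff[OF m_subspace])
  then have "u - v \<in> subgroup_lie_algebra G AG H"
    using eq by (intro kernel_subgroup_lie_algebra m_tangent) (simp_all add: P_linear)
  then have "u - v = 0" using d decomposition unfolding direct_sum_of_def by blast
  then show ?thesis by simp
qed

text \<open>The projection is a submersion, and \<open>P\<close> kills the component in \<open>h\<close>.\<close>

lemma P_surj: "\<exists>u\<in>m. P u = x"
proof -
  have "\<one>\<^bsub>G\<^esub> \<in> (\<Union>d\<in>AG. fst d)" by (rule el_point[OF one_closed])
  then have "tangent_map AG AM (coset_proj G H) \<one>\<^bsub>G\<^esub> ` lie_algebra G AG = tangent_space AM H"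
    using homogeneous proj_one unfolding homogeneous_space_def smooth_submersion_def by metis
  moreover have "AM.chart_vector c H x \<in> tangent_space AM H" by (rule AM.chart_vector_tangent[OF c])
  ultimately obtain u where u: "u \<in> lie_algebra G AG" "P u = x"
    using AM.chart_vector_comp[OF c, of x] unfolding P_def base_tangent_def by (metis imageE)
  then obtain a b where ab: "u = a + b" "a \<in> subgroup_lie_algebra G AG H" "b \<in> m"
    using decomposition unfolding direct_sum_of_def by blast
  then have "P b = x" using u subgroup_lie_algebra_tangent(2)[OF ab(2)] by (simp add: P_linear)
  then show ?thesis using ab by blast
qed

definition R :: "'f \<Rightarrow> ('g, 'e) tvec" where "R x = (THE u. u \<in> m \<and> P u = x)"

lemma R: "R x \<in> m" "P (R x) = x"
proof -
  have "\<exists>!u. u \<in> m \<and> P u = x" using P_surj P_inj by metis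
  from theI'[OF this] show "R x \<in> m" "P (R x) = x" unfolding R_def by auto
qed

lemma R_P: "u \<in> m \<Longrightarrow> R (P u) = u"
  using R P_inj by blast

lemma linear_R: "linear R"
proof (rule linearI)
  fix x y r
  show "R (x + y) = R x + R y"
    by (rule P_inj) (simp_all add: R P_linear subspace_add[OF m_subspace])
  show "R (r *\<^sub>R x) = r *\<^sub>R R x"
    by (rule P_inj) (simp_all add: R P_linear subspace_scale[OF m_subspace])
qed

lemma proj_along_eq:
  assumes "w \<in> lie_algebra G AG"
  shows "proj_along (subgroup_lie_algebra G AG H) m w = R (P w)"
  unfolding proj_along_def
proof (rule the_equality)
  have "w - R (P w) \<in> subgroup_lie_algebra G AG H"
    using AG.tangent_subspace m_tangent[OF R(1)] assms
    by (intro kernel_subgroup_lie_algebra) (auto simp: P_linear R intro: subspace_diff)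
  then show "R (P w) \<in> m \<and> w - R (P w) \<in> subgroup_lie_algebra G AG H" using R by blast
  fix v assume v: "v \<in> m \<and> w - v \<in> subgroup_lie_algebra G AG H"
  then have "P (w - v) = 0" using subgroup_lie_algebra_tangent(2) by blast
  then have "P v = P w" by (simp add: P_linear)
  then show "v = R (P w)" using R_P v by metis
qed

lemma bounded_linear_R: "bounded_linear (\<lambda>x. R x d)"
  by (rule linear_conv_bounded_linear[THEN iffD1], rule linearI)
    (simp_all add: linear_add[OF linear_R] linear_scale[OF linear_R] scaleR_fun_def)

text \<open>Derivatives of curves in \<open>m\<close> can be computed in the model space: in every chart, \<open>R\<close> followed by
taking the component is a linear map between finite-dimensional spaces.\<close>

lemma tvec_deriv_R:
  assumes "open I" "t \<in> I" "\<And>s. s \<in> I \<Longrightarrow> w s = R (h s)" "(h has_vector_derivative h') (at t)"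
  shows "tvec_deriv w t = R h'"
proof
  fix d
  have "((\<lambda>s. R (h s) d) has_vector_derivative R h' d) (at t)"
    by (rule bounded_linear.has_vector_derivative[OF bounded_linear_R assms(4)])
  then have "((\<lambda>s. w s d) has_vector_derivative R h' d) (at t)"
    by (rule has_vector_derivative_transform_within_open[OF _ assms(1,2)]) (simp add: assms(3))
  then show "tvec_deriv w t d = R h' d" by (simp add: tvec_deriv_def vector_derivative_at)
qed

end


section \<open>Sprays on homogeneous spaces\<close>

locale homogeneous_spray_chart = decomposed_chart G TG AG H TM AM c Z N m
  for G :: "('g, 'z) monoid_scheme" and TG :: "'g topology"
    and AG :: "('g, 'e::euclidean_space) chart set" and H :: "'g set"
    and TM :: "'g set topology" and AM :: "('g set, 'f::euclidean_space) chart set"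
    and c :: "('g set, 'f) chart" and Z N and m :: "('g, 'e) tvec set" +
  fixes S :: "('g set, 'f) slit_vf"
  assumes spray: "spray AM S"
begin

text \<open>The derivative of the differential of the action in the group variable.\<close>

definition a :: "('g, 'e) tvec \<Rightarrow> 'f \<Rightarrow> 'f" where "a y v = DD (\<lambda>z. B z v) z0 (y cG)"

definition Gs :: "'f \<Rightarrow> 'f \<Rightarrow> 'f" where "Gs = spray_coeff AM S c"

lemma B_at_differentiable: "z \<in> Z \<Longrightarrow> (\<lambda>z. B z v) differentiable (at z)"
  using smooth_on_differentiable[OF smooth_B_at] .

lemma a_left: "a (y + u) v = a y v + a u v" "a (r *\<^sub>R y) v = r *\<^sub>R a y v"
  using linear_frechet_derivative[OF B_at_differentiable[OF Z(2)]]
  by (simp_all add: a_def scaleR_fun_def linear_add linear_scale)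

lemma a_right: "a y (v + w) = a y v + a y w" "a y (r *\<^sub>R v) = r *\<^sub>R a y v"
proof -
  note d = B_at_differentiable[OF Z(2)]
  have "DD (\<lambda>z. B z (v + w)) z0 = DD (\<lambda>z. B z v + B z w) z0"
    by (rule DD_cong_open[OF Z(1,2)]) (simp add: linear_add[OF linear_B])
  also have "\<dots> = (\<lambda>h. DD (\<lambda>z. B z v) z0 h + DD (\<lambda>z. B z w) z0 h)"
    by (intro DD_eq has_derivative_add DD_works d)
  finally show "a y (v + w) = a y v + a y w" by (simp add: a_def)
  have "DD (\<lambda>z. B z (r *\<^sub>R v)) z0 = DD (\<lambda>z. r *\<^sub>R B z v) z0"
    by (rule DD_cong_open[OF Z(1,2)]) (simp add: linear_scale[OF linear_B])
  also have "\<dots> = (\<lambda>h. r *\<^sub>R DD (\<lambda>z. B z v) z0 h)"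
    by (intro DD_eq has_derivative_scaleR_right DD_works d)
  finally show "a y (r *\<^sub>R v) = r *\<^sub>R a y v" by (simp add: a_def)
qed

lemma linear_a: "linear (a y)"
  by (rule linearI) (simp_all add: a_right)

subsection \<open>Lifts of geodesics\<close>

lemma P_nonzero: "y \<in> m - {0} \<Longrightarrow> P y \<noteq> 0"
  using R_P[of y] linear_0[OF linear_R] by auto

text \<open>Left translation by \<open>\<gamma>(t)\<close> and by its inverse cancel.\<close>

lemma left_velocity_translate:
  assumes u: "u \<in> lie_algebra G AG" and g: "\<gamma> t \<in> carrier G"
    and v: "velocity AG \<gamma> t = left_invariant_vf G AG u (\<gamma> t)"
  shows "left_velocity G AG \<gamma> t = u"
proof -
  have "left_velocity G AG \<gamma> t
      = tangent_map AG AG (\<lambda>h. left_trans G (inv\<^bsub>G\<^esub> (\<gamma> t)) (left_trans G (\<gamma> t) h)) \<one>\<^bsub>G\<^esub> u"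
    using tangent_map_compose[OF atlasG atlasG smooth_left[OF g] smooth_left[OF inv_closed[OF g]] u el_point[OF one_closed]] g
    unfolding left_velocity_def v left_invariant_vf_def by (simp add: left_trans_def)
  also have "\<dots> = u"
    by (rule tangent_map_ident[OF atlasG el_point[OF one_closed] u])
      (simp add: chartsG left_trans_def g m_assoc[symmetric] l_inv del: UN_iff)
  finally show ?thesis .
qed

text \<open>The geodesic equation for \<open>(x, v)\<close> and the equation of the lift \<open>z\<close> are solved as one
  system.  The projection of \<open>z\<close> has velocity \<open>B(z) C(z) v = v\<close>, like \<open>x\<close>, so \<open>z\<close> lies over
  \<open>x\<close> although the equation of \<open>z\<close> does not refer to \<open>x\<close>.\<close>

lemma geodesic_lift_exists:
  assumes y: "y \<in> m - {0}"
  shows "\<exists>\<gamma>. \<exists>\<epsilon>>0. \<exists>k. geodesic AM S {-\<epsilon><..<\<epsilon>} k \<and> k 0 = H \<and>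
    velocity AM k 0 = base_tangent G AG H AM y \<and> is_lift G AG H m {-\<epsilon><..<\<epsilon>} k \<gamma>"
proof -
  define U :: "('f \<times> 'f \<times> 'e) set" where "U = N \<times> (- {0}) \<times> Z"
  have oU: "open U" unfolding U_def using N Z by (intro open_Times) auto
  define F where "F w = (fst (snd w), - 2 *\<^sub>R Gs (fst w) (fst (snd w)),
    ell (snd (snd w)) (R (C (snd (snd w)) (fst (snd w))) cG))" for w
  have l1: "smooth_on U fst" by (rule smooth_on_bounded_linear[OF bounded_linear_fst])
  have l2: "smooth_on U (\<lambda>w. fst (snd w))"
    by (rule smooth_on_bounded_linear[OF bounded_linear_compose[OF bounded_linear_fst bounded_linear_snd]])
  have l3: "smooth_on U (\<lambda>w. snd (snd w))"
    by (rule smooth_on_bounded_linear[OF bounded_linear_compose[OF bounded_linear_snd bounded_linear_snd]])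
  have "smooth_on U (\<lambda>w. Gs (fst (fst w, fst (snd w))) (snd (fst w, fst (snd w))))"
    unfolding Gs_def
    by (rule smooth_on_compose[OF oU smooth_on_Pair[OF oU l1 l2] AM.smooth_spray_coeff[OF spray c(1)]])
      (use N(3) in \<open>auto simp: U_def\<close>)
  then have s2: "smooth_on U (\<lambda>w. - 2 *\<^sub>R Gs (fst w) (fst (snd w)))"
    unfolding fst_conv snd_conv by (rule smooth_on_linear_compose[OF oU _ bounded_linear_scaleR_right])
  have "smooth_on U (\<lambda>w. C (fst (snd (snd w), fst (snd w))) (snd (snd (snd w), fst (snd w))))"
    by (rule smooth_on_compose[OF oU smooth_on_Pair[OF oU l3 l2] smooth_C]) (auto simp: U_def)
  then have "smooth_on U (\<lambda>w. R (C (snd (snd w)) (fst (snd w))) cG)"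
    unfolding fst_conv snd_conv by (rule smooth_on_linear_compose[OF oU _ bounded_linear_R])
  then have "smooth_on U (\<lambda>w. (snd (snd w), R (C (snd (snd w)) (fst (snd w))) cG))"
    by (rule smooth_on_Pair[OF oU l3])
  moreover have "(\<lambda>w. (snd (snd w), R (C (snd (snd w)) (fst (snd w))) cG)) ` U \<subseteq> Z \<times> UNIV"
    by (auto simp: U_def)
  ultimately have s3: "smooth_on U (\<lambda>w. ell (snd (snd w)) (R (C (snd (snd w)) (fst (snd w))) cG))"
    using smooth_on_compose[OF oU _ smooth_ell] by fastforce
  have sF: "smooth_on U F"
    unfolding F_def by (rule smooth_on_Pair[OF oU l2 smooth_on_Pair[OF oU s2 s3]])
  have "(x0, P y, z0) \<in> U" using N(2) Z(2) P_nonzero[OF y] by (simp add: U_def)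
  then obtain e w where e: "e > 0" and w: "w 0 = (x0, P y, z0)" "\<And>t. t \<in> {-e<..<e} \<Longrightarrow> w t \<in> U"
    "\<And>t. t \<in> {-e<..<e} \<Longrightarrow> (w has_vector_derivative F (w t)) (at t)" "smooth_on {-e<..<e} w"
    by (rule ode_local_existence[OF oU _ sF]) blast
  let ?I = "{-e<..<e}"
  define x v z where "x t = fst (w t)" and "v t = fst (snd (w t))" and "z t = snd (snd (w t))" for t
  have init: "x 0 = x0" "v 0 = P y" "z 0 = z0" by (simp_all add: x_def v_def z_def w(1))
  have mem: "x t \<in> N" "v t \<noteq> 0" "z t \<in> Z" if "t \<in> ?I" for t
    using w(2)[OF that] by (auto simp: U_def x_def v_def z_def)
  define u where "u t = R (C (z t) (v t))" for t
  have der: "(x has_vector_derivative v t) (at t)"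
      "(v has_vector_derivative - 2 *\<^sub>R Gs (x t) (v t)) (at t)"
      "(z has_vector_derivative ell (z t) (u t cG)) (at t)" if t: "t \<in> ?I" for t
  proof -
    note 1 = w(3)[OF t] and 2 = bounded_linear.has_vector_derivative[OF bounded_linear_snd w(3)[OF t]]
    show "(x has_vector_derivative v t) (at t)"
      using bounded_linear.has_vector_derivative[OF bounded_linear_fst 1]
      by (simp add: x_def[abs_def] v_def F_def)
    show "(v has_vector_derivative - 2 *\<^sub>R Gs (x t) (v t)) (at t)"
      using bounded_linear.has_vector_derivative[OF bounded_linear_fst 2]
      by (simp add: x_def v_def[abs_def] F_def)
    show "(z has_vector_derivative ell (z t) (u t cG)) (at t)"
      using bounded_linear.has_vector_derivative[OF bounded_linear_snd 2]
      by (simp add: z_def[abs_def] v_def F_def u_def)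
  qed
  have smx: "smooth_on ?I x"
    unfolding x_def by (rule smooth_on_linear_compose[OF open_greaterThanLessThan w(4) bounded_linear_fst])
  have smz: "smooth_on ?I z"
    unfolding z_def
    by (rule smooth_on_linear_compose[OF open_greaterThanLessThan w(4)
          bounded_linear_compose[OF bounded_linear_snd bounded_linear_snd]])
  have imgx: "x t \<in> chart_img c" if "t \<in> ?I" for t using mem(1)[OF that] N(3) by blast
  have imgz: "z t \<in> chart_img cG" if "t \<in> ?I" for t using mem(3)[OF that] Z(3) by blast
  define k where "k t = pt (x t)" for t
  define \<gamma> where "\<gamma> t = el (z t)" for t
  have t0: "0 \<in> ?I" using e by simp
  have geo: "geodesic AM S ?I k"
    unfolding k_def pt_def
    by (rule AM.geodesic_of_chart[OF spray open_greaterThanLessThan c(1) smx imgx der(1) mem(2)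
          der(2)[unfolded Gs_def]])
  have k0: "k 0 = H" by (simp add: k_def init pt_x0)
  have "velocity AM k 0 c = P y"
    using velocity_of_chart[OF open_greaterThanLessThan t0 c(1) imgx der(1)[OF t0]]
    by (simp add: k_def[abs_def] pt_def init)
  moreover have "velocity AM k 0 \<in> tangent_space AM H"
    using velocity_tangent[OF atlasM, of ?I k 0] geo t0 k0 by (simp add: geodesic_def)
  ultimately have vel: "velocity AM k 0 = base_tangent G AG H AM y"
    using AM.tangent_ext[OF _ base_tangent_tangent[OF m_tangent] c] y by (simp add: P_def)
  have cur: "smooth_curve AG ?I \<gamma>"
    unfolding \<gamma>_def el_def by (rule smooth_curve_of_chart[OF atlasG open_greaterThanLessThan cG(1) smz imgz])
  have over: "pr (z t) = x t" if t: "t \<in> ?I" for t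
  proof -
    have "((\<lambda>s. pr (z s) - x s) has_vector_derivative 0) (at s)" if s: "s \<in> ?I" for s
    proof -
      note d = pr_differentiable[OF mem(3)[OF s]]
      have eq: "DD pr (z s) (ell (z s) (u s cG)) = v s"
        unfolding pr_ell[OF mem(3)[OF s]] P_eq[symmetric] u_def R(2) by (rule B_C[OF mem(3)[OF s]])
      from has_derivative_compose[OF der(3)[OF s, unfolded has_vector_derivative_def] DD_works[OF d]]
      have "((\<lambda>s. pr (z s)) has_vector_derivative v s) (at s)"
        by (simp add: has_vector_derivative_def linear_scale[OF linear_frechet_derivative[OF d]] eq)
      from has_vector_derivative_diff[OF this der(1)[OF s]] show ?thesis by simp
    qed
    then obtain r where "\<And>s. s \<in> ?I \<Longrightarrow> pr (z s) - x s = r"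
      using has_vector_derivative_zero_constant[of ?I "\<lambda>s. pr (z s) - x s"]
      by (metis convex_real_interval(8) has_vector_derivative_at_within)
    from this[OF t] this[OF t0] show ?thesis by (simp add: init pr_z0)
  qed
  have "k t = coset_act G (\<gamma> t) H \<and> left_velocity G AG \<gamma> t \<in> m - {0}" if t: "t \<in> ?I" for t
  proof
    have "chart_inv c (snd c (coset_proj G H (el (z t)))) = coset_proj G H (el (z t))"
      by (rule AM.chart_inv_chart[OF c(1) pr(3)[OF mem(3)[OF t]]])
    then show "k t = coset_act G (\<gamma> t) H"
      using over[OF t] by (simp add: act_H k_def \<gamma>_def pr_def pt_def)
    have ug: "u t \<in> lie_algebra G AG" unfolding u_def by (rule m_tangent[OF R(1)])
    have gt: "\<gamma> t \<in> carrier G" unfolding \<gamma>_def by (rule el_Z[OF mem(3)[OF t]])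
    have "velocity AG \<gamma> t cG = left_invariant_vf G AG (u t) (\<gamma> t) cG"
      using velocity_of_chart[OF open_greaterThanLessThan t cG(1) imgz der(3)[OF t]]
        left_invariant_chart[OF ug mem(3)[OF t]] by (simp add: \<gamma>_def[abs_def] el_def)
    then have "velocity AG \<gamma> t = left_invariant_vf G AG (u t) (\<gamma> t)"
      using el_in[OF mem(3)[OF t]]
      by (intro AG.tangent_ext[OF velocity_tangent[OF atlasG cur t] left_invariant_tangent[OF ug gt] cG(1)])
        (simp add: \<gamma>_def)
    then have "left_velocity G AG \<gamma> t = u t" by (rule left_velocity_translate[where \<gamma> = \<gamma>, OF ug gt])
    moreover have "u t \<noteq> 0"
    proof
      assume "u t = 0"
      then have "C (z t) (v t) = 0" using R(2)[of "C (z t) (v t)"] by (simp add: u_def P_linear)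
      then have "v t = 0" using B_C[OF mem(3)[OF t], of "v t"] linear_0[OF linear_B[OF mem(3)[OF t]]] by simp
      then show False using mem(2)[OF t] by simp
    qed
    ultimately show "left_velocity G AG \<gamma> t \<in> m - {0}" using R(1) by (simp add: u_def)
  qed
  then have "is_lift G AG H m ?I k \<gamma>"
    using cur by (simp add: is_lift_def \<gamma>_def init el_z0)
  then show ?thesis using e geo k0 vel by blast
qed

text \<open>Translating the velocity of \<open>\<gamma>\<close> back to the identity and projecting is the same as projecting
first and translating back by the action.\<close>

lemma P_left_velocity:
  assumes cur: "smooth_curve AG I \<gamma>" and t: "t \<in> I" and g: "\<gamma> t = el z" and z: "z \<in> Z"
  shows "P (left_velocity G AG \<gamma> t) = C z (velocity AM (\<lambda>s. coset_proj G H (\<gamma> s)) t c)"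
proof -
  let ?v = "velocity AG \<gamma> t" and ?L = "left_trans G (inv\<^bsub>G\<^esub> (el z))" and ?b = "coset_act G (inv\<^bsub>G\<^esub> (el z))"
  note ge = el_Z[OF z] and gi = inv_closed[OF el_Z[OF z]]
  note pz = el_point[OF ge]
  have v: "?v \<in> tangent_space AG (el z)" using velocity_tangent[OF atlasG cur t] g by simp
  have one: "?L (el z) = \<one>\<^bsub>G\<^esub>" using ge by (simp add: left_trans_def)
  have "P (left_velocity G AG \<gamma> t)
      = tangent_map AG AM (\<lambda>h. coset_proj G H (?L h)) (el z) ?v c"
    using tangent_map_compose[OF atlasG atlasG smooth_left[OF gi] smooth_proj v pz]
    by (simp add: P_def base_tangent_def left_velocity_def g one)
  also have "\<dots> = tangent_map AG AM (\<lambda>h. ?b (coset_proj G H h)) (el z) ?v c"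
    by (subst tangent_map_cong[OF atlasG pz, of "\<lambda>h. coset_proj G H (?L h)" "\<lambda>h. ?b (coset_proj G H h)"])
      (simp_all only: chartsG act_proj[OF gi] left_trans_def)
  also have "\<dots> = tangent_map AM AM ?b (coset_proj G H (el z)) (tangent_map AG AM (coset_proj G H) (el z) ?v) c"
    using tangent_map_compose[OF atlasG atlasM smooth_proj smooth_act[OF gi] v pz] by simp
  also have "\<dots> = C z (tangent_map AG AM (coset_proj G H) (el z) ?v c)"
    by (rule tangent_iact[OF z tangent_map_tangent[OF atlasG atlasM smooth_proj v pz]])
  also have "tangent_map AG AM (coset_proj G H) (el z) ?v = velocity AM (\<lambda>s. coset_proj G H (\<gamma> s)) t"
    using velocity_compose[OF atlasG atlasM cur t smooth_proj] v g by simp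
  finally show ?thesis .
qed

text \<open>The velocity of a lifted geodesic \<open>x\<close> is \<open>x' = B(z) w\<close> with \<open>w\<close> the image of the left
  velocity; comparing the derivative of this at time \<open>0\<close> with the geodesic equation yields \<open>w'\<close>.\<close>

lemma spray_vector_field_eq:
  assumes y: "y \<in> m - {0}"
  shows "spray_vector_field G AG H AM S m y = R (2 *\<^sub>R Gs x0 (P y) + a y (P y))"
proof -
  define \<gamma> where "\<gamma> = geodesic_lift G AG H AM S m y"
  have "\<exists>\<epsilon>>0. \<exists>k. geodesic AM S {-\<epsilon><..<\<epsilon>} k \<and> k 0 = H \<and>
      velocity AM k 0 = base_tangent G AG H AM y \<and> is_lift G AG H m {-\<epsilon><..<\<epsilon>} k \<gamma>"
    unfolding \<gamma>_def geodesic_lift_def by (rule someI_ex[OF geodesic_lift_exists[OF y]])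
  then obtain e k where e: "e > 0" and geo: "geodesic AM S {-e<..<e} k" and k0: "k 0 = H"
    and vel: "velocity AM k 0 = base_tangent G AG H AM y" and lift: "is_lift G AG H m {-e<..<e} k \<gamma>"
    by blast
  let ?I = "{-e<..<e}"
  have t0: "0 \<in> ?I" using e by simp
  have cur: "smooth_curve AG ?I \<gamma>" and g0: "\<gamma> 0 = \<one>\<^bsub>G\<^esub>"
    and kt: "\<And>t. t \<in> ?I \<Longrightarrow> k t = coset_proj G H (\<gamma> t)"
    and lv: "\<And>t. t \<in> ?I \<Longrightarrow> left_velocity G AG \<gamma> t \<in> m"
    using lift by (auto simp: is_lift_def act_H)
  have kc: "smooth_curve AM ?I k" using geo by (simp add: geodesic_def)
  obtain V where V: "open V" "0 \<in> V" "V \<subseteq> ?I" "\<And>s. s \<in> V \<Longrightarrow> \<gamma> s \<in> fst cG"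
    "smooth_on V (\<lambda>s. snd cG (\<gamma> s))"
    by (rule smooth_curveD[OF cur t0 cG(1)]) (use cG g0 in auto)
  obtain V' where V': "open V'" "0 \<in> V'" "V' \<subseteq> ?I" "\<And>s. s \<in> V' \<Longrightarrow> k s \<in> fst c"
    "smooth_on V' (\<lambda>s. snd c (k s))" "smooth_on V' (\<lambda>s. velocity AM k s c)"
    by (rule AM.smooth_velocity[OF kc t0 c(1)]) (use c k0 in auto)
  define z where "z s = snd cG (\<gamma> s)" for s
  define J where "J = V' \<inter> (V \<inter> z -` Z)"
  have oJ: "open J"
    unfolding J_def z_def
    by (intro open_Int V'(1) continuous_open_preimage[OF smooth_on_continuous[OF V(5)] V(1) Z(1)])
  have J0: "0 \<in> J" using V(2) V'(2) Z(2) by (simp add: J_def z_def g0 z0_def)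
  have J: "s \<in> ?I" "z s \<in> Z" "el (z s) = \<gamma> s" if "s \<in> J" for s
    using that V(3) AG.chart_inv_chart[OF cG(1) V(4)[of s]] by (auto simp: J_def z_def el_def)
  have z_0: "z 0 = z0" by (simp add: z_def g0 z0_def)
  have smz: "smooth_on J z" unfolding z_def by (rule smooth_on_subset[OF V(5)]) (auto simp: J_def)
  define \<xi> where "\<xi> s = velocity AM k s c" for s
  have sm\<xi>: "smooth_on J \<xi>" unfolding \<xi>_def by (rule smooth_on_subset[OF V'(6)]) (auto simp: J_def)
  define w where "w s = C (z s) (\<xi> s)" for s
  have vk: "velocity AM (\<lambda>s. coset_proj G H (\<gamma> s)) t c = \<xi> t" if t: "t \<in> J" for t
  proof -
    have kc': "k t \<in> fst c" using t V'(4) by (simp add: J_def)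
    have "((\<lambda>s. snd c (coset_proj G H (\<gamma> s))) has_vector_derivative \<xi> t) (at t)"
      by (rule has_vector_derivative_transform_within_open[OF
            velocity_chart[OF kc J(1)[OF t] c(1) kc', folded \<xi>_def] open_greaterThanLessThan J(1)[OF t]])
        (simp add: kt)
    then show ?thesis
      using c(1) kc' kt[OF J(1)[OF t]] by (simp add: velocity_def comp_def vector_derivative_at)
  qed
  have Pw: "P (left_velocity G AG \<gamma> s) = w s" if "s \<in> J" for s
    using P_left_velocity[OF cur J(1)[OF that] J(3)[OF that, symmetric] J(2)[OF that]] vk[OF that]
    by (simp add: w_def)
  have lvR: "left_velocity G AG \<gamma> s = R (w s)" if "s \<in> J" for s
    using R_P[OF lv[OF J(1)[OF that]]] Pw[OF that] by simp
  have Bw: "B (z s) (w s) = \<xi> s" if "s \<in> J" for s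
    unfolding w_def by (rule B_C[OF J(2)[OF that]])
  have smw: "smooth_on J w"
  proof -
    have "(\<lambda>s. (z s, \<xi> s)) ` J \<subseteq> Z \<times> UNIV" using J(2) by auto
    from smooth_on_compose[OF oJ smooth_on_Pair[OF oJ smz sm\<xi>] smooth_C this]
    show ?thesis by (simp add: w_def[abs_def])
  qed
  have \<xi>0: "\<xi> 0 = P y" by (simp add: \<xi>_def vel P_def)
  have w0: "w 0 = P y" using Bw[OF J0] by (simp add: z_0 B_z0 \<xi>0)
  have lv0: "left_velocity G AG \<gamma> 0 = y" using lvR[OF J0] R_P y by (simp add: w0)
  have v0: "velocity AG \<gamma> 0 = y"
  proof -
    have "velocity AG \<gamma> 0 \<in> lie_algebra G AG" using velocity_tangent[OF atlasG cur t0] g0 by simp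
    from left_velocity_translate[OF this, of \<gamma> 0] left_invariant_one[OF this] show ?thesis
      using lv0 g0 by simp
  qed
  have dz: "z differentiable (at 0)" and dw: "w differentiable (at 0)" and d\<xi>: "\<xi> differentiable (at 0)"
    using smooth_on_differentiable[OF smz J0] smooth_on_differentiable[OF smw J0]
      smooth_on_differentiable[OF sm\<xi> J0] .
  have Dz: "DD z 0 1 = y cG"
    using DD_eq[OF velocity_chart[OF cur t0 cG(1), unfolded has_vector_derivative_def]] cG g0 v0
    by (simp add: z_def[abs_def])
  have "(\<xi> has_vector_derivative - 2 *\<^sub>R Gs x0 (P y)) (at 0)"
    using AM.geodesic_acceleration[OF spray geo t0 c(1)] c(2) k0 \<xi>0
    by (simp add: \<xi>_def[abs_def] Gs_def x0_def)
  then have "- 2 *\<^sub>R Gs x0 (P y) = DD \<xi> 0 1"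
    using DD_eq[of \<xi> "\<lambda>h. h *\<^sub>R (- 2 *\<^sub>R Gs x0 (P y))" 0] by (simp add: has_vector_derivative_def)
  also have "DD \<xi> 0 = DD (\<lambda>s. (\<lambda>q. B (fst q) (snd q)) (z s, w s)) 0"
    by (rule DD_cong_open[OF oJ J0]) (simp add: Bw)
  also have "DD (\<lambda>s. (\<lambda>q. B (fst q) (snd q)) (z s, w s)) 0 1 = a y (P y) + DD w 0 1"
  proof -
    have Q: "(\<lambda>q. B (fst q) (snd q)) differentiable (at (z 0, w 0))"
      by (rule smooth_on_differentiable[OF smooth_B]) (simp add: z_0 Z)
    show ?thesis
      unfolding DD_pair_chain[of "\<lambda>q. B (fst q) (snd q)" z 0 w, OF Q dz dw]
      by (simp add: z_0 w0 Dz a_def B_z0)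
  qed
  finally have Dw: "DD w 0 1 = - (2 *\<^sub>R Gs x0 (P y) + a y (P y))"
    by (simp add: algebra_simps eq_neg_iff_add_eq_0)
  have dvw: "(w has_vector_derivative DD w 0 1) (at 0)"
  proof -
    have "DD w 0 = (\<lambda>r. r *\<^sub>R DD w 0 1)"
    proof
      show "DD w 0 r = r *\<^sub>R DD w 0 1" for r
        using linear_scale[OF linear_frechet_derivative[OF dw], of r 1] by simp
    qed
    then show ?thesis using DD_works[OF dw] unfolding has_vector_derivative_def by metis
  qed
  have "tvec_deriv (left_velocity G AG \<gamma>) 0 = R (DD w 0 1)"
    by (rule tvec_deriv_R[OF oJ J0 lvR dvw])
  then show ?thesis
    unfolding spray_vector_field_def \<gamma>_def[symmetric] Dw linear_neg[OF linear_R] by simp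
qed

subsection \<open>The bracket and the connection operator\<close>

lemma vf_chart_eq:
  assumes u: "u \<in> lie_algebra G AG" and z: "z \<in> Z" and d: "d \<in> AG" "el z \<in> fst d"
  shows "vf_in_chart d (left_invariant_vf G AG u) (snd d (el z))
    = DD (transition cG d) z (ell z (u cG))"
  using AG.tangent_transition[OF left_invariant_tangent[OF u el_Z[OF z]] cG(1) d(1) el_in[OF z] d(2)]
    left_invariant_chart[OF u z] AG.chart_inv_chart[OF d] snd_el[OF z]
  by (simp add: vf_in_chart_def)

lemma lie_bracket_chart:
  "lie_bracket G AG y u cG = DD (\<lambda>z. ell z (u cG)) z0 (y cG) - DD (\<lambda>z. ell z (y cG)) z0 (u cG)"
  if y: "y \<in> lie_algebra G AG" and u: "u \<in> lie_algebra G AG"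
proof -
  have "DD (vf_in_chart cG (left_invariant_vf G AG u)) z0 = DD (\<lambda>z. ell z (u cG)) z0"
    if u: "u \<in> lie_algebra G AG" for u
    by (rule DD_cong_open[OF Z(1,2)]) (use left_invariant_chart[OF u] in \<open>simp add: vf_in_chart_def el_def\<close>)
  then show ?thesis
    using cG y u left_invariant_one by (simp add: lie_bracket_def vf_bracket_def z0_def)
qed

text \<open>The components of the bracket are defined chart by chart.  They are those of one tangent vector
because a transition map relates the coordinate expressions of a vector field, so that
\<open>bracket_related\<close> applies to it.\<close>

lemma lie_bracket_tangent:
  assumes y: "y \<in> lie_algebra G AG" and u: "u \<in> lie_algebra G AG"
  shows "lie_bracket G AG y u \<in> lie_algebra G AG"
proof -
  have "lie_bracket G AG y u d = AG.chart_vector cG \<one>\<^bsub>G\<^esub> (lie_bracket G AG y u cG) d" for d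
  proof (cases "d \<in> AG \<and> \<one>\<^bsub>G\<^esub> \<in> fst d")
    case False
    then show ?thesis by (auto simp: lie_bracket_def vf_bracket_def AG.chart_vector_def)
  next
    case True
    then have d: "d \<in> AG" "\<one>\<^bsub>G\<^esub> \<in> fst d" by auto
    let ?p = "transition cG d" and ?q = "transition d cG" and ?x = "snd d \<one>\<^bsub>G\<^esub>"
    define Y where "Y = Z \<inter> snd cG ` (fst cG \<inter> fst d)"
    have oY: "open Y" unfolding Y_def by (intro open_Int Z(1) AG.open_overlap[OF cG(1) d(1)])
    have Y0: "z0 \<in> Y" using Z(2) cG d by (auto simp: Y_def z0_def)
    have sp: "smooth_on Y ?p"
      by (rule smooth_on_subset[OF AG.smooth_transition[OF cG(1) d(1)]]) (simp add: Y_def)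
    have Yd: "z \<in> Z" "el z \<in> fst d" "?p z = snd d (el z)" if "z \<in> Y" for z
      using that AG.overlap_mem[OF cG(1), of z d] by (auto simp: Y_def el_def transition_def)
    define W where "W u z = DD ?p z (ell z (u cG))" for u :: "('g, 'e) tvec" and z
    have W_eq: "vf_in_chart d (left_invariant_vf G AG u) (?p z) = W u z"
      if "u \<in> lie_algebra G AG" "z \<in> Y" for u z
      unfolding W_def Yd(3)[OF that(2)] by (rule vf_chart_eq[OF that(1) Yd(1)[OF that(2)] d(1) Yd(2)[OF that(2)]])
    define X where "X = snd d ` (fst d \<inter> fst cG) \<inter> ?q -` Y"
    have oX: "open X" unfolding X_def
      by (rule continuous_open_preimage[OF smooth_on_continuous[OF AG.smooth_transition[OF d(1) cG(1)]]
            AG.open_overlap[OF d(1) cG(1)] oY])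
    have X0: "?x \<in> X" "?q ?x = z0" "?p z0 = ?x"
      using d cG Y0 AG.transition_chart[OF d, of cG] AG.transition_chart[OF cG, of d]
      by (auto simp: X_def z0_def)
    have sW: "smooth_on Y (W u)" for u
      unfolding W_def
      by (rule smooth_on_DD_apply[OF oY smooth_on_bounded_linear[OF bounded_linear_ident]
            smooth_on_subset[OF smooth_ell_at] sp]) (auto simp: Y_def)
    have dV: "vf_in_chart d (left_invariant_vf G AG u) differentiable (at ?x)"
      if u: "u \<in> lie_algebra G AG" for u
    proof -
      have pq: "?p (?q x) = x" if "x \<in> X" for x
        using that by (auto simp: X_def AG.transition_chart[OF d(1)] AG.transition_chart[OF cG(1)])
      have "smooth_on X (\<lambda>x. W u (?q x))"
        by (rule smooth_on_compose[OF oX smooth_on_subset[OF AG.smooth_transition[OF d(1) cG(1)]] sW])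
          (auto simp: X_def)
      then have "smooth_on X (vf_in_chart d (left_invariant_vf G AG u))"
        by (rule smooth_on_cong_imp[OF oX]) (metis W_eq[OF u] pq X_def IntD2 vimageD)
      then show ?thesis by (rule smooth_on_differentiable[OF _ X0(1)])
    qed
    have DW: "DD (W u) z0 h = DD (vf_in_chart d (left_invariant_vf G AG u)) ?x (DD ?p z0 h)"
      if u: "u \<in> lie_algebra G AG" for u h
    proof -
      have "DD (W u) z0 = DD (\<lambda>z. vf_in_chart d (left_invariant_vf G AG u) (?p z)) z0"
        by (rule DD_cong_open[OF oY Y0]) (simp add: W_eq[OF u])
      then show ?thesis
        using DD_compose[OF smooth_on_differentiable[OF sp Y0]] dV[OF u] X0(3) by simp
    qed
    have tr: "DD ?p z0 (u cG) = u d" if "u \<in> lie_algebra G AG" for u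
      using AG.tangent_transition[OF that cG(1) d(1) cG(2) d(2)] by (simp add: z0_def)
    have "DD ?p z0 (DD (\<lambda>z. ell z (u cG)) z0 (ell z0 (y cG)) - DD (\<lambda>z. ell z (y cG)) z0 (ell z0 (u cG)))
        = DD (W u) z0 (ell z0 (y cG)) - DD (W y) z0 (ell z0 (u cG))"
      by (rule bracket_related[OF oY Y0 sp])
        (auto simp: W_def intro: smooth_on_differentiable[OF smooth_ell_at Z(2)])
    then have "DD ?p z0 (lie_bracket G AG y u cG) = lie_bracket G AG y u d"
      using d left_invariant_one[OF y] left_invariant_one[OF u]
      by (simp add: ell_z0 lie_bracket_chart[OF y u] DW[OF y] DW[OF u] tr[OF y] tr[OF u])
        (simp add: lie_bracket_def vf_bracket_def)
    then show ?thesis using d by (simp add: AG.chart_vector_def z0_def)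
  qed
  then have "lie_bracket G AG y u = AG.chart_vector cG \<one>\<^bsub>G\<^esub> (lie_bracket G AG y u cG)" by blast
  then show ?thesis using AG.chart_vector_tangent[OF cG] by metis
qed

text \<open>The same lemma, applied to the projection, which maps the left-invariant fields to \<open>B z (P y)\<close> and
\<open>B z (P u)\<close>.\<close>

lemma P_lie_bracket:
  assumes y: "y \<in> lie_algebra G AG" and u: "u \<in> lie_algebra G AG"
  shows "P (lie_bracket G AG y u) = a y (P u) - a u (P y)"
proof -
  have "DD pr z0 (DD (\<lambda>z. ell z (u cG)) z0 (ell z0 (y cG)) - DD (\<lambda>z. ell z (y cG)) z0 (ell z0 (u cG)))
      = DD (\<lambda>z. B z (P u)) z0 (ell z0 (y cG)) - DD (\<lambda>z. B z (P y)) z0 (ell z0 (u cG))"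
    by (rule bracket_related[OF Z(1,2) pr(1)])
      (auto simp: pr_ell P_eq intro: smooth_on_differentiable[OF smooth_ell_at Z(2)])
  then show ?thesis
    unfolding P_eq[of "lie_bracket G AG y u"] lie_bracket_chart[OF y u] by (simp add: ell_z0 a_def)
qed

lemma bracket_m_eq: "y \<in> m \<Longrightarrow> u \<in> m \<Longrightarrow> bracket_m G AG H m y u = R (a y (P u) - a u (P y))"
  unfolding bracket_m_def
  by (simp add: proj_along_eq lie_bracket_tangent m_tangent P_lie_bracket)

lemma Gs_differentiable: "v \<noteq> 0 \<Longrightarrow> Gs x0 differentiable (at v)"
proof -
  assume v: "v \<noteq> 0"
  have "(\<lambda>z. Gs (fst z) (snd z)) differentiable (at (x0, v))"
    unfolding Gs_def
    by (rule smooth_on_differentiable[OF AM.smooth_spray_coeff[OF spray c(1)]]) (use v N in auto)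
  moreover have "(\<lambda>v. (x0, v)) differentiable (at v)" by simp
  ultimately have "((\<lambda>z. Gs (fst z) (snd z)) \<circ> (\<lambda>v. (x0, v))) differentiable (at v)"
    using differentiable_chain_at by blast
  then show ?thesis by (simp add: comp_def)
qed

text \<open>By bilinearity \<open>D\<eta>(y, u)\<close> contributes \<open>a u (P y) + a y (P u)\<close>, and the bracket contributes
\<open>a y (P u) - a u (P y)\<close>.  One half of each of them adds up to \<open>a y (P u)\<close>.\<close>

lemma connection_operator_eq:
  assumes y: "y \<in> m - {0}" and u: "u \<in> m"
  shows "connection_operator G AG H AM S m y u + bracket_m G AG H m y u
    = R (DD (Gs x0) (P y) (P u) + a y (P u))"
proof -
  let ?v = "P y" and ?w = "P u"
  define h where "h t = 2 *\<^sub>R Gs x0 (?v + t *\<^sub>R ?w) + (a y ?v + t *\<^sub>R (a u ?v + a y ?w) + (t * t) *\<^sub>R a u ?w)" for t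
  define I where "I = (\<lambda>t. ?v + t *\<^sub>R ?w) -` (- {0})"
  have oI: "open I" unfolding I_def by (intro open_vimage continuous_intros open_Compl closed_singleton)
  have I0: "0 \<in> I" using P_nonzero[OF y] by (simp add: I_def)
  have eta: "spray_vector_field G AG H AM S m (y + t *\<^sub>R u) = R (h t)" if "t \<in> I" for t
  proof -
    have Pt: "P (y + t *\<^sub>R u) = ?v + t *\<^sub>R ?w" by (simp add: P_linear)
    have "y + t *\<^sub>R u \<in> m - {0}"
    proof -
      have "y + t *\<^sub>R u \<in> m" using y u by (intro subspace_add subspace_scale m_subspace) auto
      moreover have "y + t *\<^sub>R u \<noteq> 0" using that Pt P_linear(4) by (auto simp: I_def)
      ultimately show ?thesis by blast
    qed
    from spray_vector_field_eq[OF this] show ?thesis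
      unfolding Pt h_def by (simp add: a_left a_right algebra_simps)
  qed
  have "((\<lambda>t. ?v + t *\<^sub>R ?w) has_derivative (\<lambda>t. t *\<^sub>R ?w)) (at 0)"
    by (auto intro!: derivative_eq_intros)
  moreover have "(Gs x0 has_derivative DD (Gs x0) ?v) (at (?v + 0 *\<^sub>R ?w))"
    using DD_works[OF Gs_differentiable[OF P_nonzero[OF y]]] by simp
  ultimately have "((\<lambda>t. Gs x0 (?v + t *\<^sub>R ?w)) has_derivative (\<lambda>t. DD (Gs x0) ?v (t *\<^sub>R ?w))) (at 0)"
    by (rule has_derivative_compose)
  then have dG: "((\<lambda>t. Gs x0 (?v + t *\<^sub>R ?w)) has_vector_derivative DD (Gs x0) ?v ?w) (at 0)"
    by (simp add: has_vector_derivative_def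
        linear_scale[OF linear_frechet_derivative[OF Gs_differentiable[OF P_nonzero[OF y]]]])
  have "(h has_vector_derivative 2 *\<^sub>R DD (Gs x0) ?v ?w + (a u ?v + a y ?w)) (at 0)"
    unfolding h_def by (auto intro!: derivative_eq_intros dG)
  from tvec_deriv_R[OF oI I0 eta this]
  have "tvec_deriv (\<lambda>t. spray_vector_field G AG H AM S m (y + t *\<^sub>R u)) 0
      = R (2 *\<^sub>R DD (Gs x0) ?v ?w + (a u ?v + a y ?w))"
    by simp
  then have "connection_operator G AG H AM S m y u + bracket_m G AG H m y u
      = (1/2) *\<^sub>R R (2 *\<^sub>R DD (Gs x0) ?v ?w + (a u ?v + a y ?w)) + (1/2) *\<^sub>R R (a y ?w - a u ?v)"
    using y u scaleR_half_double[of "R (a y ?w - a u ?v)"]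
    by (simp add: connection_operator_def bracket_m_eq scaleR_add_right algebra_simps)
  also have "\<dots> = R ((1/2) *\<^sub>R (2 *\<^sub>R DD (Gs x0) ?v ?w + (a u ?v + a y ?w)) + (1/2) *\<^sub>R (a y ?w - a u ?v))"
    by (simp only: linear_add[OF linear_R] linear_scale[OF linear_R])
  also have "(1/2) *\<^sub>R (2 *\<^sub>R DD (Gs x0) ?v ?w + (a u ?v + a y ?w)) + (1/2) *\<^sub>R (a y ?w - a u ?v)
      = DD (Gs x0) ?v ?w + a y ?w"
    by (simp add: scaleR_add_right scaleR_diff_right flip: scaleR_add_left)
  finally show ?thesis .
qed

end


section \<open>Invariant measures\<close>

text \<open>Coordinate maps are homeomorphisms, so open sets of coordinates define measurable sets.\<close>

lemma open_chart_image:
  assumes X: "smooth_manifold X A" and c: "c \<in> A" and E: "open E" "E \<subseteq> chart_img c"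
  shows "openin X (chart_inv c ` E)"
proof -
  have hom: "homeomorphic_map (subtopology X (fst c)) (top_of_set (chart_img c)) (snd c)"
    and op: "openin X (fst c)"
  proof -
    have "is_chart X c" using X c by (simp add: smooth_manifold_def)
    then show "homeomorphic_map (subtopology X (fst c)) (top_of_set (chart_img c)) (snd c)"
        "openin X (fst c)"
      by (simp_all add: is_chart_def)
  qed
  have top: "topspace (subtopology X (fst c)) = fst c" using openin_subset[OF op] by auto
  have sub: "chart_inv c ` E \<subseteq> fst c" by (rule image_subsetI) (rule chart_inv_in[OF subsetD[OF E(2)]])
  have "snd c (chart_inv c x) = x" if "x \<in> E" for x by (rule chart_chart_inv[OF subsetD[OF E(2) that]])
  then have "snd c ` chart_inv c ` E = E" by (simp add: image_image)
  moreover have "openin (top_of_set (chart_img c)) E" using E open_subset by blast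
  ultimately have "openin (subtopology X (fst c)) (chart_inv c ` E)"
    using homeomorphic_map_openness[OF hom, unfolded top, OF sub] by simp
  then show ?thesis using op openin_trans_full by blast
qed

context homogeneous_chart
begin

text \<open>In the chart, the action of \<open>el z\<close> is an injective smooth map that preserves the density \<open>\<sigma>\<close>, and
its Jacobian at the base point is the determinant of \<open>B z\<close>.\<close>

lemma density_action:
  assumes \<mu>: "smooth_measure TM AM \<mu>" "invariant_measure G \<mu>" and \<sigma>: "local_density \<mu> c \<sigma>" and z: "z \<in> Z"
  shows "\<sigma> (pr z) * \<bar>edet (B z)\<bar> = \<sigma> x0"
proof -
  define f where "f x = act (z, x)" for x
  have TM: "smooth_manifold TM AM" using homogeneous by (simp add: homogeneous_space_def)
  have sf: "smooth_on N f"
  proof -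
    have "smooth_on N (\<lambda>x. (z, x))"
      by (rule smooth_on_Pair[OF N(1) smooth_on_const smooth_on_bounded_linear[OF bounded_linear_ident]])
    moreover have "Pair z ` N \<subseteq> Z \<times> N" using z by auto
    ultimately show ?thesis
      using smooth_on_compose[OF N(1) _ act(1)] unfolding f_def by fastforce
  qed
  have pt: "pt x \<in> fst c" if "x \<in> N" for x using that N(3) chart_inv_in[of x c] unfolding pt_def by blast
  have actpt: "coset_act G (el z) (pt x) = pt (f x)" if "x \<in> N" for x
    using AM.chart_inv_chart[OF c(1) act(2)[OF z that]] by (simp add: f_def act_def pt_def)
  have fimg: "f ` N \<subseteq> chart_img c"
    using chart_in_img[OF act(2)[OF z]] by (auto simp: f_def act_def)
  have inj: "inj_on f N"
  proof (rule inj_onI)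
    fix x x' assume x: "x \<in> N" "x' \<in> N" and "f x = f x'"
    then have "coset_act G (el z) (pt x) = coset_act G (el z) (pt x')" by (simp add: actpt)
    then have "pt x = pt x'"
      using act_inverse(1)[OF el_Z[OF z], of "pt x"] act_inverse(1)[OF el_Z[OF z], of "pt x'"] pt[OF x(1)]
        pt[OF x(2)] c(1) by (metis UN_I)
    then show "x = x'"
      using chart_chart_inv[of x c] chart_chart_inv[of x' c] x N(3) unfolding pt_def by (metis subsetD)
  qed
  have meas: "emeasure \<mu> (pt ` E) = (\<integral>\<^sup>+x\<in>E. ennreal (\<sigma> x) \<partial>lborel)" "pt ` E \<in> sets \<mu>"
    if E: "open E" "E \<subseteq> chart_img c" for E
  proof -
    have op: "openin TM (pt ` E)" unfolding pt_def by (rule open_chart_image[OF TM c(1) E])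
    then show s: "pt ` E \<in> sets \<mu>" using \<mu>(1) unfolding smooth_measure_def by auto
    have "snd c (pt x) = x" if "x \<in> E" for x unfolding pt_def by (rule chart_chart_inv[OF subsetD[OF E(2) that]])
    then have "snd c ` pt ` E = E" by (simp add: image_image)
    moreover have "pt ` E \<subseteq> fst c" unfolding pt_def by (rule image_subsetI) (rule chart_inv_in[OF subsetD[OF E(2)]])
    ultimately show "emeasure \<mu> (pt ` E) = (\<integral>\<^sup>+x\<in>E. ennreal (\<sigma> x) \<partial>lborel)"
      using \<sigma> s unfolding local_density_def by metis
  qed
  have inv: "(\<integral>\<^sup>+x\<in>f ` E. ennreal (\<sigma> x) \<partial>lborel) = (\<integral>\<^sup>+x\<in>E. ennreal (\<sigma> x) \<partial>lborel)"
    if E: "open E" "E \<subseteq> N" for E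
  proof -
    have "open (f ` E)"
      using continuous_on_subset[OF smooth_on_continuous[OF sf] E(2)] E(1) inj_on_subset[OF inj E(2)]
      by (rule invariance_of_domain)
    moreover have "f ` E \<subseteq> chart_img c" using fimg E(2) by blast
    moreover have "coset_act G (el z) ` pt ` E = pt ` f ` E"
      unfolding image_image using actpt E(2) by (intro image_cong) auto
    ultimately show ?thesis
      using meas(1)[of "f ` E"] meas[OF E(1)] E(2) N(3) \<mu>(2) el_Z[OF z]
      unfolding invariant_measure_def by (metis subset_trans)
  qed
  have "\<sigma> (f x0) * \<bar>edet (DD f x0)\<bar> = \<sigma> x0"
    by (rule density_jacobian[OF N(1,2) sf inj AM.open_img[OF c(1)] _ _ N(3) fimg inv])
      (use \<sigma> in \<open>auto simp: local_density_def intro: smooth_on_continuous\<close>)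
  moreover have "f x0 = pr z" by (simp add: f_def act_def pr_def pt_x0 act_H)
  moreover have "DD f x0 = B z" using B_slice[OF z] by (simp add: f_def[abs_def])
  ultimately show ?thesis by simp
qed

text \<open>The derivative at the identity of \<open>\<sigma> (pr z) \<bar>det (B z)\<bar> = \<sigma> x0\<close>.  Near the identity the determinant is
positive, so the absolute value may be dropped, and its derivative is a trace.\<close>

lemma density_derivative:
  assumes \<mu>: "smooth_measure TM AM \<mu>" "invariant_measure G \<mu>" and \<sigma>: "local_density \<mu> c \<sigma>"
  shows "DD \<sigma> x0 (DD pr z0 h) + \<sigma> x0 * (\<Sum>b\<in>Basis. DD (\<lambda>z. B z b) z0 h \<bullet> b) = 0"
proof -
  have dB: "((\<lambda>z. edet (B z)) has_derivative (\<lambda>h. \<Sum>b\<in>Basis. DD (\<lambda>z. B z b) z0 h \<bullet> b)) (at z0)"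
    by (rule has_derivative_edet_at_ident)
      (auto simp: B_z0 intro: DD_works smooth_on_differentiable[OF smooth_B_at Z(2)])
  have det1: "edet (B z0) = 1" using edet_ident B_z0 by (metis ext)
  have "\<sigma> differentiable (at x0)"
    using \<sigma> N smooth_on_differentiable unfolding local_density_def by blast
  from DD_works[OF this]
  have d\<sigma>: "((\<lambda>z. \<sigma> (pr z)) has_derivative (\<lambda>h. DD \<sigma> x0 (DD pr z0 h))) (at z0)"
    using has_derivative_compose[OF DD_works[OF smooth_on_differentiable[OF pr(1) Z(2)]], of \<sigma> "DD \<sigma> x0"]
    by (simp add: pr_z0)
  have "\<forall>\<^sub>F z in at z0. edet (B z) > 0"
    using has_derivative_continuous[OF dB] det1
    by (intro order_tendstoD) (auto simp: continuous_at)
  moreover have "\<forall>\<^sub>F z in at z0. z \<in> Z" using Z by (intro eventually_at_in_open') auto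
  ultimately have ev: "\<forall>\<^sub>F z in at z0. \<sigma> (pr z) * edet (B z) = \<sigma> x0"
    by eventually_elim (use density_action[OF \<mu> \<sigma>] in force)
  have "((\<lambda>z. \<sigma> (pr z) * edet (B z)) has_derivative
      (\<lambda>h. \<sigma> (pr z0) * (\<Sum>b\<in>Basis. DD (\<lambda>z. B z b) z0 h \<bullet> b) + DD \<sigma> x0 (DD pr z0 h) * edet (B z0))) (at z0)"
    by (rule has_derivative_mult[OF d\<sigma> dB])
  moreover have "((\<lambda>z. \<sigma> (pr z) * edet (B z)) has_derivative (\<lambda>h. 0)) (at z0)"
    by (rule has_derivative_transform_eventually[OF has_derivative_const[of "\<sigma> x0"]])
      (use ev in \<open>auto simp: eq_commute pr_z0 det1\<close>)
  ultimately have "(\<lambda>h. \<sigma> (pr z0) * (\<Sum>b\<in>Basis. DD (\<lambda>z. B z b) z0 h \<bullet> b)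
      + DD \<sigma> x0 (DD pr z0 h) * edet (B z0)) = (\<lambda>h. 0)"
    by (rule has_derivative_unique)
  from fun_cong[OF this, of h] show ?thesis by (simp add: pr_z0 det1)
qed

end

section \<open>The S-curvature\<close>

text \<open>The density that occurs in the definition of the S-curvature is a chosen one, but all that
matters is its logarithmic derivative along \<open>P y\<close>, which \<open>density_derivative\<close> turns into the trace of
\<open>a y\<close>.\<close>

lemma (in homogeneous_spray_chart) S_curvature_eq:
  assumes \<mu>: "smooth_measure TM AM \<mu>" "invariant_measure G \<mu>" and y: "y \<in> m - {0}"
  shows "S_curvature AM S \<mu> c H (base_tangent G AG H AM y)
    = lin_trace m (\<lambda>w. connection_operator G AG H AM S m y w + bracket_m G AG H m y w)"
proof -
  define \<sigma> where "\<sigma> = (SOME \<sigma>. local_density \<mu> c \<sigma>)"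
  have "\<exists>\<sigma>. local_density \<mu> c \<sigma>" using \<mu>(1) c(1) unfolding smooth_measure_def by blast
  then have \<sigma>: "local_density \<mu> c \<sigma>" unfolding \<sigma>_def by (rule someI_ex)
  have "x0 \<in> chart_img c" using N by blast
  then have pos: "\<sigma> x0 > 0" and d\<sigma>: "\<sigma> differentiable (at x0)"
    using \<sigma> smooth_on_differentiable unfolding local_density_def by blast+
  note dG = Gs_differentiable[OF P_nonzero[OF y]]
  have "(\<Sum>b\<in>Basis. (P y \<bullet> b) / \<sigma> x0 * DD \<sigma> x0 b) = DD \<sigma> x0 (P y) / \<sigma> x0"
    by (simp add: DD_basis_expand[OF d\<sigma>, of "P y"] sum_divide_distrib)
  also have "\<dots> = - (\<Sum>b\<in>Basis. a y b \<bullet> b)"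
    using density_derivative[OF \<mu> \<sigma>, of "y cG"] pos
    by (simp add: P_eq[symmetric] a_def[symmetric] field_simps eq_neg_iff_add_eq_0)
  finally have "S_curvature AM S \<mu> c H (base_tangent G AG H AM y)
      = (\<Sum>b\<in>Basis. (DD (Gs x0) (P y) b + a y b) \<bullet> b)"
    unfolding S_curvature_def \<sigma>_def[symmetric] P_def[symmetric] x0_def[symmetric] Gs_def[symmetric]
    by (simp add: Let_def inner_add_left sum.distrib)
  also have "\<dots> = lin_trace m (\<lambda>w. connection_operator G AG H AM S m y w + bracket_m G AG H m y w)"
  proof (rule lin_trace_transport[symmetric])
    show "linear (\<lambda>b. DD (Gs x0) (P y) b + a y b)"
      by (intro linear_compose_add linear_frechet_derivative[OF dG] linear_a)
  qed (simp_all add: m_subspace linear_R R R_P connection_operator_eq[OF y])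
  finally show ?thesis .
qed

theorem theoremE:
  fixes G :: "('g, 'z) monoid_scheme"
    and TG :: "'g topology"
    and AG :: "('g, 'e::euclidean_space) chart set"
    and H :: "'g set"
    and TM :: "'g set topology"
    and AM :: "('g set, 'f::euclidean_space) chart set"
    and S :: "('g set, 'f) slit_vf"
    and m :: "('g, 'e) tvec set"
    and \<mu> :: "'g set measure"
    and y :: "('g, 'e) tvec"
    and c :: "('g set, 'f) chart"
  assumes "homogeneous_spray_manifold G TG AG H TM AM S"
    and "direct_sum_of (lie_algebra G AG) (subgroup_lie_algebra G AG H) m"
    and "Ad_unimodular G AG H"
    and "smooth_measure TM AM \<mu>"
    and "invariant_measure G \<mu>"
    and "y \<in> m - {0}"
    and "c \<in> AM" and "H \<in> fst c"
  shows "S_curvature AM S \<mu> c H (base_tangent G AG H AM y)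
         = lin_trace m (\<lambda>w. connection_operator G AG H AM S m y w + bracket_m G AG H m y w)"
proof -
  have "homogeneous G TG AG H TM AM c"
    using assms(1,7,8) by (simp add: homogeneous_def homogeneous_spray_manifold_def)
  then obtain Z N where "homogeneous_chart G TG AG H TM AM c Z N"
    using homogeneous.homogeneous_chart_exists by blast
  then interpret homogeneous_spray_chart G TG AG H TM AM c Z N m S
    using assms(1,2)
    by (simp add: homogeneous_spray_chart_def homogeneous_spray_chart_axioms_def decomposed_chart_def decomposed_chart_axioms_def
        homogeneous_spray_manifold_def)
  show ?thesis by (rule S_curvature_eq[OF assms(4,5,6)])
qed

end
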